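(* Let $F:\mathcal X\to\mathcal Y$ be a refinement of étale proper groupoids with corners. Then $F^*:A^*(\mathcal Y)\to A^*(\mathcal X)$ is an isomorphism with inverse $F_*:A^*(\mathcal X)\to A^*(\mathcal Y)$, taken with respect to the canonical relative orientation of $F$.
   Context: An étale proper groupoid with corners $\mathcal X$ is a groupoid whose object set $X_0$ and morphism set $X_1$ are manifolds with corners of the same dimension, with source and target maps $s,t:X_1\to X_0$ local diffeomorphisms (hence so are the composition, inverse and identity maps), and with $s\times t:X_1\to X_0\times X_0$ proper. A smooth functor $F:\mathcal X\to\mathcal Y$ is a functor whose maps $F_0:X_0\to Y_0$ and $F_1:X_1\to Y_1$ are smooth. $F$ is a refinement if it is an equivalence of categories and $F_0$ (hence $F_1$) is a local diffeomorphism. A subset $C\subset X_0$ is clean if $t|_{s^{-1}(C)}$ is proper. A subset $C\subset X_1$ is clean if it is closed and $s(C),t(C)$ are clean. $A_{cl}^*(X_i)\subset A^*(X_i)$ is the space of smooth forms with clean support. Push-forward of forms along a local diffeomorphism $h$ (with respect to the canonical relative orientation $[\det dh]$) is summation over fibers, defined for forms on whose support $h$ is proper: $(h_*\beta)_y=\sum_{z\in h^{-1}(y)}((dh_z)^{-1})^*\beta_z$. $A^*(\mathcal X)=\ker(s^*-t^*:A^*(X_0)\to A^*(X_1))$ and $A_{cl}^*(\mathcal X)=\mathrm{coker}(s_*-t_*:A_{cl}^*(X_1)\to A_{cl}^*(X_0))$. $J:A_{cl}^*(\mathcal X)\to A^*(\mathcal X)$ is $J([\alpha])=t_*s^*\alpha$.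 A partition of unity for $\mathcal X$ is a smooth $\rho:X_0\to[0,1]$ with clean support such that $t_*s^*\rho=1$ (one always exists), and $K:A^*(\mathcal X)\to A_{cl}^*(\mathcal X)$, $K(\alpha)=[\rho\alpha]$, is inverse to $J$. $F^*\alpha=F_0^*\alpha$ on $A^*(\mathcal Y)$. A refinement is a proper map (on spaces of isomorphism classes), $F_0$ is proper on clean subsets, and $F_*[\alpha]=[(F_0)_*\alpha]$ defines $F_*:A_{cl}^*(\mathcal X)\to A_{cl}^*(\mathcal Y)$. The push-forward $F_*:A^*(\mathcal X)\to A^*(\mathcal Y)$ is defined as the composite $J\circ F_*\circ K$, i.e. $F_*\xi=t_*s^*((F_0)_*(\rho\xi))$ with $\rho$ a partition of unity for $\mathcal X$. *)

theory Defs
  imports "HOL-Analysis.Analysis"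
begin

section \<open>Smooth maps between subsets of Euclidean space\<close>

text \<open>
  The model of dimension \<open>n\<close> is a real inner product space with a finite orthonormal basis of
  \<open>n\<close> elements. The class \<open>euclidean_space\<close> is not used because it excludes \<open>n = 0\<close>.
\<close>

definition orthonormal_basis :: "'e::real_inner set \<Rightarrow> bool" where
  "orthonormal_basis B \<longleftrightarrow>
     finite B \<and> (\<forall>b\<in>B. norm b = 1) \<and> (\<forall>b\<in>B. \<forall>c\<in>B. b \<noteq> c \<longrightarrow> b \<bullet> c = 0) \<and> span B = UNIV"

definition corner :: "'e::real_inner set \<Rightarrow> 'e set" where
  "corner B = {x. \<forall>b\<in>B. 0 \<le> x \<bullet> b}"

primrec C_k_on :: "nat \<Rightarrow> 'e::real_normed_vector set \<Rightarrow> ('e \<Rightarrow> 'f::real_normed_vector) \<Rightarrow> bool" where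
  "C_k_on 0 W f \<longleftrightarrow> continuous_on W f"
| "C_k_on (Suc k) W f \<longleftrightarrow>
     f differentiable_on W \<and> (\<forall>v. C_k_on k W (\<lambda>x. frechet_derivative f (at x) v))"

text \<open>On an arbitrary set, smooth means locally extendable to a smooth map on an open set.\<close>

definition smooth_on :: "'e::real_normed_vector set \<Rightarrow> ('e \<Rightarrow> 'f::real_normed_vector) \<Rightarrow> bool" where
  "smooth_on S f \<longleftrightarrow>
     (\<forall>p\<in>S. \<exists>W g. open W \<and> p \<in> W \<and> (\<forall>k. C_k_on k W g) \<and> (\<forall>q\<in>S \<inter> W. g q = f q))"


section \<open>Manifolds with corners\<close>

type_synonym ('a, 'e) chart = "'a set \<times> ('a \<Rightarrow> 'e)"

text \<open>The smooth structure is given by an atlas, which need not be maximal.\<close>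

record ('a, 'e) mfd =
  mtop :: "'a topology"
  matlas :: "('a, 'e) chart set"
  mbasis :: "'e set"

abbreviation pts :: "('a, 'e, 'z) mfd_scheme \<Rightarrow> 'a set" where
  "pts M \<equiv> topspace (mtop M)"

definition chart_inv :: "('a, 'e) chart \<Rightarrow> 'e \<Rightarrow> 'a" where
  "chart_inv c = inv_into (fst c) (snd c)"

definition is_chart :: "('a, 'e::real_inner) mfd \<Rightarrow> ('a, 'e) chart \<Rightarrow> bool" where
  "is_chart M c \<longleftrightarrow>
     openin (mtop M) (fst c) \<and>
     openin (top_of_set (corner (mbasis M))) (snd c ` fst c) \<and>
     homeomorphic_map (subtopology (mtop M) (fst c)) (top_of_set (snd c ` fst c)) (snd c)"

text \<open>Domain and coordinate expression of \<open>h\<close> in a source chart \<open>c\<close> and a target chart \<open>d\<close>.\<close>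

definition loc_dom :: "('a, 'e) chart \<Rightarrow> ('b, 'f) chart \<Rightarrow> ('a \<Rightarrow> 'b) \<Rightarrow> 'e set" where
  "loc_dom c d h = snd c ` {x \<in> fst c. h x \<in> fst d}"

definition loc_rep :: "('a, 'e) chart \<Rightarrow> ('b, 'f) chart \<Rightarrow> ('a \<Rightarrow> 'b) \<Rightarrow> 'e \<Rightarrow> 'f" where
  "loc_rep c d h = (\<lambda>p. snd d (h (chart_inv c p)))"

definition manifold_with_corners :: "('a, 'e::real_inner) mfd \<Rightarrow> bool" where
  "manifold_with_corners M \<longleftrightarrow>
     orthonormal_basis (mbasis M) \<and>
     Hausdorff_space (mtop M) \<and> second_countable (mtop M) \<and>
     (\<forall>c\<in>matlas M. is_chart M c) \<and>
     (\<Union>c\<in>matlas M. fst c) = pts M \<and>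
     (\<forall>c\<in>matlas M. \<forall>d\<in>matlas M. smooth_on (loc_dom c d id) (loc_rep c d id))"

definition smooth_map ::
    "('a, 'e::real_inner) mfd \<Rightarrow> ('b, 'f::real_inner) mfd \<Rightarrow> ('a \<Rightarrow> 'b) \<Rightarrow> bool" where
  "smooth_map M N h \<longleftrightarrow>
     continuous_map (mtop M) (mtop N) h \<and>
     (\<forall>c\<in>matlas M. \<forall>d\<in>matlas N. smooth_on (loc_dom c d h) (loc_rep c d h))"

definition open_submfd :: "('a, 'e) mfd \<Rightarrow> 'a set \<Rightarrow> ('a, 'e) mfd" where
  "open_submfd M U =
     \<lparr>mtop = subtopology (mtop M) U, matlas = (\<lambda>c. (fst c \<inter> U, snd c)) ` matlas M, mbasis = mbasis M\<rparr>"

definition diffeo ::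
    "('a, 'e::real_inner) mfd \<Rightarrow> ('b, 'f::real_inner) mfd \<Rightarrow> ('a \<Rightarrow> 'b) \<Rightarrow> bool" where
  "diffeo M N h \<longleftrightarrow>
     smooth_map M N h \<and>
     (\<exists>g. smooth_map N M g \<and> (\<forall>x\<in>pts M. g (h x) = x) \<and> (\<forall>y\<in>pts N. h (g y) = y))"

definition local_diffeo ::
    "('a, 'e::real_inner) mfd \<Rightarrow> ('b, 'f::real_inner) mfd \<Rightarrow> ('a \<Rightarrow> 'b) \<Rightarrow> bool" where
  "local_diffeo M N h \<longleftrightarrow>
     (\<forall>x\<in>pts M. \<exists>U V. openin (mtop M) U \<and> x \<in> U \<and> openin (mtop N) V \<and>
        diffeo (open_submfd M U) (open_submfd N V) h)"


section \<open>Tangent vectors and differential forms\<close>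

text \<open>
  A tangent vector at \<open>x\<close> is represented by the family of its coordinate vectors in all charts of
  the atlas around \<open>x\<close>; these transform by the derivatives of the transition maps. At
  charts that are not charts around \<open>x\<close> the family is 0, so that equality of tangent vectors is
  equality of functions. All derivatives are taken within relatively open subsets of the corner
  model, where they are unique.
\<close>

type_synonym ('a, 'e) tvec = "('a, 'e) chart \<Rightarrow> 'e"

definition charts_at :: "('a, 'e) mfd \<Rightarrow> 'a \<Rightarrow> ('a, 'e) chart set" where
  "charts_at M x = {c \<in> matlas M. x \<in> fst c}"

definition loc_deriv ::
    "('a, 'e::real_inner) chart \<Rightarrow> ('b, 'f::real_inner) chart \<Rightarrow> ('a \<Rightarrow> 'b) \<Rightarrow> 'a \<Rightarrow> 'e \<Rightarrow> 'f" where
  "loc_deriv c d h x = frechet_derivative (loc_rep c d h) (at (snd c x) within loc_dom c d h)"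

definition tangent_space :: "('a, 'e::real_inner) mfd \<Rightarrow> 'a \<Rightarrow> ('a, 'e) tvec set" where
  "tangent_space M x =
     {v. (\<forall>c\<in>charts_at M x. \<forall>d\<in>charts_at M x. v d = loc_deriv c d id x (v c)) \<and>
         (\<forall>c. c \<notin> charts_at M x \<longrightarrow> v c = 0)}"

text \<open>The tangent vector at \<open>x\<close> whose coordinates in the chart \<open>c\<close> are \<open>e\<close>.\<close>

definition coord_vec ::
    "('a, 'e::real_inner) mfd \<Rightarrow> ('a, 'e) chart \<Rightarrow> 'a \<Rightarrow> 'e \<Rightarrow> ('a, 'e) tvec" where
  "coord_vec M c x e = (\<lambda>d. if d \<in> charts_at M x then loc_deriv c d id x e else 0)"

definition differential ::
    "('a, 'e::real_inner) mfd \<Rightarrow> ('b, 'f::real_inner) mfd \<Rightarrow> ('a \<Rightarrow> 'b) \<Rightarrow> 'a \<Rightarrow>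
     ('a, 'e) tvec \<Rightarrow> ('b, 'f) tvec" where
  "differential M N h x v =
     (let c = (SOME c. c \<in> charts_at M x)
      in (\<lambda>d. if d \<in> charts_at N (h x) then loc_deriv c d h x (v c) else 0))"

text \<open>
  A form assigns to a point a function on lists of tangent vectors. Such a function is an
  alternating \<open>k\<close>-linear form on \<open>T\<close>, extended by 0 to all other lists.
\<close>

type_synonym ('a, 'e) form = "'a \<Rightarrow> ('a, 'e) tvec list \<Rightarrow> real"

definition alt_form ::
    "nat \<Rightarrow> ('a, 'e::real_vector) tvec set \<Rightarrow> (('a, 'e) tvec list \<Rightarrow> real) \<Rightarrow> bool" where
  "alt_form k T \<alpha> \<longleftrightarrow>
     (\<forall>vs. \<not> (length vs = k \<and> set vs \<subseteq> T) \<longrightarrow> \<alpha> vs = 0) \<and>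
     (\<forall>vs i v w a b. length vs = k \<and> set vs \<subseteq> T \<and> i < k \<and> v \<in> T \<and> w \<in> T \<longrightarrow>
        \<alpha> (vs[i := (\<lambda>c. a *\<^sub>R v c + b *\<^sub>R w c)]) = a * \<alpha> (vs[i := v]) + b * \<alpha> (vs[i := w])) \<and>
     (\<forall>vs i j. length vs = k \<and> set vs \<subseteq> T \<and> i < j \<and> j < k \<and> vs ! i = vs ! j \<longrightarrow> \<alpha> vs = 0)"

definition forms :: "nat \<Rightarrow> ('a, 'e::real_inner) mfd \<Rightarrow> ('a, 'e) form set" where
  "forms k M =
     {\<omega>. (\<forall>x\<in>pts M. alt_form k (tangent_space M x) (\<omega> x)) \<and>
         (\<forall>x. x \<notin> pts M \<longrightarrow> \<omega> x = (\<lambda>_. 0)) \<and>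
         (\<forall>c\<in>matlas M. \<forall>es. length es = k \<longrightarrow>
            smooth_on (snd c ` fst c)
              (\<lambda>p. \<omega> (chart_inv c p) (map (coord_vec M c (chart_inv c p)) es)))}"

definition form_supp :: "('a, 'e) mfd \<Rightarrow> ('a, 'e) form \<Rightarrow> 'a set" where
  "form_supp M \<omega> = mtop M closure_of {x \<in> pts M. \<omega> x \<noteq> (\<lambda>_. 0)}"

definition fun_form :: "('a, 'e) mfd \<Rightarrow> ('a \<Rightarrow> real) \<Rightarrow> ('a, 'e) form" where
  "fun_form M f = (\<lambda>x vs. if x \<in> pts M \<and> vs = [] then f x else 0)"

definition fun_mult :: "('a \<Rightarrow> real) \<Rightarrow> ('a, 'e) form \<Rightarrow> ('a, 'e) form" where
  "fun_mult f \<omega> = (\<lambda>x vs. f x * \<omega> x vs)"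

definition form_add :: "('a, 'e) form \<Rightarrow> ('a, 'e) form \<Rightarrow> ('a, 'e) form" where
  "form_add \<alpha> \<beta> = (\<lambda>x vs. \<alpha> x vs + \<beta> x vs)"

definition form_diff :: "('a, 'e) form \<Rightarrow> ('a, 'e) form \<Rightarrow> ('a, 'e) form" where
  "form_diff \<alpha> \<beta> = (\<lambda>x vs. \<alpha> x vs - \<beta> x vs)"

definition form_scale :: "real \<Rightarrow> ('a, 'e) form \<Rightarrow> ('a, 'e) form" where
  "form_scale r \<alpha> = (\<lambda>x vs. r * \<alpha> x vs)"

definition pull ::
    "('a, 'e::real_inner) mfd \<Rightarrow> ('b, 'f::real_inner) mfd \<Rightarrow> ('a \<Rightarrow> 'b) \<Rightarrow>
     ('b, 'f) form \<Rightarrow> ('a, 'e) form" where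
  "pull M N h \<omega> = (\<lambda>x vs.
     if x \<in> pts M \<and> set vs \<subseteq> tangent_space M x then \<omega> (h x) (map (differential M N h x) vs) else 0)"

text \<open>
  Push-forward along a local diffeomorphism. The sum runs only over the points of the fiber where
  \<open>\<beta>\<close> is non-zero: these are finitely many if \<open>h\<close> is proper on the support of \<open>\<beta>\<close>, whereas
  the whole fiber may be infinite, in which case \<open>sum\<close> would yield 0.
\<close>

definition push ::
    "('a, 'e::real_inner) mfd \<Rightarrow> ('b, 'f::real_inner) mfd \<Rightarrow> ('a \<Rightarrow> 'b) \<Rightarrow>
     ('a, 'e) form \<Rightarrow> ('b, 'f) form" where
  "push M N h \<beta> = (\<lambda>y ws.
     if y \<in> pts N \<and> set ws \<subseteq> tangent_space N y
     then \<Sum>z\<in>{z \<in> pts M. h z = y \<and> \<beta> z \<noteq> (\<lambda>_. 0)}.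
            \<beta> z (map (inv_into (tangent_space M z) (differential M N h z)) ws)
     else 0)"


section \<open>Groupoids, functors, equivalences\<close>

text \<open>
  \<open>comp g f\<close> is the composite of \<open>f\<close> followed by \<open>g\<close>; it is meaningful only if \<open>src g = tgt f\<close>.
\<close>

record ('a, 'm, 'e) gpd =
  Obj :: "('a, 'e) mfd"
  Mor :: "('m, 'e) mfd"
  src :: "'m \<Rightarrow> 'a"
  tgt :: "'m \<Rightarrow> 'a"
  comp :: "'m \<Rightarrow> 'm \<Rightarrow> 'm"
  idm :: "'a \<Rightarrow> 'm"
  invm :: "'m \<Rightarrow> 'm"

abbreviation obs :: "('a, 'm, 'e) gpd \<Rightarrow> 'a set" where "obs X \<equiv> pts (Obj X)"
abbreviation mors :: "('a, 'm, 'e) gpd \<Rightarrow> 'm set" where "mors X \<equiv> pts (Mor X)"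

definition groupoid :: "('a, 'm, 'e) gpd \<Rightarrow> bool" where
  "groupoid X \<longleftrightarrow>
     (\<forall>g\<in>mors X. src X g \<in> obs X \<and> tgt X g \<in> obs X) \<and>
     (\<forall>x\<in>obs X. idm X x \<in> mors X \<and> src X (idm X x) = x \<and> tgt X (idm X x) = x) \<and>
     (\<forall>g\<in>mors X. \<forall>f\<in>mors X. src X g = tgt X f \<longrightarrow>
        comp X g f \<in> mors X \<and> src X (comp X g f) = src X f \<and> tgt X (comp X g f) = tgt X g) \<and>
     (\<forall>h\<in>mors X. \<forall>g\<in>mors X. \<forall>f\<in>mors X. src X h = tgt X g \<and> src X g = tgt X f \<longrightarrow>
        comp X (comp X h g) f = comp X h (comp X g f)) \<and>
     (\<forall>g\<in>mors X. comp X g (idm X (src X g)) = g \<and> comp X (idm X (tgt X g)) g = g) \<and>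
     (\<forall>g\<in>mors X. invm X g \<in> mors X \<and> src X (invm X g) = tgt X g \<and> tgt X (invm X g) = src X g \<and>
        comp X (invm X g) g = idm X (src X g) \<and> comp X g (invm X g) = idm X (tgt X g))"

text \<open>
  Once \<open>src\<close> and \<open>tgt\<close> are local diffeomorphisms, continuity of composition, identity and inverse
  amounts to their smoothness, since they commute with \<open>src\<close> and \<open>tgt\<close>; they are then local
  diffeomorphisms, too.
\<close>

definition etale_proper_groupoid :: "('a, 'm, 'e::real_inner) gpd \<Rightarrow> bool" where
  "etale_proper_groupoid X \<longleftrightarrow>
     groupoid X \<and>
     manifold_with_corners (Obj X) \<and> manifold_with_corners (Mor X) \<and>
     local_diffeo (Mor X) (Obj X) (src X) \<and> local_diffeo (Mor X) (Obj X) (tgt X) \<and>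
     continuous_map
       (subtopology (prod_topology (mtop (Mor X)) (mtop (Mor X))) {(g, f). src X g = tgt X f})
       (mtop (Mor X)) (\<lambda>(g, f). comp X g f) \<and>
     continuous_map (mtop (Obj X)) (mtop (Mor X)) (idm X) \<and>
     continuous_map (mtop (Mor X)) (mtop (Mor X)) (invm X) \<and>
     proper_map (mtop (Mor X)) (prod_topology (mtop (Obj X)) (mtop (Obj X))) (\<lambda>g. (src X g, tgt X g))"

definition gpd_functor ::
    "('a, 'm, 'e) gpd \<Rightarrow> ('b, 'n, 'f) gpd \<Rightarrow> ('a \<Rightarrow> 'b) \<Rightarrow> ('m \<Rightarrow> 'n) \<Rightarrow> bool" where
  "gpd_functor X Y F0 F1 \<longleftrightarrow>
     (\<forall>x\<in>obs X. F0 x \<in> obs Y \<and> F1 (idm X x) = idm Y (F0 x)) \<and>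
     (\<forall>g\<in>mors X. F1 g \<in> mors Y \<and> src Y (F1 g) = F0 (src X g) \<and> tgt Y (F1 g) = F0 (tgt X g)) \<and>
     (\<forall>g\<in>mors X. \<forall>f\<in>mors X. src X g = tgt X f \<longrightarrow> F1 (comp X g f) = comp Y (F1 g) (F1 f))"

text \<open>All morphisms of a groupoid are invertible, so every natural transformation is an isomorphism.\<close>

definition natural_iso ::
    "('a, 'm, 'e) gpd \<Rightarrow> ('b, 'n, 'f) gpd \<Rightarrow> ('a \<Rightarrow> 'b) \<Rightarrow> ('m \<Rightarrow> 'n) \<Rightarrow> ('a \<Rightarrow> 'b) \<Rightarrow> ('m \<Rightarrow> 'n) \<Rightarrow>
     ('a \<Rightarrow> 'n) \<Rightarrow> bool" where
  "natural_iso X Y F0 F1 G0 G1 \<eta> \<longleftrightarrow>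
     (\<forall>x\<in>obs X. \<eta> x \<in> mors Y \<and> src Y (\<eta> x) = F0 x \<and> tgt Y (\<eta> x) = G0 x) \<and>
     (\<forall>g\<in>mors X. comp Y (G1 g) (\<eta> (src X g)) = comp Y (\<eta> (tgt X g)) (F1 g))"

definition equivalence_of_categories ::
    "('a, 'm, 'e) gpd \<Rightarrow> ('b, 'n, 'f) gpd \<Rightarrow> ('a \<Rightarrow> 'b) \<Rightarrow> ('m \<Rightarrow> 'n) \<Rightarrow> bool" where
  "equivalence_of_categories X Y F0 F1 \<longleftrightarrow>
     gpd_functor X Y F0 F1 \<and>
     (\<exists>G0 G1 \<eta> \<epsilon>. gpd_functor Y X G0 G1 \<and>
        natural_iso X X id id (G0 \<circ> F0) (G1 \<circ> F1) \<eta> \<and>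
        natural_iso Y Y (F0 \<circ> G0) (F1 \<circ> G1) id id \<epsilon>)"

definition smooth_functor ::
    "('a, 'm, 'e::real_inner) gpd \<Rightarrow> ('b, 'n, 'f::real_inner) gpd \<Rightarrow> ('a \<Rightarrow> 'b) \<Rightarrow> ('m \<Rightarrow> 'n) \<Rightarrow> bool" where
  "smooth_functor X Y F0 F1 \<longleftrightarrow>
     gpd_functor X Y F0 F1 \<and> smooth_map (Obj X) (Obj Y) F0 \<and> smooth_map (Mor X) (Mor Y) F1"

definition refinement ::
    "('a, 'm, 'e::real_inner) gpd \<Rightarrow> ('b, 'n, 'f::real_inner) gpd \<Rightarrow> ('a \<Rightarrow> 'b) \<Rightarrow> ('m \<Rightarrow> 'n) \<Rightarrow> bool" where
  "refinement X Y F0 F1 \<longleftrightarrow>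
     smooth_functor X Y F0 F1 \<and> equivalence_of_categories X Y F0 F1 \<and>
     local_diffeo (Obj X) (Obj Y) F0"


section \<open>Forms on groupoids\<close>

definition clean_obs :: "('a, 'm, 'e) gpd \<Rightarrow> 'a set \<Rightarrow> bool" where
  "clean_obs X C \<longleftrightarrow>
     C \<subseteq> obs X \<and>
     proper_map (subtopology (mtop (Mor X)) {g \<in> mors X. src X g \<in> C}) (mtop (Obj X)) (tgt X)"

definition clean_mors :: "('a, 'm, 'e) gpd \<Rightarrow> 'm set \<Rightarrow> bool" where
  "clean_mors X C \<longleftrightarrow>
     closedin (mtop (Mor X)) C \<and> clean_obs X (src X ` C) \<and> clean_obs X (tgt X ` C)"

definition clean_forms_obs :: "nat \<Rightarrow> ('a, 'm, 'e::real_inner) gpd \<Rightarrow> ('a, 'e) form set" where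
  "clean_forms_obs k X = {\<alpha> \<in> forms k (Obj X). clean_obs X (form_supp (Obj X) \<alpha>)}"

definition clean_forms_mors :: "nat \<Rightarrow> ('a, 'm, 'e::real_inner) gpd \<Rightarrow> ('m, 'e) form set" where
  "clean_forms_mors k X = {\<beta> \<in> forms k (Mor X). clean_mors X (form_supp (Mor X) \<beta>)}"

text \<open>The degree \<open>k\<close> parts of the kernel of \<open>s\<^sup>* - t\<^sup>*\<close> and of the cokernel of \<open>s\<^sub>* - t\<^sub>*\<close>.\<close>

definition gforms :: "nat \<Rightarrow> ('a, 'm, 'e::real_inner) gpd \<Rightarrow> ('a, 'e) form set" where
  "gforms k X =
     {\<omega> \<in> forms k (Obj X). pull (Mor X) (Obj X) (src X) \<omega> = pull (Mor X) (Obj X) (tgt X) \<omega>}"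

definition clean_coset ::
    "nat \<Rightarrow> ('a, 'm, 'e::real_inner) gpd \<Rightarrow> ('a, 'e) form \<Rightarrow> ('a, 'e) form set" where
  "clean_coset k X \<alpha> =
     {form_add \<alpha> (form_diff (push (Mor X) (Obj X) (src X) \<beta>) (push (Mor X) (Obj X) (tgt X) \<beta>))
       | \<beta>. \<beta> \<in> clean_forms_mors k X}"

definition gforms_cl :: "nat \<Rightarrow> ('a, 'm, 'e::real_inner) gpd \<Rightarrow> ('a, 'e) form set set" where
  "gforms_cl k X = clean_coset k X ` clean_forms_obs k X"

definition partition_of_unity :: "('a, 'm, 'e::real_inner) gpd \<Rightarrow> ('a \<Rightarrow> real) \<Rightarrow> bool" where
  "partition_of_unity X \<rho> \<longleftrightarrow>
     (\<forall>x\<in>obs X. \<rho> x \<in> {0..1}) \<and>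
     fun_form (Obj X) \<rho> \<in> clean_forms_obs 0 X \<and>
     push (Mor X) (Obj X) (tgt X) (pull (Mor X) (Obj X) (src X) (fun_form (Obj X) \<rho>))
       = fun_form (Obj X) (\<lambda>_. 1)"

text \<open>
  \<open>J\<close> and \<open>F\<^sub>*\<close> on cosets: the value is computed on all representatives; it is the same for
  each of them.
\<close>

definition J_map :: "('a, 'm, 'e::real_inner) gpd \<Rightarrow> ('a, 'e) form set \<Rightarrow> ('a, 'e) form" where
  "J_map X C =
     the_elem ((\<lambda>\<alpha>. push (Mor X) (Obj X) (tgt X) (pull (Mor X) (Obj X) (src X) \<alpha>)) ` C)"

definition K_map ::
    "nat \<Rightarrow> ('a, 'm, 'e::real_inner) gpd \<Rightarrow> ('a \<Rightarrow> real) \<Rightarrow> ('a, 'e) form \<Rightarrow> ('a, 'e) form set" where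
  "K_map k X \<rho> \<alpha> = clean_coset k X (fun_mult \<rho> \<alpha>)"

definition pushforward_cl ::
    "nat \<Rightarrow> ('a, 'm, 'e::real_inner) gpd \<Rightarrow> ('b, 'n, 'f::real_inner) gpd \<Rightarrow> ('a \<Rightarrow> 'b) \<Rightarrow>
     ('a, 'e) form set \<Rightarrow> ('b, 'f) form set" where
  "pushforward_cl k X Y F0 C = (\<Union>\<alpha>\<in>C. clean_coset k Y (push (Obj X) (Obj Y) F0 \<alpha>))"

definition pushforward ::
    "nat \<Rightarrow> ('a, 'm, 'e::real_inner) gpd \<Rightarrow> ('b, 'n, 'f::real_inner) gpd \<Rightarrow> ('a \<Rightarrow> 'b) \<Rightarrow>
     ('a \<Rightarrow> real) \<Rightarrow> ('a, 'e) form \<Rightarrow> ('b, 'f) form" where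
  "pushforward k X Y F0 \<rho> \<xi> = J_map Y (pushforward_cl k X Y F0 (K_map k X \<rho> \<xi>))"

definition pullback ::
    "('a, 'm, 'e::real_inner) gpd \<Rightarrow> ('b, 'n, 'f::real_inner) gpd \<Rightarrow> ('a \<Rightarrow> 'b) \<Rightarrow>
     ('b, 'f) form \<Rightarrow> ('a, 'e) form" where
  "pullback X Y F0 \<eta> = pull (Obj X) (Obj Y) F0 \<eta>"

definition linear_iso ::
    "('a, 'e) form set \<Rightarrow> ('b, 'f) form set \<Rightarrow> (('a, 'e) form \<Rightarrow> ('b, 'f) form) \<Rightarrow> bool" where
  "linear_iso A B \<Phi> \<longleftrightarrow>
     bij_betw \<Phi> A B \<and>
     (\<forall>\<alpha>\<in>A. \<forall>\<beta>\<in>A. \<Phi> (form_add \<alpha> \<beta>) = form_add (\<Phi> \<alpha>) (\<Phi> \<beta>)) \<and>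
     (\<forall>r. \<forall>\<alpha>\<in>A. \<Phi> (form_scale r \<alpha>) = form_scale r (\<Phi> \<alpha>))"

end

theory Submission
  imports Defs
begin

text \<open>
  A morphism \<open>g\<close> of an etale groupoid is the value at \<open>tgt g\<close> of a unique germ of a section of \<open>tgt\<close>,
  and the germ of \<open>src\<close> composed with this section transports tangent vectors from \<open>tgt g\<close> to
  \<open>src g\<close>. This transport is functorial, elements of \<open>A\<^sup>*(X)\<close> are the forms
  invariant under it, and \<open>J[\<alpha>]\<close> at \<open>x\<close> is the sum of the transported \<open>\<alpha>\<close> over all morphisms to
  \<open>x\<close>, which is finite because the support is clean. Let \<open>F\<close> be a refinement. Every \<open>y\<close> is the target of
  some \<open>h\<close> with source \<open>F\<^sub>0(z)\<close>. As \<open>F\<close> is fully faithful, the sum over the morphisms to \<open>y\<close> and the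
  fibres of \<open>F\<^sub>0\<close> that computes \<open>J(F\<^sub>*\<alpha>)\<close> at \<open>y\<close> is the sum over the morphisms to \<open>z\<close> that computes
  \<open>J(\<alpha>)\<close> at \<open>z\<close>, so that \<open>F\<^sub>*F\<^sup>*\<eta> = J(F\<^sub>*(\<rho> F\<^sup>*\<eta>))\<close> equals \<open>\<eta>\<close>. Conversely, an invariant form on \<open>X\<close>
  descends along \<open>F\<close> by transport from \<open>z\<close> to \<open>y\<close>, and the descended form is smooth since it is locally
  a pull-back along \<open>F\<^sub>0\<inverse> \<circ> src \<circ> tgt\<inverse>\<close>.
\<close>

section \<open>Smooth maps on corners\<close>

text \<open>Two facts suffice: \<open>F_* F^* = id\<close>, and every invariant form on
  \<open>X\<close> is a pull-back. They give
  \<open>F_* \<xi> = F_* F^* (descent \<xi>) = descent \<xi>\<close>, so smoothness and invariance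
  of a push-forward are read off from the descended form and never from the sum that defines it. The
  sums are handled pointwise under the finiteness condition \<open>orbit_finite\<close>, which
  cleanness of supports supplies. Since \<open>J\<close> and \<open>F_*\<close> act on cosets
  through all representatives, constancy of \<open>J\<close> on cosets is applied once on
  \<open>X\<close> and once on \<open>Y\<close>. The analytic obstacle is functoriality of
  transport: composition of morphisms is given as a continuous map, so the chain rule is applied to
  local sections of \<open>tgt\<close>, and continuity identifies a product of sections with the
  section through the composite. This calls for a calculus of maps that are meaningful only on open
  subsets: \<open>smooth_into\<close>, \<open>germ_deriv\<close> and \<open>tdiff\<close>. At corner
  points it rests on the uniqueness of derivatives within relatively open subsets of the
  corner.\<close>

text \<open>On an open set the derivative at a point sees only values inside the set, so the
  equality of functions passes to all iterated derivatives.\<close>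

lemma C_k_on_cong:
  assumes "open W" "\<And>x. x \<in> W \<Longrightarrow> f x = g x" "C_k_on k W f"
  shows "C_k_on k W g"
  using assms(2,3)
proof (induction k arbitrary: f g)
  case 0
  then show ?case by (simp cong: continuous_on_cong)
next
  case (Suc k)
  have d: "frechet_derivative f (at x) = frechet_derivative g (at x)" if "x \<in> W" for x
    by (rule frechet_derivative_transform_within_open[OF _ assms(1) that])
       (use Suc.prems that assms(1) in \<open>auto simp: differentiable_on_eq_differentiable_at\<close>)
  have "g differentiable_on W"
    unfolding differentiable_on_def
  proof
    fix x assume "x \<in> W"
    then show "g differentiable (at x within W)"
      using Suc.prems differentiable_transform_within[of f x W 1 g]
      by (auto simp: differentiable_on_def)
  qed
  moreover have "C_k_on k W (\<lambda>x. frechet_derivative g (at x) v)" for v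
    by (rule Suc.IH[of "\<lambda>x. frechet_derivative f (at x) v"]) (use d Suc.prems in auto)
  ultimately show ?case by simp
qed

lemma C_k_on_subset:
  assumes "C_k_on k W f" "W' \<subseteq> W"
  shows "C_k_on k W' f"
  using assms(1)
proof (induction k arbitrary: f)
  case 0
  then show ?case using assms(2) continuous_on_subset by auto
next
  case (Suc k)
  then show ?case using assms(2) differentiable_on_subset by auto
qed

lemma C_k_on_Suc_D: "C_k_on (Suc k) W f \<Longrightarrow> C_k_on k W f"
proof (induction k arbitrary: f)
  case 0
  then show ?case by (simp add: differentiable_imp_continuous_on)
next
  case (Suc k)
  have "C_k_on k W (\<lambda>x. frechet_derivative f (at x) v)" for v
    by (rule Suc.IH) (use Suc.prems in simp)
  then show ?case using Suc.prems by simp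
qed

text \<open>Lets an explicit derivative formula \<open>D\<close> replace the choice
  \<open>frechet_derivative\<close>; the closure rules below obtain their formulas from the usual
  rules of differentiation.\<close>

lemma C_k_on_SucI:
  assumes "open W" "\<And>x. x \<in> W \<Longrightarrow> (f has_derivative D x) (at x)"
    and "\<And>v. C_k_on k W (\<lambda>x. D x v)"
  shows "C_k_on (Suc k) W f"
proof -
  have "f differentiable_on W"
    using assms(1,2) by (auto simp: differentiable_on_eq_differentiable_at differentiable_def)
  moreover have "C_k_on k W (\<lambda>x. frechet_derivative f (at x) v)" for v
    by (rule C_k_on_cong[OF assms(1) _ assms(3)[of v]])
       (use assms(2) frechet_derivative_at in metis)
  ultimately show ?thesis by simp
qed

lemma C_k_on_Suc_has_derivative:
  assumes "open W" "C_k_on (Suc k) W f" "x \<in> W"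
  shows "(f has_derivative frechet_derivative f (at x)) (at x)"
  using assms by (auto simp: differentiable_on_eq_differentiable_at frechet_derivative_works)

lemma C_k_on_const: "open W \<Longrightarrow> C_k_on k W (\<lambda>_. c)"
proof (induction k arbitrary: c)
  case (Suc k)
  then show ?case by (intro C_k_on_SucI[where D = "\<lambda>_ _. 0"]) auto
qed simp

lemma C_k_on_add:
  assumes "open W" "C_k_on k W f" "C_k_on k W g"
  shows "C_k_on k W (\<lambda>x. f x + g x)"
  using assms(2,3)
proof (induction k arbitrary: f g)
  case (Suc k)
  show ?case
    by (rule C_k_on_SucI[OF assms(1) has_derivative_add[OF C_k_on_Suc_has_derivative C_k_on_Suc_has_derivative]])
       (use Suc assms(1) in auto)
qed (simp add: continuous_on_add)

lemma C_k_on_sum: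
  assumes "open W" "\<And>i. i \<in> I \<Longrightarrow> C_k_on k W (f i)"
  shows "C_k_on k W (\<lambda>x. \<Sum>i\<in>I. f i x)"
  using assms(2)
  by (induction I rule: infinite_finite_induct) (auto simp: C_k_on_const C_k_on_add assms(1))

lemma C_k_on_scaleR:
  assumes "open W" "C_k_on k W u" "C_k_on k W f"
  shows "C_k_on k W (\<lambda>x. u x *\<^sub>R f x)"
  using assms(2,3)
proof (induction k arbitrary: u f)
  case (Suc k)
  have "C_k_on k W (\<lambda>x. u x *\<^sub>R frechet_derivative f (at x) v + frechet_derivative u (at x) v *\<^sub>R f x)" for v
    by (intro C_k_on_add Suc.IH assms(1) C_k_on_Suc_D[OF Suc.prems(1)] C_k_on_Suc_D[OF Suc.prems(2)])
       (use Suc.prems in auto)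
  then show ?case
    by (intro C_k_on_SucI[OF assms(1) has_derivative_scaleR[OF C_k_on_Suc_has_derivative[OF assms(1) Suc.prems(1)]
            C_k_on_Suc_has_derivative[OF assms(1) Suc.prems(2)]]])
qed (simp add: continuous_on_scaleR)

lemma C_k_on_bounded_linear:
  assumes "open W" "bounded_linear L" "C_k_on k W f"
  shows "C_k_on k W (\<lambda>x. L (f x))"
  using assms(3)
proof (induction k arbitrary: f)
  case 0
  then show ?case using bounded_linear.continuous_on[OF assms(2)] by simp
next
  case (Suc k)
  then show ?case
    by (intro C_k_on_SucI[OF assms(1) bounded_linear.has_derivative[OF assms(2)
            C_k_on_Suc_has_derivative[OF assms(1) Suc.prems]]]) auto
qed

lemma orthonormal_basis_expansion:
  assumes "orthonormal_basis B"
  shows "(\<Sum>b\<in>B. (x \<bullet> b) *\<^sub>R b) = x"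
proof -
  have "x \<in> span B" using assms by (auto simp: orthonormal_basis_def)
  then show ?thesis
  proof (induction rule: span_induct_alt)
    case base
    then show ?case by simp
  next
    case (step c x y)
    have "(\<Sum>b\<in>B. (x \<bullet> b) *\<^sub>R b) = (\<Sum>b\<in>B. if b = x then x else 0)"
      using assms step.hyps
      by (intro sum.cong) (auto simp: orthonormal_basis_def inner_commute norm_eq_1)
    then have "(\<Sum>b\<in>B. (x \<bullet> b) *\<^sub>R b) = x"
      using assms step.hyps by (simp add: orthonormal_basis_def)
    then show ?case
      using step.IH
      by (simp add: inner_add_left scaleR_add_left sum.distrib scaleR_scaleR[symmetric]
          scaleR_sum_right[symmetric] del: scaleR_scaleR)
  qed
qed

lemma linear_expansion:
  assumes "orthonormal_basis B" "linear L"
  shows "L x = (\<Sum>b\<in>B. (x \<bullet> b) *\<^sub>R L b)"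
proof -
  have "L x = L (\<Sum>b\<in>B. (x \<bullet> b) *\<^sub>R b)"
    using orthonormal_basis_expansion[OF assms(1)] by metis
  then show ?thesis by (simp add: linear_sum[OF assms(2)] linear_cmul[OF assms(2)])
qed

text \<open>In the chain rule the direction fed into the derivative of \<open>g\<close> varies with
  \<open>x\<close>, so the induction hypothesis does not apply to it directly. Expanding that
  direction in the orthonormal basis leaves a finite sum of scalar coefficients times partial
  derivatives of \<open>g\<close> in fixed directions, composed with \<open>f\<close>.\<close>

lemma C_k_on_compose:
  fixes f :: "'e::real_normed_vector \<Rightarrow> 'f::real_inner" and g :: "'f \<Rightarrow> 'g::real_normed_vector"
    and B :: "'f set"
  assumes "orthonormal_basis B" "open W" "open W'" "f ` W \<subseteq> W'"
    and "C_k_on k W f" "C_k_on k W' g"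
  shows "C_k_on k W (\<lambda>x. g (f x))"
  using assms(5,6)
proof (induction k arbitrary: g)
  case 0
  then show ?case using continuous_on_compose2[of W' g W f] assms(4) by simp
next
  case (Suc k)
  have f: "(f has_derivative frechet_derivative f (at x)) (at x)" if "x \<in> W" for x
    using C_k_on_Suc_has_derivative[OF assms(2) Suc.prems(1) that] .
  have g: "(g has_derivative frechet_derivative g (at (f x))) (at (f x))" if "x \<in> W" for x
    by (rule C_k_on_Suc_has_derivative[OF assms(3) Suc.prems(2)]) (use that assms(4) in auto)
  let ?D = "\<lambda>x v. \<Sum>b\<in>B. (frechet_derivative f (at x) v \<bullet> b) *\<^sub>R frechet_derivative g (at (f x)) b"
  show ?case
  proof (rule C_k_on_SucI[where D = ?D])
    fix x assume "x \<in> W"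
    have "?D x = (\<lambda>v. frechet_derivative g (at (f x)) (frechet_derivative f (at x) v))"
      by (intro ext linear_expansion[OF assms(1) has_derivative_linear[OF g[OF \<open>x \<in> W\<close>]], symmetric])
    then show "((\<lambda>x. g (f x)) has_derivative ?D x) (at x)"
      using has_derivative_compose[OF f[OF \<open>x \<in> W\<close>] g[OF \<open>x \<in> W\<close>]] by simp
  next
    fix v
    show "C_k_on k W (\<lambda>x. ?D x v)"
      by (intro C_k_on_sum C_k_on_scaleR assms(2) Suc.IH C_k_on_Suc_D[OF Suc.prems(1)]
          C_k_on_bounded_linear[OF _ bounded_linear_inner_left])
         (use Suc.prems in auto)
  qed (rule assms(2))
qed

section \<open>Smoothness at a point and derivatives on the corner model\<close>

definition smooth_at :: "'e::real_normed_vector set \<Rightarrow> ('e \<Rightarrow> 'f::real_normed_vector) \<Rightarrow> 'e \<Rightarrow> bool" where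
  "smooth_at S f p \<longleftrightarrow>
     (\<exists>W g. open W \<and> p \<in> W \<and> (\<forall>k. C_k_on k W g) \<and> (\<forall>q\<in>S \<inter> W. g q = f q))"

lemma smooth_on_iff_smooth_at: "smooth_on S f \<longleftrightarrow> (\<forall>p\<in>S. smooth_at S f p)"
  by (simp add: smooth_on_def smooth_at_def)

lemma smooth_at_cong:
  assumes "smooth_at S f p" "open V" "p \<in> V" "\<And>q. q \<in> S' \<Longrightarrow> q \<in> V \<Longrightarrow> q \<in> S \<and> f q = f' q"
  shows "smooth_at S' f' p"
proof -
  obtain W g where W: "open W" "p \<in> W" "\<And>k. C_k_on k W g" "\<And>q. q \<in> S \<inter> W \<Longrightarrow> g q = f q"
    using assms(1) by (auto simp: smooth_at_def)
  show ?thesis unfolding smooth_at_def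
    by (rule exI[of _ "W \<inter> V"], rule exI[of _ g])
       (use W assms(2-4) in \<open>auto intro: C_k_on_subset[OF W(3)]\<close>)
qed

lemma smooth_at_const: "smooth_at S (\<lambda>_. c) p"
  unfolding smooth_at_def by (rule exI[of _ UNIV]) (auto intro: C_k_on_const)

lemma smooth_at_add:
  assumes "smooth_at S f p" "smooth_at S g p"
  shows "smooth_at S (\<lambda>x. f x + g x) p"
proof -
  obtain W f' where W: "open W" "p \<in> W" "\<And>k. C_k_on k W f'" "\<And>q. q \<in> S \<inter> W \<Longrightarrow> f' q = f q"
    using assms(1) by (auto simp: smooth_at_def)
  obtain V g' where V: "open V" "p \<in> V" "\<And>k. C_k_on k V g'" "\<And>q. q \<in> S \<inter> V \<Longrightarrow> g' q = g q"
    using assms(2) by (auto simp: smooth_at_def)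
  show ?thesis unfolding smooth_at_def
    by (rule exI[of _ "W \<inter> V"], rule exI[of _ "\<lambda>x. f' x + g' x"])
       (use W V in \<open>auto intro!: C_k_on_add C_k_on_subset[OF W(3)] C_k_on_subset[OF V(3)]\<close>)
qed

lemma smooth_at_sum:
  "(\<And>i. i \<in> I \<Longrightarrow> smooth_at S (f i) p) \<Longrightarrow> smooth_at S (\<lambda>x. \<Sum>i\<in>I. f i x) p"
  by (induction I rule: infinite_finite_induct) (auto simp: smooth_at_const smooth_at_add)

lemma smooth_at_scaleR:
  assumes "smooth_at S f p" "smooth_at S g p"
  shows "smooth_at S (\<lambda>x. f x *\<^sub>R g x) p"
proof -
  obtain W f' where W: "open W" "p \<in> W" "\<And>k. C_k_on k W f'" "\<And>q. q \<in> S \<inter> W \<Longrightarrow> f' q = f q"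
    using assms(1) by (auto simp: smooth_at_def)
  obtain V g' where V: "open V" "p \<in> V" "\<And>k. C_k_on k V g'" "\<And>q. q \<in> S \<inter> V \<Longrightarrow> g' q = g q"
    using assms(2) by (auto simp: smooth_at_def)
  show ?thesis unfolding smooth_at_def
    by (rule exI[of _ "W \<inter> V"], rule exI[of _ "\<lambda>x. f' x *\<^sub>R g' x"])
       (use W V in \<open>auto intro!: C_k_on_scaleR C_k_on_subset[OF W(3)] C_k_on_subset[OF V(3)]\<close>)
qed

lemma smooth_at_inner:
  assumes "smooth_at S f p"
  shows "smooth_at S (\<lambda>x. f x \<bullet> b) p"
proof -
  obtain W g where W: "open W" "p \<in> W" "\<And>k. C_k_on k W g" "\<And>q. q \<in> S \<inter> W \<Longrightarrow> g q = f q"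
    using assms(1) by (auto simp: smooth_at_def)
  show ?thesis unfolding smooth_at_def
    by (rule exI[of _ W], rule exI[of _ "\<lambda>x. g x \<bullet> b"])
       (use W in \<open>auto intro!: C_k_on_bounded_linear[OF _ bounded_linear_inner_left]\<close>)
qed

lemma smooth_at_compose:
  fixes f :: "'e::real_normed_vector \<Rightarrow> 'f::real_inner" and g :: "'f \<Rightarrow> 'g::real_normed_vector"
    and B :: "'f set"
  assumes "orthonormal_basis B" "p \<in> S" "smooth_at S f p" "smooth_at S' g (f p)"
    and "\<And>q. q \<in> S \<Longrightarrow> f q \<in> S'"
  shows "smooth_at S (\<lambda>x. g (f x)) p"
proof -
  obtain W f' where W: "open W" "p \<in> W" "\<And>k. C_k_on k W f'" "\<And>q. q \<in> S \<inter> W \<Longrightarrow> f' q = f q"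
    using assms(3) by (auto simp: smooth_at_def)
  obtain V g' where V: "open V" "f p \<in> V" "\<And>k. C_k_on k V g'" "\<And>q. q \<in> S' \<inter> V \<Longrightarrow> g' q = g q"
    using assms(4) by (auto simp: smooth_at_def)
  let ?W = "W \<inter> f' -` V"
  have "open ?W"
    using continuous_open_preimage[OF _ W(1) V(1), of f'] W(3)[of 0] by simp
  moreover have "C_k_on k ?W (\<lambda>x. g' (f' x))" for k
    by (rule C_k_on_compose[OF assms(1) \<open>open ?W\<close> V(1) _ C_k_on_subset[OF W(3)] V(3)]) auto
  moreover have "p \<in> ?W" using W V assms(2) by auto
  moreover have "\<forall>q\<in>S \<inter> ?W. g' (f' q) = g (f q)"
    using W(4) V(4) assms(5) by auto
  ultimately show ?thesis unfolding smooth_at_def by blast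
qed

lemma smooth_at_has_derivative:
  assumes "smooth_at S f p" "p \<in> S"
  obtains W g where "open W" "p \<in> W" "\<And>k. C_k_on k W g" "\<And>q. q \<in> S \<inter> W \<Longrightarrow> g q = f q"
    "\<And>q. q \<in> S \<inter> W \<Longrightarrow> (f has_derivative frechet_derivative g (at q)) (at q within S)"
proof -
  obtain W g where W: "open W" "p \<in> W" "\<And>k. C_k_on k W g" "\<And>q. q \<in> S \<inter> W \<Longrightarrow> g q = f q"
    using assms(1) by (auto simp: smooth_at_def)
  have "(f has_derivative frechet_derivative g (at q)) (at q within S)" if q: "q \<in> S \<inter> W" for q
  proof -
    have "(g has_derivative frechet_derivative g (at q)) (at q within S)"
      using C_k_on_Suc_has_derivative[OF W(1) W(3)] q has_derivative_at_withinI by blast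
    moreover obtain e where e: "e > 0" "ball q e \<subseteq> W" using W(1) q openE by blast
    ultimately show ?thesis
      by (intro has_derivative_transform_within[of g _ q S e f]) (use q W(4) in \<open>auto simp: dist_commute subset_iff\<close>)
  qed
  then show thesis using that W by blast
qed

text \<open>From a point of the corner one can always move a little in each positive basis
  direction, since orthonormality keeps all coordinates nonnegative. The one-sided derivatives along
  these segments determine the derivative on the basis, and linearity does the rest.\<close>

lemma corner_derivative_unique:
  fixes f :: "'e::real_inner \<Rightarrow> 'f::real_normed_vector"
  assumes B: "orthonormal_basis B" and S: "openin (top_of_set (corner B)) S" "x \<in> S"
    and f: "(f has_derivative f') (at x within S)" "(f has_derivative f'') (at x within S)"
  shows "f' = f''"
proof -
  obtain V where V: "open V" "S = corner B \<inter> V" using S(1) by (auto simp: openin_open)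
  obtain e where e: "e > 0" "ball x e \<subseteq> V" using V S(2) openE by blast
  have eq: "f' b = f'' b" if b: "b \<in> B" for b
  proof -
    have nb: "norm b = 1" using B b by (auto simp: orthonormal_basis_def)
    \<comment> \<open>The length \<open>e/2\<close> keeps the closed segment inside the open ball of
      radius \<open>e\<close>.\<close>
    have inS: "x + t *\<^sub>R b \<in> S" if t: "t \<in> {0..e/2}" for t :: real
    proof -
      have "x + t *\<^sub>R b \<in> corner B"
        unfolding corner_def mem_Collect_eq
      proof
        fix c assume "c \<in> B"
        have "b \<bullet> c \<ge> 0" using B b \<open>c \<in> B\<close> by (cases "b = c") (auto simp: orthonormal_basis_def)
        then show "0 \<le> (x + t *\<^sub>R b) \<bullet> c"
          using S(2) V(2) t \<open>c \<in> B\<close> by (auto simp: corner_def inner_add_left)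
      qed
      moreover have "x + t *\<^sub>R b \<in> ball x e" using t nb e(1) by (auto simp: dist_norm)
      ultimately show ?thesis using V(2) e(2) by auto
    qed
    have line: "((\<lambda>t. x + t *\<^sub>R b) has_derivative (\<lambda>t. t *\<^sub>R b)) (at 0 within {0..e/2})"
      by (auto intro!: derivative_eq_intros)
    have *: "((\<lambda>t. f (x + t *\<^sub>R b)) has_vector_derivative D b) (at 0 within {0..e/2})"
      if D: "(f has_derivative D) (at x within S)" for D
    proof -
      have "(\<lambda>t. x + t *\<^sub>R b) ` {0..e/2} \<subseteq> S" using inS by blast
      then have "(f has_derivative D) (at (x + 0 *\<^sub>R b) within (\<lambda>t. x + t *\<^sub>R b) ` {0..e/2})"
        using has_derivative_subset[OF D] by simp
      from has_derivative_in_compose[OF line this]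
      have "((\<lambda>t. f (x + t *\<^sub>R b)) has_derivative (\<lambda>t. D (t *\<^sub>R b))) (at 0 within {0..e/2})" .
      then show ?thesis
        by (simp add: has_vector_derivative_def linear_cmul[OF has_derivative_linear[OF D]])
    qed
    show ?thesis
      using vector_derivative_unique_within[OF _ *[OF f(1)] *[OF f(2)]]
        at_within_Icc_at_right[of 0 "e/2"] e(1) by simp
  qed
  show ?thesis
  proof
    fix v
    show "f' v = f'' v"
      using linear_expansion[OF B has_derivative_linear[OF f(1)], of v]
        linear_expansion[OF B has_derivative_linear[OF f(2)], of v] eq by simp
  qed
qed

text \<open>By uniqueness on the corner, the chosen derivative within \<open>S\<close> equals the
  derivative of any local smooth extension, and the latter is smooth on an open set.\<close>

lemma smooth_on_frechet_derivative:
  assumes B: "orthonormal_basis B" and S: "openin (top_of_set (corner B)) S" and f: "smooth_on S f"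
  shows "p \<in> S \<Longrightarrow> (f has_derivative frechet_derivative f (at p within S)) (at p within S)"
    and "smooth_on S (\<lambda>p. frechet_derivative f (at p within S) v)"
proof -
  have D: "(f has_derivative frechet_derivative f (at p within S)) (at p within S)" if "p \<in> S" for p
  proof -
    have "smooth_at S f p" using f that by (simp add: smooth_on_iff_smooth_at)
    then show ?thesis
      using smooth_at_has_derivative[OF _ that]
      by (metis IntI differentiableI frechet_derivative_works that)
  qed
  then show "p \<in> S \<Longrightarrow> (f has_derivative frechet_derivative f (at p within S)) (at p within S)" .
  show "smooth_on S (\<lambda>p. frechet_derivative f (at p within S) v)"
    unfolding smooth_on_iff_smooth_at
  proof
    fix p assume p: "p \<in> S"
    then have sm: "smooth_at S f p" using f by (simp add: smooth_on_iff_smooth_at)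
    obtain W g where W: "open W" "p \<in> W" "\<And>k. C_k_on k W g"
      "\<And>q. q \<in> S \<inter> W \<Longrightarrow> (f has_derivative frechet_derivative g (at q)) (at q within S)"
      using smooth_at_has_derivative[OF sm p] by metis
    have "frechet_derivative g (at q) v = frechet_derivative f (at q within S) v" if "q \<in> S \<inter> W" for q
      using corner_derivative_unique[OF B S _ W(4)[OF that] D[of q]] that by auto
    moreover have "C_k_on k W (\<lambda>x. frechet_derivative g (at x) v)" for k
      using W(3)[of "Suc k"] by simp
    ultimately show "smooth_at S (\<lambda>p. frechet_derivative f (at p within S) v) p"
      unfolding smooth_at_def using W(1,2) by (intro exI[of _ W]) blast
  qed
qed

section \<open>Germs of smooth maps and their differentials\<close>

declare split_paired_All [simp del] split_paired_Ex [simp del]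

lemma is_chart_of_atlas: "manifold_with_corners M \<Longrightarrow> c \<in> matlas M \<Longrightarrow> is_chart M c"
  by (simp add: manifold_with_corners_def)

lemma manifold_basis: "manifold_with_corners M \<Longrightarrow> orthonormal_basis (mbasis M)"
  by (simp add: manifold_with_corners_def)

lemma openin_chart_domain: "is_chart M c \<Longrightarrow> openin (mtop M) (fst c)"
  by (simp add: is_chart_def)

lemma chart_domain_subset: "is_chart M c \<Longrightarrow> fst c \<subseteq> pts M"
  by (simp add: is_chart_def openin_subset)

lemma inj_on_chart: "is_chart M c \<Longrightarrow> inj_on (snd c) (fst c)"
  using homeomorphic_imp_injective_map chart_domain_subset
  by (fastforce simp: is_chart_def inf.absorb2)

lemma chart_inv_chart: "is_chart M c \<Longrightarrow> x \<in> fst c \<Longrightarrow> chart_inv c (snd c x) = x"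
  by (simp add: chart_inv_def inj_on_chart inv_into_f_f)

lemma openin_chart_image:
  assumes "is_chart M c" "openin (mtop M) U" "U \<subseteq> fst c"
  shows "openin (top_of_set (corner (mbasis M))) (snd c ` U)"
proof -
  have "openin (subtopology (mtop M) (fst c)) U"
    using assms openin_subtopology_Int2 openin_subset by (metis inf.absorb2)
  then have "openin (top_of_set (snd c ` fst c)) (snd c ` U)"
    using assms(1) homeomorphic_imp_open_map open_map_def unfolding is_chart_def by metis
  then show ?thesis
    using assms(1) openin_trans by (auto simp: is_chart_def)
qed

lemma charts_atD:
  assumes "manifold_with_corners M" "c \<in> charts_at M x"
  shows "c \<in> matlas M" "is_chart M c" "x \<in> fst c" "x \<in> pts M"
  using assms is_chart_of_atlas[OF assms(1), of c] chart_domain_subset[of M c]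
  by (auto simp: charts_at_def)

lemma charts_at_nonempty:
  assumes "manifold_with_corners M" "x \<in> pts M"
  obtains c where "c \<in> charts_at M x"
proof -
  have "x \<in> (\<Union>c\<in>matlas M. fst c)" using assms by (simp add: manifold_with_corners_def)
  then show thesis using that by (auto simp: charts_at_def)
qed

section \<open>Germs of smooth maps and their chain rule\<close>

definition overlap :: "('a, 'e) chart \<Rightarrow> ('b, 'f) chart \<Rightarrow> 'a set \<Rightarrow> ('a \<Rightarrow> 'b) \<Rightarrow> 'a set" where
  "overlap c d U h = {x \<in> fst c \<inter> U. h x \<in> fst d}"

text \<open>
  Local versions of \<^const>\<open>smooth_map\<close> and \<^const>\<open>differential\<close>, for maps that are meaningful only
  on an open set \<open>U\<close>, such as local inverses.
\<close>

definition smooth_into ::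
    "('a, 'e::real_inner) mfd \<Rightarrow> ('b, 'f::real_inner) mfd \<Rightarrow> 'a set \<Rightarrow> ('a \<Rightarrow> 'b) \<Rightarrow> bool" where
  "smooth_into M N U h \<longleftrightarrow>
     openin (mtop M) U \<and> continuous_map (subtopology (mtop M) U) (mtop N) h \<and>
     (\<forall>c\<in>matlas M. \<forall>d\<in>matlas N. smooth_on (snd c ` overlap c d U h) (loc_rep c d h))"

text \<open>The derivative is taken within the image of the overlap with \<open>U\<close>, so the
  arbitrary values of \<open>h\<close> outside \<open>U\<close> do not enter.\<close>

definition germ_deriv ::
    "'a set \<Rightarrow> ('a, 'e::real_inner) chart \<Rightarrow> ('b, 'f::real_inner) chart \<Rightarrow> ('a \<Rightarrow> 'b) \<Rightarrow> 'a \<Rightarrow> 'e \<Rightarrow> 'f" where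
  "germ_deriv U c d h x =
     frechet_derivative (loc_rep c d h) (at (snd c x) within snd c ` overlap c d U h)"

lemma smooth_intoD:
  assumes "smooth_into M N U h"
  shows "openin (mtop M) U" "U \<subseteq> pts M" "continuous_map (subtopology (mtop M) U) (mtop N) h"
    and "x \<in> U \<Longrightarrow> h x \<in> pts N"
proof -
  show "openin (mtop M) U" "U \<subseteq> pts M" "continuous_map (subtopology (mtop M) U) (mtop N) h"
    using assms openin_subset by (auto simp: smooth_into_def)
  then show "x \<in> U \<Longrightarrow> h x \<in> pts N"
    by (auto simp: continuous_map_def)
qed

lemma openin_preimage_subtopology:
  assumes "continuous_map (subtopology T U) T' h" "openin T U" "openin T' V"
  shows "openin T {x \<in> U. h x \<in> V}"
proof -
  have "openin (subtopology T U) {x \<in> topspace (subtopology T U). h x \<in> V}"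
    using openin_continuous_map_preimage[OF assms(1,3)] .
  moreover have "topspace (subtopology T U) = U"
    using openin_subset[OF assms(2)] by (simp add: inf.absorb2)
  ultimately show ?thesis using assms(2) openin_open_subtopology by metis
qed

lemma openin_overlap:
  assumes "smooth_into M N U h" "is_chart M c" "is_chart N d"
  shows "openin (mtop M) (overlap c d U h)"
proof -
  have "overlap c d U h = fst c \<inter> {x \<in> U. h x \<in> fst d}" by (auto simp: overlap_def)
  then show ?thesis
    using openin_preimage_subtopology[OF smooth_intoD(3)[OF assms(1)] smooth_intoD(1)[OF assms(1)]]
      openin_chart_domain assms(2,3) by (metis openin_Int)
qed

lemma openin_chart_image_overlap:
  assumes "smooth_into M N U h" "is_chart M c" "is_chart N d"
  shows "openin (top_of_set (corner (mbasis M))) (snd c ` overlap c d U h)"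
  by (rule openin_chart_image[OF assms(2) openin_overlap[OF assms]]) (auto simp: overlap_def)

lemma germ_deriv_works:
  assumes "manifold_with_corners M" "manifold_with_corners N" "smooth_into M N U h"
    and "x \<in> U" "c \<in> charts_at M x" "d \<in> charts_at N (h x)"
  shows "(loc_rep c d h has_derivative germ_deriv U c d h x) (at (snd c x) within snd c ` overlap c d U h)"
  unfolding germ_deriv_def
  by (rule smooth_on_frechet_derivative(1)[OF manifold_basis[OF assms(1)] openin_chart_image_overlap[OF assms(3)]])
     (use assms charts_atD[OF assms(1,5)] charts_atD[OF assms(2,6)] in \<open>auto simp: overlap_def smooth_into_def\<close>)

lemma germ_deriv_linear:
  assumes "manifold_with_corners M" "manifold_with_corners N" "smooth_into M N U h"
    and "x \<in> U" "c \<in> charts_at M x" "d \<in> charts_at N (h x)"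
  shows "linear (germ_deriv U c d h x)"
  using germ_deriv_works[OF assms] has_derivative_linear by blast

text \<open>A derivative computed on any smaller open neighbourhood is the right one: both restrict
  to a common relatively open piece of the corner, where derivatives are unique.\<close>

lemma germ_deriv_unique:
  assumes "manifold_with_corners M" "manifold_with_corners N" "smooth_into M N U h"
    and "x \<in> U" "c \<in> charts_at M x" "d \<in> charts_at N (h x)"
    and "openin (mtop M) W" "x \<in> W" "(loc_rep c d h has_derivative A) (at (snd c x) within snd c ` (fst c \<inter> W))"
  shows "germ_deriv U c d h x = A"
proof (rule corner_derivative_unique[OF manifold_basis[OF assms(1)]])
  note c = charts_atD[OF assms(1,5)] and d = charts_atD[OF assms(2,6)]
  let ?S = "overlap c d U h \<inter> W"
  have "?S \<subseteq> fst c" by (auto simp: overlap_def)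
  then show "openin (top_of_set (corner (mbasis M))) (snd c ` ?S)"
    using openin_chart_image[OF c(2) openin_Int[OF openin_overlap[OF assms(3) c(2) d(2)] assms(7)]] by blast
  show "snd c x \<in> snd c ` ?S"
    using c d assms by (auto simp: overlap_def)
  show "(loc_rep c d h has_derivative germ_deriv U c d h x) (at (snd c x) within snd c ` ?S)"
    by (rule has_derivative_subset[OF germ_deriv_works[OF assms(1-6)]]) auto
  show "(loc_rep c d h has_derivative A) (at (snd c x) within snd c ` ?S)"
    by (rule has_derivative_subset[OF assms(9)]) (auto simp: overlap_def)
qed

lemma germ_deriv_cong:
  assumes "manifold_with_corners M" "manifold_with_corners N" "smooth_into M N U h" "smooth_into M N U' h'"
    and "x \<in> W" "openin (mtop M) W" "W \<subseteq> U" "W \<subseteq> U'" "\<And>u. u \<in> W \<Longrightarrow> h u = h' u"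
    and "c \<in> charts_at M x" "d \<in> charts_at N (h x)"
  shows "germ_deriv U c d h x = germ_deriv U' c d h' x"
proof -
  note c = charts_atD[OF assms(1,10)] and d = charts_atD[OF assms(2,11)]
  have hx: "h x = h' x" using assms(5,9) by simp
  let ?W = "overlap c d U' h' \<inter> W"
  have "openin (mtop M) ?W"
    using openin_Int[OF openin_overlap[OF assms(4) c(2) d(2)] assms(6)] .
  moreover have "x \<in> ?W" using c d assms hx by (auto simp: overlap_def)
  moreover have "(loc_rep c d h has_derivative germ_deriv U' c d h' x) (at (snd c x) within snd c ` (fst c \<inter> ?W))"
  proof (rule has_derivative_transform_within[where d = 1])
    show "(loc_rep c d h' has_derivative germ_deriv U' c d h' x) (at (snd c x) within snd c ` (fst c \<inter> ?W))"
      by (rule has_derivative_subset[OF germ_deriv_works]) (use assms c d hx in auto)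
    show "snd c x \<in> snd c ` (fst c \<inter> ?W)" using \<open>x \<in> ?W\<close> c(3) by blast
    show "loc_rep c d h' p = loc_rep c d h p" if "p \<in> snd c ` (fst c \<inter> ?W)" for p
      using that assms(9) by (auto simp: loc_rep_def chart_inv_chart[OF c(2)])
  qed simp
  ultimately show ?thesis
    by (intro germ_deriv_unique) (use assms in auto)
qed

lemma smooth_into_subset:
  assumes "manifold_with_corners M" "smooth_into M N U h" "openin (mtop M) U'" "U' \<subseteq> U"
    "\<And>x. x \<in> U' \<Longrightarrow> h x = h' x"
  shows "smooth_into M N U' h'"
  unfolding smooth_into_def
proof (intro conjI ballI)
  show "openin (mtop M) U'" by (rule assms(3))
  have "continuous_map (subtopology (mtop M) U') (mtop N) h"
    using smooth_intoD(3)[OF assms(2)] assms(4) continuous_map_from_subtopology_mono by blast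
  then show "continuous_map (subtopology (mtop M) U') (mtop N) h'"
    by (rule continuous_map_eq) (use assms(5) in auto)
  fix c d assume c: "c \<in> matlas M" and d: "d \<in> matlas N"
  note cc = is_chart_of_atlas[OF assms(1) c]
  show "smooth_on (snd c ` overlap c d U' h') (loc_rep c d h')"
    unfolding smooth_on_iff_smooth_at
  proof
    fix p assume p: "p \<in> snd c ` overlap c d U' h'"
    have sub: "overlap c d U' h' \<subseteq> overlap c d U h" using assms(4,5) by (auto simp: overlap_def)
    then have "smooth_at (snd c ` overlap c d U h) (loc_rep c d h) p"
      using p assms(2) c d by (auto simp: smooth_into_def smooth_on_iff_smooth_at)
    then show "smooth_at (snd c ` overlap c d U' h') (loc_rep c d h') p"
      by (rule smooth_at_cong[of _ _ _ UNIV])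
         (use sub assms(5) in \<open>auto simp: loc_rep_def overlap_def chart_inv_chart[OF cc]\<close>)
  qed
qed

lemma loc_rep_comp:
  assumes "is_chart M c" "is_chart N d" "x \<in> fst c" "h x \<in> fst d"
  shows "loc_rep c e (k \<circ> h) (snd c x) = loc_rep d e k (loc_rep c d h (snd c x))"
  using assms by (simp add: loc_rep_def chart_inv_chart)

lemma smooth_at_openin_localize:
  assumes "openin (top_of_set K) T" "T \<subseteq> S" "S \<subseteq> K" "smooth_at T f p" "p \<in> T"
  shows "smooth_at S f p"
proof -
  obtain V where V: "open V" "T = K \<inter> V" using assms(1) by (auto simp: openin_open)
  show ?thesis
    by (rule smooth_at_cong[OF assms(4) V(1)]) (use V assms in auto)
qed

lemma smooth_into_compose:
  assumes M: "manifold_with_corners M" and N: "manifold_with_corners N" and P: "manifold_with_corners P"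
    and h: "smooth_into M N U h" and k: "smooth_into N P V k"
  shows "smooth_into M P {x \<in> U. h x \<in> V} (k \<circ> h)"
  unfolding smooth_into_def
proof (intro conjI ballI)
  let ?U = "{x \<in> U. h x \<in> V}"
  show U: "openin (mtop M) ?U"
    using openin_preimage_subtopology[OF smooth_intoD(3)[OF h] smooth_intoD(1)[OF h] smooth_intoD(1)[OF k]] .
  have "continuous_map (subtopology (mtop M) ?U) (subtopology (mtop N) V) h"
    unfolding continuous_map_in_subtopology
    using continuous_map_from_subtopology_mono[OF smooth_intoD(3)[OF h], of ?U] by auto
  then show "continuous_map (subtopology (mtop M) ?U) (mtop P) (k \<circ> h)"
    using continuous_map_compose smooth_intoD(3)[OF k] by blast
  fix c e assume c: "c \<in> matlas M" and e: "e \<in> matlas P"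
  note cc = is_chart_of_atlas[OF M c] and ec = is_chart_of_atlas[OF P e]
  show "smooth_on (snd c ` overlap c e ?U (k \<circ> h)) (loc_rep c e (k \<circ> h))"
    unfolding smooth_on_iff_smooth_at
  proof
    fix p assume "p \<in> snd c ` overlap c e ?U (k \<circ> h)"
    then obtain x where x: "p = snd c x" "x \<in> fst c" "x \<in> U" "h x \<in> V" "k (h x) \<in> fst e"
      by (auto simp: overlap_def)
    obtain d where d: "d \<in> charts_at N (h x)"
      using charts_at_nonempty[OF N smooth_intoD(4)[OF h x(3)]] .
    note dc = charts_atD[OF N d]
    \<comment> \<open>Smoothness is tested in \<open>c\<close> and \<open>e\<close>, but the
      composite factors through coordinates only where the intermediate chart \<open>d\<close>
      applies. \<open>?T\<close> is such a neighbourhood of \<open>x\<close>, and smoothness there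
      is carried back to the full overlap by openness.\<close>
    let ?W = "overlap c d U h" and ?W' = "overlap d e V k"
    let ?T = "{y \<in> ?W. h y \<in> ?W'}"
    have W: "openin (mtop M) ?W" using openin_overlap[OF h cc dc(2)] .
    have "openin (mtop N) ?W'" using openin_overlap[OF k dc(2) ec] .
    moreover have "?T = ?W \<inter> {y \<in> U. h y \<in> ?W'}" by (auto simp: overlap_def)
    ultimately have T: "openin (mtop M) ?T"
      using openin_Int[OF W openin_preimage_subtopology[OF smooth_intoD(3)[OF h] smooth_intoD(1)[OF h]]] by simp
    have xT: "x \<in> ?T" using x dc by (auto simp: overlap_def)
    have "smooth_at (snd c ` ?T) (\<lambda>q. loc_rep d e k (loc_rep c d h q)) p"
    proof (rule smooth_at_compose[OF manifold_basis[OF N]])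
      show "p \<in> snd c ` ?T" using xT x(1) by blast
      have "smooth_at (snd c ` ?W) (loc_rep c d h) p"
        using h c dc(1) xT x(1) by (auto simp: smooth_into_def smooth_on_iff_smooth_at)
      then show "smooth_at (snd c ` ?T) (loc_rep c d h) p"
        by (rule smooth_at_cong[of _ _ _ UNIV]) auto
      have "loc_rep c d h p = snd d (h x)" using x by (simp add: loc_rep_def chart_inv_chart[OF cc])
      then show "smooth_at (snd d ` ?W') (loc_rep d e k) (loc_rep c d h p)"
        using k e dc(1) xT by (auto simp: smooth_into_def smooth_on_iff_smooth_at)
      show "loc_rep c d h q \<in> snd d ` ?W'" if "q \<in> snd c ` ?T" for q
        using that by (auto simp: loc_rep_def overlap_def chart_inv_chart[OF cc])
    qed
    then have 1: "smooth_at (snd c ` ?T) (loc_rep c e (k \<circ> h)) p"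
      by (rule smooth_at_cong[of _ _ _ UNIV])
         (use loc_rep_comp[OF cc dc(2), of _ h e k] in \<open>auto simp: overlap_def\<close>)
    have 2: "openin (top_of_set (corner (mbasis M))) (snd c ` ?T)"
      by (rule openin_chart_image[OF cc T]) (auto simp: overlap_def)
    have 3: "snd c ` overlap c e ?U (k \<circ> h) \<subseteq> corner (mbasis M)"
      using cc openin_subset[of "top_of_set (corner (mbasis M))" "snd c ` fst c"]
      by (auto simp: is_chart_def overlap_def)
    have 4: "?T \<subseteq> overlap c e ?U (k \<circ> h)" by (auto simp: overlap_def)
    show "smooth_at (snd c ` overlap c e ?U (k \<circ> h)) (loc_rep c e (k \<circ> h)) p"
      using smooth_at_openin_localize[OF 2 image_mono[OF 4] 3 1] imageI[OF xT, of "snd c"] x(1) by metis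
  qed
qed

lemma germ_deriv_compose:
  assumes M: "manifold_with_corners M" and N: "manifold_with_corners N" and P: "manifold_with_corners P"
    and h: "smooth_into M N U h" and k: "smooth_into N P V k" and x: "x \<in> U" "h x \<in> V"
    and c: "c \<in> charts_at M x" and d: "d \<in> charts_at N (h x)" and e: "e \<in> charts_at P (k (h x))"
  shows "germ_deriv {x \<in> U. h x \<in> V} c e (k \<circ> h) x
    = (\<lambda>v. germ_deriv V d e k (h x) (germ_deriv U c d h x v))"
proof -
  note cc = charts_atD[OF M c] and dc = charts_atD[OF N d] and ec = charts_atD[OF P e]
  let ?W = "overlap c d U h" and ?W' = "overlap d e V k"
  let ?T = "{y \<in> ?W. h y \<in> ?W'}"
  have W: "openin (mtop M) ?W" using openin_overlap[OF h cc(2) dc(2)] .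
  have "openin (mtop N) ?W'" using openin_overlap[OF k dc(2) ec(2)] .
  moreover have "?T = ?W \<inter> {y \<in> U. h y \<in> ?W'}" by (auto simp: overlap_def)
  ultimately have T: "openin (mtop M) ?T"
    using openin_Int[OF W openin_preimage_subtopology[OF smooth_intoD(3)[OF h] smooth_intoD(1)[OF h]]] by simp
  have xT: "x \<in> ?T" using x cc dc ec by (auto simp: overlap_def)
  have Tc: "fst c \<inter> ?T = ?T" by (auto simp: overlap_def)
  have D1: "(loc_rep c d h has_derivative germ_deriv U c d h x) (at (snd c x) within snd c ` ?T)"
    by (rule has_derivative_subset[OF germ_deriv_works[OF M N h x(1) c d]]) auto
  have "loc_rep c d h (snd c x) = snd d (h x)" by (simp add: loc_rep_def chart_inv_chart[OF cc(2,3)])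
  moreover have "loc_rep c d h ` (snd c ` ?T) \<subseteq> snd d ` ?W'"
    by (auto simp: loc_rep_def overlap_def chart_inv_chart[OF cc(2)])
  ultimately have D2: "(loc_rep d e k has_derivative germ_deriv V d e k (h x))
      (at (loc_rep c d h (snd c x)) within loc_rep c d h ` (snd c ` ?T))"
    using has_derivative_subset[OF germ_deriv_works[OF N P k x(2) d e]] by simp
  have "(loc_rep c e (k \<circ> h) has_derivative (\<lambda>v. germ_deriv V d e k (h x) (germ_deriv U c d h x v)))
      (at (snd c x) within snd c ` (fst c \<inter> ?T))"
    unfolding Tc
    by (rule has_derivative_transform_within[OF has_derivative_in_compose[OF D1 D2], of 1])
       (use xT loc_rep_comp[OF cc(2) dc(2), of _ h e k] in \<open>auto simp: overlap_def\<close>)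
  then show ?thesis
    by (intro germ_deriv_unique[OF M P smooth_into_compose[OF M N P h k] _ c _ T xT]) (use x e in auto)
qed

lemma overlap_pts: "is_chart M c \<Longrightarrow> snd c ` overlap c d (pts M) h = loc_dom c d h"
  using chart_domain_subset[of M c] by (auto simp: overlap_def loc_dom_def)

lemma loc_deriv_eq_germ_deriv: "is_chart M c \<Longrightarrow> loc_deriv c d h x = germ_deriv (pts M) c d h x"
  by (simp add: loc_deriv_def germ_deriv_def overlap_pts)

lemma smooth_map_iff_smooth_into:
  assumes "manifold_with_corners M"
  shows "smooth_map M (N :: ('c, 'd::real_inner) mfd) h \<longleftrightarrow> smooth_into M N (pts M) h"
proof -
  have "snd c ` overlap c d (pts M) h = loc_dom c d h" if "c \<in> matlas M" for c and d :: "('c, 'd) chart"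
    using overlap_pts[OF is_chart_of_atlas[OF assms that]] .
  then show ?thesis by (simp add: smooth_map_def smooth_into_def cong: ball_cong)
qed

lemma smooth_into_id:
  assumes "manifold_with_corners M"
  shows "smooth_into M M (pts M) id"
  using assms unfolding smooth_map_iff_smooth_into[OF assms, symmetric]
  by (simp add: smooth_map_def manifold_with_corners_def id_def[symmetric])

lemma germ_deriv_id:
  assumes M: "manifold_with_corners M" and c: "c \<in> charts_at M x"
  shows "germ_deriv (pts M) c c id x v = v"
proof -
  note cc = charts_atD[OF M c]
  have "(loc_rep c c id has_derivative (\<lambda>v. v)) (at (snd c x) within snd c ` (fst c \<inter> fst c))"
    by (rule has_derivative_transform_within[OF has_derivative_ident, of 1])
       (use cc in \<open>auto simp: loc_rep_def chart_inv_chart[OF cc(2)]\<close>)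
  then have "germ_deriv (pts M) c c id x = (\<lambda>v. v)"
    by (intro germ_deriv_unique[OF M M smooth_into_id[OF M] _ c _ openin_chart_domain[OF cc(2)]])
       (use cc c in auto)
  then show ?thesis by simp
qed

text \<open>A change of chart is the coordinate expression of the identity, so the transformation
  rule is the chain rule with one factor \<open>id\<close>.\<close>

lemma germ_deriv_pre_id:
  assumes M: "manifold_with_corners M" and N: "manifold_with_corners N" and h: "smooth_into M N U h"
    and x: "x \<in> U" and c: "c \<in> charts_at M x" and c': "c' \<in> charts_at M x" and d: "d \<in> charts_at N (h x)"
  shows "germ_deriv U c d h x v = germ_deriv U c' d h x (germ_deriv (pts M) c c' id x v)"
proof -
  have "{y \<in> pts M. id y \<in> U} = U" using smooth_intoD(2)[OF h] by auto
  then show ?thesis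
    using germ_deriv_compose[OF M M N smooth_into_id[OF M] h _ _ c, of c' d] x c' d smooth_intoD(2)[OF h]
    by auto
qed

lemma germ_deriv_post_id:
  assumes M: "manifold_with_corners M" and N: "manifold_with_corners N" and h: "smooth_into M N U h"
    and x: "x \<in> U" and c: "c \<in> charts_at M x" and d: "d \<in> charts_at N (h x)" and d': "d' \<in> charts_at N (h x)"
  shows "germ_deriv U c d' h x v = germ_deriv (pts N) d d' id (h x) (germ_deriv U c d h x v)"
proof -
  have "{y \<in> U. h y \<in> pts N} = U" using smooth_intoD(4)[OF h] by auto
  then show ?thesis
    using germ_deriv_compose[OF M N N h smooth_into_id[OF N] x _ c d, of d'] d' smooth_intoD(4)[OF h x]
    by auto
qed

section \<open>Tangent vectors in charts\<close>

lemma mem_tangent_space_iff: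
  fixes M :: "('a, 'e::real_inner) mfd"
  assumes "manifold_with_corners M"
  shows "v \<in> tangent_space M x \<longleftrightarrow>
    (\<forall>c\<in>charts_at M x. \<forall>d\<in>charts_at M x. v d = germ_deriv (pts M) c d id x (v c)) \<and>
    (\<forall>c. c \<notin> charts_at M x \<longrightarrow> v c = 0)"
proof -
  have "loc_deriv c d id x = germ_deriv (pts M) c d id x" if "c \<in> charts_at M x" for c d :: "('a, 'e) chart"
    using loc_deriv_eq_germ_deriv[OF charts_atD(2)[OF assms that]] .
  then show ?thesis by (simp add: tangent_space_def cong: ball_cong)
qed

lemma tangent_vec_change:
  assumes "manifold_with_corners M" "v \<in> tangent_space M x" "c \<in> charts_at M x" "d \<in> charts_at M x"
  shows "v d = germ_deriv (pts M) c d id x (v c)"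
  using assms(2)[unfolded mem_tangent_space_iff[OF assms(1)], THEN conjunct1, rule_format, OF assms(3,4)] .

lemma tangent_vec_ext:
  assumes "manifold_with_corners M" "v \<in> tangent_space M x" "w \<in> tangent_space M x"
    "c \<in> charts_at M x" "v c = w c"
  shows "v = w"
proof
  fix d
  show "v d = w d"
  proof (cases "d \<in> charts_at M x")
    case True
    then show ?thesis
      using tangent_vec_change[OF assms(1,2,4)] tangent_vec_change[OF assms(1,3,4)] assms(5) by metis
  next
    case False
    then show ?thesis using assms(2,3) by (simp add: tangent_space_def)
  qed
qed

lemma coord_vec_in:
  fixes M :: "('a, 'e::real_inner) mfd"
  assumes M: "manifold_with_corners M" and c: "c \<in> charts_at M x"
  shows "coord_vec M c x e \<in> tangent_space M x"
  unfolding mem_tangent_space_iff[OF M]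
proof (intro conjI ballI allI impI)
  fix d d' :: "('a, 'e) chart"
  assume d: "d \<in> charts_at M x" "d' \<in> charts_at M x"
  show "coord_vec M c x e d' = germ_deriv (pts M) d d' id x (coord_vec M c x e d)"
    using germ_deriv_post_id[OF M M smooth_into_id[OF M] charts_atD(4)[OF M c] c, of d d'] d
      loc_deriv_eq_germ_deriv[OF charts_atD(2)[OF M c], of d id x] loc_deriv_eq_germ_deriv[OF charts_atD(2)[OF M c], of d' id x]
    by (simp add: coord_vec_def)
qed (simp add: coord_vec_def)

lemma coord_vec_eval:
  assumes M: "manifold_with_corners M" and c: "c \<in> charts_at M x"
  shows "coord_vec M c x e c = e"
  using germ_deriv_id[OF M c] c
  by (simp add: coord_vec_def loc_deriv_eq_germ_deriv[OF charts_atD(2)[OF M c]])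

lemma coord_vec_of_tangent:
  assumes M: "manifold_with_corners M" and c: "c \<in> charts_at M x" and v: "v \<in> tangent_space M x"
  shows "coord_vec M c x (v c) = v"
  using tangent_vec_ext[OF M coord_vec_in[OF M c] v c] coord_vec_eval[OF M c] by blast

lemma tangent_space_lincomb:
  assumes M: "manifold_with_corners M" and v: "v \<in> tangent_space M x" "w \<in> tangent_space M x"
  shows "(\<lambda>c. a *\<^sub>R v c + b *\<^sub>R w c) \<in> tangent_space M x"
proof -
  have "linear (germ_deriv (pts M) c d id x)" if "c \<in> charts_at M x" "d \<in> charts_at M x" for c d
    by (rule germ_deriv_linear[OF M M smooth_into_id[OF M]]) (use that charts_atD[OF M] in auto)
  then have "a *\<^sub>R v d + b *\<^sub>R w d = germ_deriv (pts M) c d id x (a *\<^sub>R v c + b *\<^sub>R w c)"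
    if "c \<in> charts_at M x" "d \<in> charts_at M x" for c d
    using that tangent_vec_change[OF M v(1), of c d] tangent_vec_change[OF M v(2), of c d]
    by (simp add: linear_add linear_cmul)
  moreover have "a *\<^sub>R v c + b *\<^sub>R w c = 0" if "c \<notin> charts_at M x" for c
    using v that by (simp add: tangent_space_def)
  ultimately show ?thesis
    unfolding mem_tangent_space_iff[OF M] by blast
qed

lemma coord_vec_lincomb:
  assumes M: "manifold_with_corners M" and c: "c \<in> charts_at M x"
  shows "coord_vec M c x (a *\<^sub>R e + b *\<^sub>R e') = (\<lambda>d. a *\<^sub>R coord_vec M c x e d + b *\<^sub>R coord_vec M c x e' d)"
  by (rule tangent_vec_ext[OF M coord_vec_in[OF M c] tangent_space_lincomb[OF M coord_vec_in[OF M c] coord_vec_in[OF M c]] c])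
     (simp add: coord_vec_eval[OF M c])

section \<open>Differentials of germs\<close>

definition tdiff ::
    "('a, 'e::real_inner) mfd \<Rightarrow> ('b, 'f::real_inner) mfd \<Rightarrow> 'a set \<Rightarrow> ('a \<Rightarrow> 'b) \<Rightarrow> 'a \<Rightarrow>
     ('a, 'e) tvec \<Rightarrow> ('b, 'f) tvec" where
  "tdiff M N U h x v =
     (let c = (SOME c. c \<in> charts_at M x)
      in (\<lambda>d. if d \<in> charts_at N (h x) then germ_deriv U c d h x (v c) else 0))"

lemma differential_eq_tdiff:
  assumes "manifold_with_corners M" "x \<in> pts M"
  shows "differential M N h x = tdiff M N (pts M) h x"
proof -
  have "(SOME c. c \<in> charts_at M x) \<in> charts_at M x"
    using charts_at_nonempty[OF assms] by (metis someI)
  note eq = loc_deriv_eq_germ_deriv[OF charts_atD(2)[OF assms(1) this]]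
  show ?thesis
    by (intro ext) (simp add: differential_def tdiff_def Let_def eq)
qed

text \<open>Removes the choice of chart from \<open>tdiff\<close>: passing from the chosen chart to
  \<open>c\<close> changes the coordinates of \<open>v\<close> and the derivative in opposite
  ways.\<close>

lemma tdiff_eval:
  assumes M: "manifold_with_corners M" and N: "manifold_with_corners N" and h: "smooth_into M N U h"
    and x: "x \<in> U" and v: "v \<in> tangent_space M x" and c: "c \<in> charts_at M x" and d: "d \<in> charts_at N (h x)"
  shows "tdiff M N U h x v d = germ_deriv U c d h x (v c)"
proof -
  let ?c = "SOME c. c \<in> charts_at M x"
  have c': "?c \<in> charts_at M x" using c by (rule someI)
  have "v c = germ_deriv (pts M) ?c c id x (v ?c)"
    using tangent_vec_change[OF M v c' c] .
  then show ?thesis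
    using germ_deriv_pre_id[OF M N h x c' c d] d by (simp add: tdiff_def Let_def)
qed

lemma tdiff_in:
  assumes M: "manifold_with_corners M" and N: "manifold_with_corners N" and h: "smooth_into M N U h"
    and x: "x \<in> U"
  shows "tdiff M N U h x v \<in> tangent_space N (h x)"
proof -
  let ?c = "SOME c. c \<in> charts_at M x"
  have c': "?c \<in> charts_at M x"
    using charts_at_nonempty[OF M] smooth_intoD(2)[OF h] x by (metis someI subsetD)
  show ?thesis
    unfolding mem_tangent_space_iff[OF N]
  proof (intro conjI ballI allI impI)
    fix d d' assume d: "d \<in> charts_at N (h x)" "d' \<in> charts_at N (h x)"
    show "tdiff M N U h x v d' = germ_deriv (pts N) d d' id (h x) (tdiff M N U h x v d)"
      using germ_deriv_post_id[OF M N h x c' d, of "v ?c"] d by (simp only: tdiff_def Let_def if_True)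
  qed (simp add: tdiff_def Let_def)
qed

lemma tdiff_compose:
  assumes M: "manifold_with_corners M" and N: "manifold_with_corners N" and P: "manifold_with_corners P"
    and h: "smooth_into M N U h" and k: "smooth_into N P V k" and x: "x \<in> U" "h x \<in> V"
    and v: "v \<in> tangent_space M x"
  shows "tdiff M P {x \<in> U. h x \<in> V} (k \<circ> h) x v = tdiff N P V k (h x) (tdiff M N U h x v)"
proof -
  let ?U = "{x \<in> U. h x \<in> V}"
  have kh: "smooth_into M P ?U (k \<circ> h)" using smooth_into_compose[OF M N P h k] .
  obtain c where c: "c \<in> charts_at M x" using charts_at_nonempty[OF M] smooth_intoD(2)[OF h] x by blast
  obtain d where d: "d \<in> charts_at N (h x)" using charts_at_nonempty[OF N] smooth_intoD(2)[OF k] x by blast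
  obtain e where e: "e \<in> charts_at P (k (h x))" using charts_at_nonempty[OF P] smooth_intoD(4)[OF k] x by blast
  show ?thesis
  proof (rule tangent_vec_ext[OF P _ _ e])
    show "tdiff M P ?U (k \<circ> h) x v \<in> tangent_space P (k (h x))"
      using tdiff_in[OF M P kh] x by auto
    show "tdiff N P V k (h x) (tdiff M N U h x v) \<in> tangent_space P (k (h x))"
      using tdiff_in[OF N P k x(2)] .
    show "tdiff M P ?U (k \<circ> h) x v e = tdiff N P V k (h x) (tdiff M N U h x v) e"
      using tdiff_eval[OF M P kh _ v c] tdiff_eval[OF N P k x(2) tdiff_in[OF M N h x(1)] d e]
        tdiff_eval[OF M N h x(1) v c d] germ_deriv_compose[OF M N P h k x c d e] x e by simp
  qed
qed

lemma tdiff_cong: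
  assumes M: "manifold_with_corners M" and N: "manifold_with_corners N"
    and h: "smooth_into M N U h" "smooth_into M N U' h'"
    and W: "x \<in> W" "openin (mtop M) W" "W \<subseteq> U" "W \<subseteq> U'" "\<And>u. u \<in> W \<Longrightarrow> h u = h' u"
  shows "tdiff M N U h x = tdiff M N U' h' x"
proof -
  let ?c = "SOME c. c \<in> charts_at M x"
  have c': "?c \<in> charts_at M x"
    using charts_at_nonempty[OF M] openin_subset[OF W(2)] W(1) by (metis someI subsetD)
  then show ?thesis
    using germ_deriv_cong[OF M N h W c'] W(1,5) by (intro ext) (auto simp: tdiff_def Let_def)
qed

lemma tdiff_id:
  assumes M: "manifold_with_corners M" and U: "openin (mtop M) U" and x: "x \<in> U"
    and v: "v \<in> tangent_space M x"
  shows "tdiff M M U id x v = v"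
proof -
  have xM: "x \<in> pts M" using openin_subset[OF U] x by blast
  obtain c where c: "c \<in> charts_at M x" using charts_at_nonempty[OF M xM] .
  have i: "smooth_into M M U id"
    by (rule smooth_into_subset[OF M smooth_into_id[OF M] U openin_subset[OF U]]) simp
  have "tdiff M M U id x v = tdiff M M (pts M) id x v"
    using tdiff_cong[OF M M i smooth_into_id[OF M] x U] openin_subset[OF U] by auto
  also have "\<dots> = v"
  proof (rule tangent_vec_ext[OF M _ v c])
    show "tdiff M M (pts M) id x v \<in> tangent_space M x"
      using tdiff_in[OF M M smooth_into_id[OF M] xM] by simp
    show "tdiff M M (pts M) id x v c = v c"
      using tdiff_eval[OF M M smooth_into_id[OF M] xM v c] c germ_deriv_id[OF M c] by simp
  qed
  finally show ?thesis .
qed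

lemma tdiff_lincomb:
  assumes M: "manifold_with_corners M" and N: "manifold_with_corners N" and h: "smooth_into M N U h"
    and x: "x \<in> U"
  shows "tdiff M N U h x (\<lambda>c. a *\<^sub>R v c + b *\<^sub>R w c)
    = (\<lambda>d. a *\<^sub>R tdiff M N U h x v d + b *\<^sub>R tdiff M N U h x w d)"
proof -
  let ?c = "SOME c. c \<in> charts_at M x"
  have c': "?c \<in> charts_at M x"
    using charts_at_nonempty[OF M] smooth_intoD(2)[OF h] x by (metis someI subsetD)
  show ?thesis
    using germ_deriv_linear[OF M N h x c']
    by (auto simp: tdiff_def Let_def linear_add linear_cmul)
qed

lemma tdiff_coord_vec:
  assumes M: "manifold_with_corners M" and N: "manifold_with_corners N" and h: "smooth_into M N U h"
    and x: "x \<in> U" and c: "c \<in> charts_at M x" and d: "d \<in> charts_at N (h x)"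
  shows "tdiff M N U h x (coord_vec M c x e) = coord_vec N d (h x) (germ_deriv U c d h x e)"
  using tdiff_eval[OF M N h x coord_vec_in[OF M c] c d] coord_vec_eval[OF M c]
    coord_vec_of_tangent[OF N d tdiff_in[OF M N h x]] by metis

section \<open>Local diffeomorphisms\<close>

lemma smooth_map_open_submfd:
  fixes M :: "('a, 'e::real_inner) mfd" and N :: "('b, 'f::real_inner) mfd"
  assumes M: "manifold_with_corners M" and U: "openin (mtop M) U"
    and h: "smooth_map (open_submfd M U) (open_submfd N V) h"
  shows "smooth_into M N U h" "h ` U \<subseteq> V"
proof -
  have ch: "continuous_map (subtopology (mtop M) U) (subtopology (mtop N) V) h"
    using h by (simp add: smooth_map_def open_submfd_def)
  have tU: "topspace (subtopology (mtop M) U) = U" using openin_subset[OF U] by (simp add: inf.absorb2)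
  show hUV: "h ` U \<subseteq> V"
    using ch tU unfolding continuous_map_in_subtopology by auto
  show "smooth_into M N U h"
    unfolding smooth_into_def
  proof (intro conjI ballI)
    show "openin (mtop M) U" by (rule U)
    show "continuous_map (subtopology (mtop M) U) (mtop N) h"
      using ch by (simp add: continuous_map_in_subtopology)
    fix c :: "('a, 'e) chart" and d :: "('b, 'f) chart"
    assume c: "c \<in> matlas M" and d: "d \<in> matlas N"
    let ?c = "(fst c \<inter> U, snd c)" and ?d = "(fst d \<inter> V, snd d)"
    note cc = is_chart_of_atlas[OF M c]
    have sm: "smooth_on (loc_dom ?c ?d h) (loc_rep ?c ?d h)"
      using h c d by (auto simp: smooth_map_def open_submfd_def)
    have dom: "loc_dom ?c ?d h = snd c ` overlap c d U h"
      using hUV by (auto simp: loc_dom_def overlap_def)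
    \<comment> \<open>\<open>chart_inv\<close> depends on the chart domain through
      \<open>inv_into\<close>; injectivity of the chart makes the inverses for the large and the
      small domain agree on the smaller image.\<close>
    have "chart_inv ?c (snd c x) = chart_inv c (snd c x)" if "x \<in> fst c" "x \<in> U" for x
      using that inj_on_chart[OF cc] chart_inv_chart[OF cc]
      by (auto simp: chart_inv_def inv_into_f_f inj_on_subset)
    then have "loc_rep ?c ?d h p = loc_rep c d h p" if "p \<in> snd c ` overlap c d U h" for p
      using that by (auto simp: loc_rep_def overlap_def)
    then show "smooth_on (snd c ` overlap c d U h) (loc_rep c d h)"
      using sm smooth_at_cong[of "snd c ` overlap c d U h" "loc_rep ?c ?d h" _ UNIV]
      unfolding dom smooth_on_iff_smooth_at by auto
  qed
qed

definition local_inverse ::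
    "('a, 'e::real_inner) mfd \<Rightarrow> ('b, 'f::real_inner) mfd \<Rightarrow> ('a \<Rightarrow> 'b) \<Rightarrow> 'a set \<Rightarrow> 'b set \<Rightarrow> ('b \<Rightarrow> 'a) \<Rightarrow> bool"
  where
  "local_inverse M N h U V g \<longleftrightarrow>
     smooth_into M N U h \<and> smooth_into N M V g \<and>
     (\<forall>x\<in>U. h x \<in> V \<and> g (h x) = x) \<and> (\<forall>y\<in>V. g y \<in> U \<and> h (g y) = y)"

lemma local_diffeo_local_inverse:
  assumes M: "manifold_with_corners M" and N: "manifold_with_corners N"
    and h: "local_diffeo M N h" and x: "x \<in> pts M"
  obtains U V g where "local_inverse M N h U V g" "x \<in> U"
proof -
  obtain U V where UV: "openin (mtop M) U" "x \<in> U" "openin (mtop N) V"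
    "diffeo (open_submfd M U) (open_submfd N V) h"
    using h x by (auto simp: local_diffeo_def)
  obtain g where g: "smooth_map (open_submfd N V) (open_submfd M U) g"
    "\<And>x. x \<in> pts (open_submfd M U) \<Longrightarrow> g (h x) = x" "\<And>y. y \<in> pts (open_submfd N V) \<Longrightarrow> h (g y) = y"
    and h': "smooth_map (open_submfd M U) (open_submfd N V) h"
    using UV(4) by (auto simp: diffeo_def)
  have "pts (open_submfd M U) = U" "pts (open_submfd N V) = V"
    using openin_subset[OF UV(1)] openin_subset[OF UV(3)] by (auto simp: open_submfd_def)
  then have "local_inverse M N h U V g"
    using smooth_map_open_submfd[OF M UV(1) h'] smooth_map_open_submfd[OF N UV(3) g(1)] g(2,3)
    by (auto simp: local_inverse_def)
  then show thesis using that UV(2) by blast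
qed

text \<open>Continuity and smoothness at a point may be tested on any open neighbourhood, because
  its coordinate image is relatively open in the corner.\<close>

lemma smooth_into_local:
  fixes M :: "('a, 'e::real_inner) mfd" and N :: "('b, 'f::real_inner) mfd"
  assumes M: "manifold_with_corners M" and N: "manifold_with_corners N"
    and loc: "\<And>x. x \<in> pts M \<Longrightarrow> \<exists>U. x \<in> U \<and> smooth_into M N U h"
  shows "smooth_into M N (pts M) h"
  unfolding smooth_into_def
proof (intro conjI ballI)
  show "openin (mtop M) (pts M)" by simp
  show "continuous_map (subtopology (mtop M) (pts M)) (mtop N) h"
    unfolding continuous_map_def
  proof (intro conjI allI impI)
    show "h \<in> topspace (subtopology (mtop M) (pts M)) \<rightarrow> pts N"
      using loc smooth_intoD(4) by fastforce
    fix V assume V: "openin (mtop N) V"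
    have "openin (mtop M) {x \<in> pts M. h x \<in> V}"
    proof (subst openin_subopen, intro ballI)
      fix x assume "x \<in> {x \<in> pts M. h x \<in> V}"
      then obtain U where U: "x \<in> U" "smooth_into M N U h" "h x \<in> V" using loc by auto
      show "\<exists>T. openin (mtop M) T \<and> x \<in> T \<and> T \<subseteq> {x \<in> pts M. h x \<in> V}"
        by (rule exI[of _ "{x \<in> U. h x \<in> V}"])
           (use U smooth_intoD(2)[OF U(2)] openin_preimage_subtopology[OF smooth_intoD(3,1)[OF U(2)] V] in auto)
    qed
    then show "openin (subtopology (mtop M) (pts M)) {x \<in> topspace (subtopology (mtop M) (pts M)). h x \<in> V}"
      by simp
  qed
  fix c :: "('a, 'e) chart" and d :: "('b, 'f) chart"
  assume c: "c \<in> matlas M" and d: "d \<in> matlas N"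
  note cc = is_chart_of_atlas[OF M c] and dc = is_chart_of_atlas[OF N d]
  show "smooth_on (snd c ` overlap c d (pts M) h) (loc_rep c d h)"
    unfolding smooth_on_iff_smooth_at
  proof
    fix p assume "p \<in> snd c ` overlap c d (pts M) h"
    then obtain x where x: "p = snd c x" "x \<in> fst c" "x \<in> pts M" "h x \<in> fst d" by (auto simp: overlap_def)
    obtain U where U: "x \<in> U" "smooth_into M N U h" using loc x(3) by blast
    have xU: "p \<in> snd c ` overlap c d U h" using x U(1) by (auto simp: overlap_def)
    have 1: "smooth_at (snd c ` overlap c d U h) (loc_rep c d h) p"
      using U(2) c d xU by (auto simp: smooth_into_def smooth_on_iff_smooth_at)
    have 2: "snd c ` overlap c d U h \<subseteq> snd c ` overlap c d (pts M) h"
      using smooth_intoD(2)[OF U(2)] by (auto simp: overlap_def)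
    have 3: "snd c ` overlap c d (pts M) h \<subseteq> corner (mbasis M)"
      using cc openin_subset[of "top_of_set (corner (mbasis M))" "snd c ` fst c"]
      by (auto simp: is_chart_def overlap_def)
    show "smooth_at (snd c ` overlap c d (pts M) h) (loc_rep c d h) p"
      using smooth_at_openin_localize[OF openin_chart_image_overlap[OF U(2) cc dc] 2 3 1 xU] .
  qed
qed

lemma local_diffeo_smooth_into:
  assumes M: "manifold_with_corners M" and N: "manifold_with_corners N" and h: "local_diffeo M N h"
  shows "smooth_into M N (pts M) h"
  using smooth_into_local[OF M N] local_diffeo_local_inverse[OF M N h] unfolding local_inverse_def by metis

lemma differential_in:
  assumes "manifold_with_corners M" "manifold_with_corners N" "smooth_into M N (pts M) h" "x \<in> pts M"
  shows "differential M N h x v \<in> tangent_space N (h x)"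
  using tdiff_in[OF assms] by (simp add: differential_eq_tdiff assms(1,4))

lemma differential_lincomb:
  assumes "manifold_with_corners M" "manifold_with_corners N" "smooth_into M N (pts M) h" "x \<in> pts M"
  shows "differential M N h x (\<lambda>c. a *\<^sub>R v c + b *\<^sub>R w c)
    = (\<lambda>d. a *\<^sub>R differential M N h x v d + b *\<^sub>R differential M N h x w d)"
  using tdiff_lincomb[OF assms] by (simp add: differential_eq_tdiff assms(1,4))

lemma differential_compose:
  assumes M: "manifold_with_corners M" and N: "manifold_with_corners N" and P: "manifold_with_corners P"
    and h: "smooth_into M N (pts M) h" and k: "smooth_into N P (pts N) k" and x: "x \<in> pts M"
    and v: "v \<in> tangent_space M x"
  shows "differential M P (\<lambda>y. k (h y)) x v = differential N P k (h x) (differential M N h x v)"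
proof -
  have "{x \<in> pts M. h x \<in> pts N} = pts M" using smooth_intoD(4)[OF h] by auto
  then show ?thesis
    using tdiff_compose[OF M N P h k x smooth_intoD(4)[OF h x] v] smooth_intoD(4)[OF h x]
    by (simp add: differential_eq_tdiff M N x o_def)
qed

lemma differential_cong:
  assumes M: "manifold_with_corners M" and N: "manifold_with_corners N" and h: "smooth_into M N (pts M) h"
    and x: "x \<in> pts M" and eq: "\<And>y. y \<in> pts M \<Longrightarrow> h y = h' y"
  shows "differential M N h x = differential M N h' x"
proof -
  have "smooth_into M N (pts M) h'"
    by (rule smooth_into_subset[OF M h]) (use eq in auto)
  from tdiff_cong[OF M N h this x] show ?thesis
    by (simp add: differential_eq_tdiff[OF M x] eq)
qed

text \<open>The chain rule is applied to \<open>g \<circ> h\<close> and \<open>h \<circ> g\<close>.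
  These agree with the identity only on \<open>U\<close> and \<open>V\<close>, which suffices
  because differentials depend only on germs.\<close>

lemma tdiff_differential_inverse:
  assumes M: "manifold_with_corners M" and N: "manifold_with_corners N" and h: "smooth_into M N (pts M) h"
    and g: "local_inverse M N h U V g" and x: "x \<in> U"
  shows "v \<in> tangent_space M x \<Longrightarrow> tdiff N M V g (h x) (differential M N h x v) = v"
    and "w \<in> tangent_space N (h x) \<Longrightarrow> differential M N h x (tdiff N M V g (h x) w) = w"
proof -
  have hU: "smooth_into M N U h" and gV: "smooth_into N M V g"
    and gh: "\<And>x. x \<in> U \<Longrightarrow> h x \<in> V \<and> g (h x) = x" and hg: "\<And>y. y \<in> V \<Longrightarrow> g y \<in> U \<and> h (g y) = y"
    using g by (auto simp: local_inverse_def)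
  note U = smooth_intoD(1,2)[OF hU] and V = smooth_intoD(1,2)[OF gV]
  have xM: "x \<in> pts M" using U x by blast
  have diff: "differential M N h x = tdiff M N U h x"
    using tdiff_cong[OF M N h hU x U(1) U(2)] by (simp add: differential_eq_tdiff[OF M xM])
  have eU: "{y \<in> U. h y \<in> V} = U" and eV: "{y \<in> V. g y \<in> U} = V" using gh hg by auto
  show "tdiff N M V g (h x) (differential M N h x v) = v" if v: "v \<in> tangent_space M x"
  proof -
    have "tdiff N M V g (h x) (differential M N h x v) = tdiff M M U (g \<circ> h) x v"
      using tdiff_compose[OF M N M hU gV x _ v] gh[OF x] by (simp add: diff eU)
    also have "\<dots> = tdiff M M U id x v"
    proof (rule fun_cong[OF tdiff_cong[OF M M _ _ x U(1)]])
      show "smooth_into M M U (g \<circ> h)" using smooth_into_compose[OF M N M hU gV] by (simp only: eU)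
      show "smooth_into M M U id" using smooth_into_subset[OF M smooth_into_id[OF M] U(1,2)] by simp
    qed (use gh in auto)
    also have "\<dots> = v" using tdiff_id[OF M U(1) x v] .
    finally show ?thesis .
  qed
  show "differential M N h x (tdiff N M V g (h x) w) = w" if w: "w \<in> tangent_space N (h x)"
  proof -
    have hx: "h x \<in> V" "g (h x) = x" using gh x by auto
    have "differential M N h x (tdiff N M V g (h x) w) = tdiff N N V (h \<circ> g) (h x) w"
      using tdiff_compose[OF N M N gV hU hx(1) _ w] hx x by (simp add: diff eV)
    also have "\<dots> = tdiff N N V id (h x) w"
    proof (rule fun_cong[OF tdiff_cong[OF N N _ _ hx(1) V(1)]])
      show "smooth_into N N V (h \<circ> g)" using smooth_into_compose[OF N M N gV hU] by (simp only: eV)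
      show "smooth_into N N V id" using smooth_into_subset[OF N smooth_into_id[OF N] V(1,2)] by simp
    qed (use hg in auto)
    also have "\<dots> = w" using tdiff_id[OF N V(1) hx(1) w] .
    finally show ?thesis .
  qed
qed

section \<open>Inverse differentials of local diffeomorphisms\<close>

definition dinv ::
    "('a, 'e::real_inner) mfd \<Rightarrow> ('b, 'f::real_inner) mfd \<Rightarrow> ('a \<Rightarrow> 'b) \<Rightarrow> 'a \<Rightarrow>
     ('b, 'f) tvec \<Rightarrow> ('a, 'e) tvec" where
  "dinv M N h x = inv_into (tangent_space M x) (differential M N h x)"

text \<open>Identifies the set-theoretic inverse that occurs in \<open>push\<close> with the
  differential of a smooth local inverse, to which the chain rule applies.\<close>

lemma dinv_eq_tdiff:
  assumes M: "manifold_with_corners M" and N: "manifold_with_corners N" and h: "smooth_into M N (pts M) h"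
    and g: "local_inverse M N h U V g" and x: "x \<in> U" and w: "w \<in> tangent_space N (h x)"
  shows "dinv M N h x w = tdiff N M V g (h x) w"
proof -
  have V: "smooth_into N M V g" "h x \<in> V" "g (h x) = x" using g x by (auto simp: local_inverse_def)
  have inj: "inj_on (differential M N h x) (tangent_space M x)"
    using tdiff_differential_inverse(1)[OF M N h g x] by (metis inj_on_inverseI)
  have "tdiff N M V g (h x) w \<in> tangent_space M x"
    using tdiff_in[OF N M V(1,2)] V(3) by simp
  then show ?thesis
    using inv_into_f_f[OF inj] tdiff_differential_inverse(2)[OF M N h g x w] unfolding dinv_def by metis
qed

lemma
  assumes M: "manifold_with_corners M" and N: "manifold_with_corners N"
    and h: "local_diffeo M N h" and x: "x \<in> pts M"
  shows dinv_in: "w \<in> tangent_space N (h x) \<Longrightarrow> dinv M N h x w \<in> tangent_space M x"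
    and differential_dinv: "w \<in> tangent_space N (h x) \<Longrightarrow> differential M N h x (dinv M N h x w) = w"
    and dinv_differential: "v \<in> tangent_space M x \<Longrightarrow> dinv M N h x (differential M N h x v) = v"
proof -
  note hs = local_diffeo_smooth_into[OF M N h]
  obtain U V g where g: "local_inverse M N h U V g" "x \<in> U" by (rule local_diffeo_local_inverse[OF M N h x])
  have V: "smooth_into N M V g" "h x \<in> V" "g (h x) = x" using g by (auto simp: local_inverse_def)
  note td = tdiff_differential_inverse[OF M N hs g] and eq = dinv_eq_tdiff[OF M N hs g]
  show "w \<in> tangent_space N (h x) \<Longrightarrow> dinv M N h x w \<in> tangent_space M x"
    using tdiff_in[OF N M V(1,2)] V(3) by (simp add: eq)
  show "w \<in> tangent_space N (h x) \<Longrightarrow> differential M N h x (dinv M N h x w) = w"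
    by (simp add: eq td)
  show "v \<in> tangent_space M x \<Longrightarrow> dinv M N h x (differential M N h x v) = v"
    using eq[OF differential_in[OF M N hs x]] td by simp
qed

lemma dinv_lincomb:
  assumes M: "manifold_with_corners M" and N: "manifold_with_corners N"
    and h: "local_diffeo M N h" and x: "x \<in> pts M"
    and v: "v \<in> tangent_space N (h x)" "w \<in> tangent_space N (h x)"
  shows "dinv M N h x (\<lambda>c. a *\<^sub>R v c + b *\<^sub>R w c) = (\<lambda>d. a *\<^sub>R dinv M N h x v d + b *\<^sub>R dinv M N h x w d)"
proof -
  note hs = local_diffeo_smooth_into[OF M N h]
  note i = dinv_in[OF M N h x]
  have "differential M N h x (\<lambda>d. a *\<^sub>R dinv M N h x v d + b *\<^sub>R dinv M N h x w d)
      = (\<lambda>c. a *\<^sub>R v c + b *\<^sub>R w c)"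
    by (simp add: differential_lincomb[OF M N hs x] differential_dinv[OF M N h x] v)
  then show ?thesis
    using dinv_differential[OF M N h x tangent_space_lincomb[OF M i[OF v(1)] i[OF v(2)], of a b]] by simp
qed

section \<open>Transport of tangent vectors along morphisms\<close>

locale etale_groupoid =
  fixes X :: "('a, 'm, 'e::real_inner) gpd"
  assumes etale: "etale_proper_groupoid X"
begin

lemma
  shows gpd: "groupoid X"
    and obj: "manifold_with_corners (Obj X)" and mor: "manifold_with_corners (Mor X)"
    and src_diffeo: "local_diffeo (Mor X) (Obj X) (src X)"
    and tgt_diffeo: "local_diffeo (Mor X) (Obj X) (tgt X)"
    and comp_continuous: "continuous_map
       (subtopology (prod_topology (mtop (Mor X)) (mtop (Mor X))) {(g, f). src X g = tgt X f})
       (mtop (Mor X)) (\<lambda>(g, f). comp X g f)"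
  using etale by (auto simp: etale_proper_groupoid_def)

lemma
  shows src_in: "g \<in> mors X \<Longrightarrow> src X g \<in> obs X" and tgt_in: "g \<in> mors X \<Longrightarrow> tgt X g \<in> obs X"
    and idm_in: "x \<in> obs X \<Longrightarrow> idm X x \<in> mors X"
    and src_idm: "x \<in> obs X \<Longrightarrow> src X (idm X x) = x" and tgt_idm: "x \<in> obs X \<Longrightarrow> tgt X (idm X x) = x"
    and comp_in: "\<lbrakk>g \<in> mors X; f \<in> mors X; src X g = tgt X f\<rbrakk> \<Longrightarrow> comp X g f \<in> mors X"
    and src_comp: "\<lbrakk>g \<in> mors X; f \<in> mors X; src X g = tgt X f\<rbrakk> \<Longrightarrow> src X (comp X g f) = src X f"
    and tgt_comp: "\<lbrakk>g \<in> mors X; f \<in> mors X; src X g = tgt X f\<rbrakk> \<Longrightarrow> tgt X (comp X g f) = tgt X g"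
    and comp_assoc: "\<lbrakk>h \<in> mors X; g \<in> mors X; f \<in> mors X; src X h = tgt X g; src X g = tgt X f\<rbrakk> \<Longrightarrow>
       comp X (comp X h g) f = comp X h (comp X g f)"
    and comp_idm: "g \<in> mors X \<Longrightarrow> comp X g (idm X (src X g)) = g"
    and idm_comp: "g \<in> mors X \<Longrightarrow> comp X (idm X (tgt X g)) g = g"
    and invm_in: "g \<in> mors X \<Longrightarrow> invm X g \<in> mors X"
    and src_invm: "g \<in> mors X \<Longrightarrow> src X (invm X g) = tgt X g"
    and tgt_invm: "g \<in> mors X \<Longrightarrow> tgt X (invm X g) = src X g"
    and invm_comp: "g \<in> mors X \<Longrightarrow> comp X (invm X g) g = idm X (src X g)"
    and comp_invm: "g \<in> mors X \<Longrightarrow> comp X g (invm X g) = idm X (tgt X g)"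
  using gpd by (simp_all add: groupoid_def)

lemmas gpd_simps = src_in tgt_in idm_in src_idm tgt_idm comp_in src_comp tgt_comp comp_idm idm_comp
  invm_in src_invm tgt_invm invm_comp comp_invm

lemma invm_comp_cancel:
  assumes "g \<in> mors X" "f \<in> mors X" "src X g = tgt X f"
  shows "comp X (invm X g) (comp X g f) = f"
  using comp_assoc[of "invm X g" g f] assms by (simp add: gpd_simps)

lemma comp_invm_cancel:
  assumes "g \<in> mors X" "f \<in> mors X" "tgt X g = tgt X f"
  shows "comp X g (comp X (invm X g) f) = f"
  using comp_assoc[of g "invm X g" f] assms by (simp add: gpd_simps)

lemma comp_comp_invm_cancel:
  assumes "g \<in> mors X" "f \<in> mors X" "src X g = tgt X f"
  shows "comp X (comp X g f) (invm X f) = g"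
  using comp_assoc[of g f "invm X f"] comp_idm[OF assms(1)] assms by (simp add: gpd_simps)

lemma comp_left_cancel:
  assumes "g \<in> mors X" "f \<in> mors X" "f' \<in> mors X" "src X g = tgt X f" "src X g = tgt X f'"
    and "comp X g f = comp X g f'"
  shows "f = f'"
  using invm_comp_cancel[OF assms(1,2,4)] invm_comp_cancel[OF assms(1,3,5)] assms(6) by metis

lemma comp_right_cancel:
  assumes "f \<in> mors X" "g \<in> mors X" "g' \<in> mors X" "src X g = tgt X f" "src X g' = tgt X f"
    and "comp X g f = comp X g' f"
  shows "g = g'"
  using comp_comp_invm_cancel[OF assms(2,1,4)] comp_comp_invm_cancel[OF assms(3,1,5)] assms(6) by metis

text \<open>This is the map on arguments that results from \<open>pull\<close> along
  \<open>src\<close> followed by \<open>push\<close> along \<open>tgt\<close>; its description as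
  the differential of a germ follows in \<open>transp_eq_tdiff\<close>.\<close>

definition transp :: "'m \<Rightarrow> ('a, 'e) tvec \<Rightarrow> ('a, 'e) tvec" where
  "transp g w = differential (Mor X) (Obj X) (src X) g (dinv (Mor X) (Obj X) (tgt X) g w)"

lemmas src_smooth = local_diffeo_smooth_into[OF mor obj src_diffeo]
lemmas tgt_smooth = local_diffeo_smooth_into[OF mor obj tgt_diffeo]

lemma transp_in: "g \<in> mors X \<Longrightarrow> transp g w \<in> tangent_space (Obj X) (src X g)"
  unfolding transp_def by (rule differential_in[OF mor obj src_smooth])

lemma transp_differential_tgt:
  "\<lbrakk>g \<in> mors X; v \<in> tangent_space (Mor X) g\<rbrakk> \<Longrightarrow>
   transp g (differential (Mor X) (Obj X) (tgt X) g v) = differential (Mor X) (Obj X) (src X) g v"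
  by (simp add: transp_def dinv_differential[OF mor obj tgt_diffeo])

lemma transp_inj:
  assumes "g \<in> mors X" "v \<in> tangent_space (Obj X) (tgt X g)" "w \<in> tangent_space (Obj X) (tgt X g)"
    "transp g v = transp g w"
  shows "v = w"
  using assms dinv_differential[OF mor obj src_diffeo assms(1)] differential_dinv[OF mor obj tgt_diffeo assms(1)]
    dinv_in[OF mor obj tgt_diffeo assms(1)] unfolding transp_def by metis

lemma transp_lincomb:
  assumes "g \<in> mors X" "v \<in> tangent_space (Obj X) (tgt X g)" "w \<in> tangent_space (Obj X) (tgt X g)"
  shows "transp g (\<lambda>c. a *\<^sub>R v c + b *\<^sub>R w c) = (\<lambda>c. a *\<^sub>R transp g v c + b *\<^sub>R transp g w c)"
  by (simp add: transp_def dinv_lincomb[OF mor obj tgt_diffeo assms] differential_lincomb[OF mor obj src_smooth assms(1)])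

lemma transp_germ_smooth:
  assumes "local_inverse (Mor X) (Obj X) (tgt X) U V \<tau>"
  shows "smooth_into (Obj X) (Obj X) V (src X \<circ> \<tau>)"
proof -
  have \<tau>: "smooth_into (Obj X) (Mor X) V \<tau>" using assms by (simp add: local_inverse_def)
  have V: "{y \<in> V. \<tau> y \<in> mors X} = V" using smooth_intoD(4)[OF \<tau>] by auto
  show ?thesis using smooth_into_compose[OF obj mor obj \<tau> src_smooth] unfolding V .
qed

lemma transp_eq_tdiff:
  assumes "local_inverse (Mor X) (Obj X) (tgt X) U V \<tau>" "g \<in> U" "w \<in> tangent_space (Obj X) (tgt X g)"
  shows "transp g w = tdiff (Obj X) (Obj X) V (src X \<circ> \<tau>) (tgt X g) w"
proof -
  have \<tau>: "smooth_into (Obj X) (Mor X) V \<tau>" "tgt X g \<in> V" "\<tau> (tgt X g) = g" and g: "g \<in> mors X"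
    using assms smooth_intoD(2) by (fastforce simp: local_inverse_def)+
  have V: "{y \<in> V. \<tau> y \<in> mors X} = V" using smooth_intoD(4)[OF \<tau>(1)] by auto
  have "tdiff (Obj X) (Obj X) V (src X \<circ> \<tau>) (tgt X g) w =
      tdiff (Mor X) (Obj X) (mors X) (src X) g (tdiff (Obj X) (Mor X) V \<tau> (tgt X g) w)"
    using tdiff_compose[OF obj mor obj \<tau>(1) src_smooth \<tau>(2) _ assms(3)] \<tau>(3) g
    unfolding V by auto
  then show ?thesis
    using differential_eq_tdiff[OF mor g, of "Obj X" "src X"] dinv_eq_tdiff[OF mor obj tgt_smooth assms]
    by (simp add: transp_def)
qed

text \<open>
  The transport along \<open>g\<close> is the derivative of the germ \<open>src \<circ> \<tau>\<close>, with \<open>\<tau>\<close> the local section of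
  \<open>tgt\<close> through \<open>g\<close>. By continuity of composition these germs compose like the morphisms.
\<close>

lemma transp_comp:
  assumes g: "g \<in> mors X" and f: "f \<in> mors X" and gf: "src X g = tgt X f"
    and w: "w \<in> tangent_space (Obj X) (tgt X g)"
  shows "transp (comp X g f) w = transp f (transp g w)"
proof -
  let ?k = "comp X g f"
  have k: "?k \<in> mors X" "src X ?k = src X f" "tgt X ?k = tgt X g"
    using g f gf by (simp_all add: gpd_simps)
  obtain Ug Vg \<tau>g where tg: "local_inverse (Mor X) (Obj X) (tgt X) Ug Vg \<tau>g" "g \<in> Ug"
    by (rule local_diffeo_local_inverse[OF mor obj tgt_diffeo g])
  obtain Uf Vf \<tau>f where tf: "local_inverse (Mor X) (Obj X) (tgt X) Uf Vf \<tau>f" "f \<in> Uf"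
    by (rule local_diffeo_local_inverse[OF mor obj tgt_diffeo f])
  obtain Uk Vk \<tau>k where tk: "local_inverse (Mor X) (Obj X) (tgt X) Uk Vk \<tau>k" "?k \<in> Uk"
    by (rule local_diffeo_local_inverse[OF mor obj tgt_diffeo k(1)])
  have sg: "smooth_into (Obj X) (Mor X) Vg \<tau>g" and sf: "smooth_into (Obj X) (Mor X) Vf \<tau>f"
    and sUk: "smooth_into (Mor X) (Obj X) Uk (tgt X)"
    and vg: "\<And>y. y \<in> Vg \<Longrightarrow> \<tau>g y \<in> mors X \<and> tgt X (\<tau>g y) = y" and vf: "\<And>y. y \<in> Vf \<Longrightarrow> \<tau>f y \<in> mors X \<and> tgt X (\<tau>f y) = y"
    and ik: "\<And>u. u \<in> Uk \<Longrightarrow> tgt X u \<in> Vk \<and> \<tau>k (tgt X u) = u"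
    and ag: "tgt X g \<in> Vg" "\<tau>g (tgt X g) = g" and af: "tgt X f \<in> Vf" "\<tau>f (tgt X f) = f"
    using tg tf tk smooth_intoD(4) by (auto simp: local_inverse_def)
  let ?\<phi> = "src X \<circ> \<tau>g"
  note G = transp_germ_smooth[OF tg(1)] transp_eq_tdiff[OF tg w]
  have tw: "transp g w \<in> tangent_space (Obj X) (tgt X f)" using transp_in[OF g] gf by metis
  note F = transp_germ_smooth[OF tf(1)] transp_eq_tdiff[OF tf tw]
  have w': "w \<in> tangent_space (Obj X) (tgt X ?k)" using w k by simp
  note K = transp_germ_smooth[OF tk(1)] transp_eq_tdiff[OF tk w']
  let ?W = "{y \<in> Vg. ?\<phi> y \<in> Vf}"
  have W: "openin (mtop (Obj X)) ?W"
    using openin_preimage_subtopology[OF smooth_intoD(3,1)[OF G(1)] smooth_intoD(1)[OF F(1)]] .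
  \<comment> \<open>The product of the sections through \<open>g\<close> and \<open>f\<close>: a
    second local section of \<open>tgt\<close> through the composite, with source map
    \<open>(src \<circ> \<tau>f) \<circ> ?\<phi>\<close>.\<close>
  let ?\<kappa> = "\<lambda>y. comp X (\<tau>g y) (\<tau>f (?\<phi> y))"
  have \<kappa>: "src X (?\<kappa> y) = src X (\<tau>f (?\<phi> y))" "tgt X (?\<kappa> y) = y" if "y \<in> ?W" for y
    using vg[of y] vf[of "?\<phi> y"] that by (simp_all add: gpd_simps)
  have c1: "continuous_map (subtopology (mtop (Obj X)) ?W) (mtop (Mor X)) \<tau>g"
    by (rule continuous_map_from_subtopology_mono[OF smooth_intoD(3)[OF sg]]) auto
  have c2: "continuous_map (subtopology (mtop (Obj X)) ?W) (mtop (Mor X)) (\<tau>f \<circ> ?\<phi>)"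
    using smooth_intoD(3)[OF smooth_into_compose[OF obj obj mor G(1) sf]] .
  have "continuous_map (subtopology (mtop (Obj X)) ?W)
     (subtopology (prod_topology (mtop (Mor X)) (mtop (Mor X))) {(g, f). src X g = tgt X f})
     (\<lambda>y. (\<tau>g y, \<tau>f (?\<phi> y)))"
    unfolding continuous_map_in_subtopology
    using continuous_map_pairedI[OF c1 c2] vf by auto
  from continuous_map_compose[OF this comp_continuous]
  have c\<kappa>: "continuous_map (subtopology (mtop (Obj X)) ?W) (mtop (Mor X)) ?\<kappa>"
    by (simp add: o_def)
  \<comment> \<open>On \<open>?W'\<close> the product section lands in \<open>Uk\<close>, where
    \<open>tgt\<close> has the inverse \<open>\<tau>k\<close>; hence it coincides with
    \<open>\<tau>k\<close> there. Openness of \<open>?W'\<close> is where continuity of composition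
    enters.\<close>
  let ?W' = "{y \<in> ?W. ?\<kappa> y \<in> Uk}"
  have W': "openin (mtop (Obj X)) ?W'"
    by (rule openin_preimage_subtopology[OF c\<kappa> W smooth_intoD(1)[OF sUk]])
  have "tdiff (Obj X) (Obj X) Vk (src X \<circ> \<tau>k) (tgt X g) = tdiff (Obj X) (Obj X) ?W ((src X \<circ> \<tau>f) \<circ> ?\<phi>) (tgt X g)"
  proof (rule tdiff_cong[OF obj obj K(1) smooth_into_compose[OF obj obj obj G(1) F(1)] _ W'])
    show "tgt X g \<in> ?W'" using ag af gf tk(2) by simp
    show "?W' \<subseteq> Vk"
    proof
      fix y assume "y \<in> ?W'"
      then show "y \<in> Vk" using ik[of "?\<kappa> y"] \<kappa>(2)[of y] by simp
    qed
    show "(src X \<circ> \<tau>k) y = ((src X \<circ> \<tau>f) \<circ> ?\<phi>) y" if "y \<in> ?W'" for y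
      using that ik[of "?\<kappa> y"] \<kappa>[of y] by simp
  qed auto
  moreover have "tdiff (Obj X) (Obj X) ?W ((src X \<circ> \<tau>f) \<circ> ?\<phi>) (tgt X g) w = tdiff (Obj X) (Obj X) Vf (src X \<circ> \<tau>f) (tgt X f) (transp g w)"
    using tdiff_compose[OF obj obj obj G(1) F(1) ag(1) _ w] ag af gf G(2) by simp
  ultimately show ?thesis using K(2) F(2) k(3) by simp
qed

text \<open>Functoriality makes transport along an identity idempotent, and an injective idempotent
  map is the identity.\<close>

lemma transp_idm:
  assumes "x \<in> obs X" "w \<in> tangent_space (Obj X) x"
  shows "transp (idm X x) w = w"
proof (rule transp_inj)
  have i: "idm X x \<in> mors X" "src X (idm X x) = x" "tgt X (idm X x) = x" using assms by (simp_all add: gpd_simps)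
  have "comp X (idm X x) (idm X x) = idm X x" using comp_idm[OF i(1)] i by simp
  then show "transp (idm X x) (transp (idm X x) w) = transp (idm X x) w"
    using transp_comp[OF i(1,1)] i assms by simp
qed (use assms transp_in[of "idm X x"] in \<open>auto simp: gpd_simps\<close>)

end

section \<open>Sums over morphisms\<close>

text \<open>The fibre is compact, and finitely many open sets on which \<open>f\<close> is injective
  cover it; each contains at most one of its points.\<close>

lemma finite_proper_map_fibre:
  fixes T :: "'a topology"
  assumes "proper_map (subtopology T A) T' f" "y \<in> topspace T'"
    and "\<And>x. x \<in> topspace T \<Longrightarrow> \<exists>U. openin T U \<and> x \<in> U \<and> inj_on f U"
  shows "finite {x \<in> topspace T \<inter> A. f x = y}"
proof -
  let ?S = "{x \<in> topspace T \<inter> A. f x = y}"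
  have "compactin (subtopology T A) {x \<in> topspace (subtopology T A). f x = y}"
    using assms(1,2) by (auto simp: proper_map_def)
  then have "compactin (subtopology T A) ?S" by simp
  then have comp: "compactin T ?S"
    by (simp add: compactin_subtopology)
  let ?\<U> = "{U. openin T U \<and> inj_on f U}"
  have "?S \<subseteq> \<Union>?\<U>" using assms(3) by auto
  then obtain \<F> where F: "finite \<F>" "\<F> \<subseteq> ?\<U>" "?S \<subseteq> \<Union>\<F>"
    using comp unfolding compactin_def by (metis (no_types, lifting) mem_Collect_eq)
  have "finite (?S \<inter> U)" if "U \<in> \<F>" for U
  proof -
    have "inj_on f U" using F(2) that by auto
    then have "inj_on f (?S \<inter> U)" by (rule inj_on_subset) auto
    moreover have "f ` (?S \<inter> U) \<subseteq> {y}" by auto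
    ultimately show ?thesis by (meson finite.simps finite_imageD finite_subset)
  qed
  moreover have "?S = (\<Union>U\<in>\<F>. ?S \<inter> U)" using F(3) by blast
  ultimately show ?thesis using F(1) by (metis (no_types, lifting) finite_UN)
qed

lemma mem_form_supp: "x \<in> pts M \<Longrightarrow> \<omega> x \<noteq> (\<lambda>_. 0) \<Longrightarrow> x \<in> form_supp M \<omega>"
  unfolding form_supp_def using closure_of_subset[of "{x \<in> pts M. \<omega> x \<noteq> (\<lambda>_. 0)}" "mtop M"] by auto

lemma push_eq:
  "y \<in> pts N \<Longrightarrow> set ws \<subseteq> tangent_space N y \<Longrightarrow>
   push M N h \<beta> y ws = (\<Sum>z\<in>{z \<in> pts M. h z = y \<and> \<beta> z \<noteq> (\<lambda>_. 0)}. \<beta> z (map (dinv M N h z) ws))"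
  by (simp add: push_def dinv_def)

lemma push_nonzeroE:
  assumes "push M N h \<beta> y \<noteq> (\<lambda>_. 0)"
  obtains z where "z \<in> pts M" "h z = y" "\<beta> z \<noteq> (\<lambda>_. 0)" "y \<in> pts N"
proof (cases "y \<in> pts N \<and> {z \<in> pts M. h z = y \<and> \<beta> z \<noteq> (\<lambda>_. 0)} \<noteq> {}")
  case False
  then have "push M N h \<beta> y = (\<lambda>_. 0)"
    by (auto simp: push_def simp del: Collect_empty_eq)
  then show thesis using assms by contradiction
qed (use that in auto)

section \<open>The map J on representatives\<close>

context etale_groupoid
begin

lemma finite_clean_obs:
  assumes C: "clean_obs X C" and x: "x \<in> obs X"
  shows "finite {g \<in> mors X. tgt X g = x \<and> src X g \<in> C}"
proof -
  have p: "proper_map (subtopology (mtop (Mor X)) {g \<in> mors X. src X g \<in> C}) (mtop (Obj X)) (tgt X)"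
    using C by (simp add: clean_obs_def)
  have "\<exists>U. openin (mtop (Mor X)) U \<and> g \<in> U \<and> inj_on (tgt X) U" if g: "g \<in> mors X" for g
  proof -
    obtain U V \<tau> where U: "local_inverse (Mor X) (Obj X) (tgt X) U V \<tau>" "g \<in> U"
      by (rule local_diffeo_local_inverse[OF mor obj tgt_diffeo g])
    then have "openin (mtop (Mor X)) U" "inj_on (tgt X) U"
      by (auto simp: local_inverse_def smooth_into_def intro: inj_on_inverseI)
    then show ?thesis using U(2) by blast
  qed
  from finite_proper_map_fibre[OF p x this] show ?thesis
    by (rule rev_finite_subset) auto
qed

definition jform :: "('a, 'e) form \<Rightarrow> ('a, 'e) form" where
  "jform \<alpha> = push (Mor X) (Obj X) (tgt X) (pull (Mor X) (Obj X) (src X) \<alpha>)"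

text \<open>Finiteness of the sums behind \<open>J\<close>, separated from smoothness and clean
  support. It is stable under sums and passes from a form to its push-forward along a refinement,
  where only the fibres need to be counted.\<close>

definition orbit_finite :: "('a, 'e) form \<Rightarrow> bool" where
  "orbit_finite \<alpha> \<longleftrightarrow> (\<forall>x\<in>obs X. finite {g \<in> mors X. tgt X g = x \<and> \<alpha> (src X g) \<noteq> (\<lambda>_. 0)})"

lemma map_transp_in:
  "g \<in> mors X \<Longrightarrow> set (map (transp g) ws) \<subseteq> tangent_space (Obj X) (src X g)"
  using transp_in by auto

lemma pull_src_dinv:
  assumes g: "g \<in> mors X" and ws: "set ws \<subseteq> tangent_space (Obj X) (tgt X g)"
  shows "pull (Mor X) (Obj X) (src X) \<alpha> g (map (dinv (Mor X) (Obj X) (tgt X) g) ws)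
      = \<alpha> (src X g) (map (transp g) ws)"
proof -
  have "set (map (dinv (Mor X) (Obj X) (tgt X) g) ws) \<subseteq> tangent_space (Mor X) g"
    using dinv_in[OF mor obj tgt_diffeo g] ws by auto
  then show ?thesis using g by (simp add: pull_def transp_def[abs_def] o_def)
qed

text \<open>Terms outside the support vanish, so any finite set of morphisms to \<open>x\<close>
  that contains the support may index the sum. This freedom allows sums with different supports to
  be compared over one index set.\<close>

lemma jform_eq:
  assumes x: "x \<in> obs X" and ws: "set ws \<subseteq> tangent_space (Obj X) x"
    and G: "finite G" "{g \<in> mors X. tgt X g = x \<and> \<alpha> (src X g) \<noteq> (\<lambda>_. 0)} \<subseteq> G" "G \<subseteq> {g \<in> mors X. tgt X g = x}"
  shows "jform \<alpha> x ws = (\<Sum>g\<in>G. \<alpha> (src X g) (map (transp g) ws))"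
proof -
  let ?p = "pull (Mor X) (Obj X) (src X) \<alpha>"
  let ?Z = "{z \<in> mors X. tgt X z = x \<and> ?p z \<noteq> (\<lambda>_. 0)}"
  have nz: "\<alpha> (src X g) \<noteq> (\<lambda>_. 0)" if "?p g \<noteq> (\<lambda>_. 0)" for g
    using that by (auto simp: pull_def fun_eq_iff split: if_splits)
  have "jform \<alpha> x ws = (\<Sum>g\<in>?Z. ?p g (map (dinv (Mor X) (Obj X) (tgt X) g) ws))"
    unfolding jform_def by (rule push_eq[OF x ws])
  also have "\<dots> = (\<Sum>g\<in>G. ?p g (map (dinv (Mor X) (Obj X) (tgt X) g) ws))"
    by (rule sum.mono_neutral_left[OF G(1)]) (use G nz in auto)
  also have "\<dots> = (\<Sum>g\<in>G. \<alpha> (src X g) (map (transp g) ws))"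
    by (rule sum.cong[OF refl]) (use G(3) ws in \<open>auto intro!: pull_src_dinv\<close>)
  finally show ?thesis .
qed

lemma jform_outside: "x \<notin> obs X \<or> \<not> set ws \<subseteq> tangent_space (Obj X) x \<Longrightarrow> jform \<alpha> x ws = 0"
  by (auto simp: jform_def push_def)

text \<open>The union of the two supports indexes all three sums; the support of the combined form
  may be smaller through cancellation.\<close>

lemma
  assumes a: "orbit_finite \<alpha>" and b: "orbit_finite \<beta>"
  shows jform_add: "jform (form_add \<alpha> \<beta>) = form_add (jform \<alpha>) (jform \<beta>)"
    and jform_diff: "jform (form_diff \<alpha> \<beta>) = form_diff (jform \<alpha>) (jform \<beta>)"
    and orbit_finite_add: "orbit_finite (form_add \<alpha> \<beta>)"
    and orbit_finite_diff: "orbit_finite (form_diff \<alpha> \<beta>)"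
proof -
  let ?N = "\<lambda>\<gamma> x. {g \<in> mors X. tgt X g = x \<and> \<gamma> (src X g) \<noteq> (\<lambda>_. 0)}"
  let ?G = "\<lambda>x. ?N \<alpha> x \<union> ?N \<beta> x"
  have fin: "finite (?G x)" if "x \<in> obs X" for x
    using a b that by (simp add: orbit_finite_def)
  have J: "jform \<gamma> x ws = (\<Sum>g\<in>?G x. \<gamma> (src X g) (map (transp g) ws))"
    if "x \<in> obs X \<and> set ws \<subseteq> tangent_space (Obj X) x" "?N \<gamma> x \<subseteq> ?G x" for \<gamma> x ws
    by (rule jform_eq) (use that fin in auto)
  have add: "?N (form_add \<alpha> \<beta>) x \<subseteq> ?G x" and diff: "?N (form_diff \<alpha> \<beta>) x \<subseteq> ?G x" for x
    by (auto simp: form_add_def form_diff_def)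
  show "orbit_finite (form_add \<alpha> \<beta>)" "orbit_finite (form_diff \<alpha> \<beta>)"
    unfolding orbit_finite_def using finite_subset[OF add fin] finite_subset[OF diff fin] by blast+
  show "jform (form_add \<alpha> \<beta>) = form_add (jform \<alpha>) (jform \<beta>)"
  proof (intro ext)
    fix x ws
    show "jform (form_add \<alpha> \<beta>) x ws = form_add (jform \<alpha>) (jform \<beta>) x ws"
    proof (cases "x \<in> obs X \<and> set ws \<subseteq> tangent_space (Obj X) x")
      case True
      show ?thesis
        using J[OF True add] J[OF True Un_upper1] J[OF True Un_upper2]
        by (simp add: form_add_def sum.distrib)
    qed (simp add: form_add_def jform_outside)
  qed
  show "jform (form_diff \<alpha> \<beta>) = form_diff (jform \<alpha>) (jform \<beta>)"
  proof (intro ext)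
    fix x ws
    show "jform (form_diff \<alpha> \<beta>) x ws = form_diff (jform \<alpha>) (jform \<beta>) x ws"
    proof (cases "x \<in> obs X \<and> set ws \<subseteq> tangent_space (Obj X) x")
      case True
      show ?thesis
        using J[OF True diff] J[OF True Un_upper1] J[OF True Un_upper2]
        by (simp add: form_diff_def sum_subtractf)
    qed (simp add: form_diff_def jform_outside)
  qed
qed

lemma orbit_finite_clean:
  assumes "clean_obs X C" "\<And>z. z \<in> obs X \<Longrightarrow> \<alpha> z \<noteq> (\<lambda>_. 0) \<Longrightarrow> z \<in> C"
  shows "orbit_finite \<alpha>"
  unfolding orbit_finite_def
proof
  fix x assume "x \<in> obs X"
  show "finite {g \<in> mors X. tgt X g = x \<and> \<alpha> (src X g) \<noteq> (\<lambda>_. 0)}"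
    by (rule finite_subset[OF _ finite_clean_obs[OF assms(1) \<open>x \<in> obs X\<close>]]) (use assms(2) src_in in auto)
qed

text \<open>The kernel condition lives on tangent vectors of the morphism manifold; evaluating it on
  the preimages of \<open>ws\<close> under the differential of \<open>tgt\<close> turns it into
  invariance under transport.\<close>

lemma gforms_transp:
  assumes \<xi>: "\<xi> \<in> gforms k X" and g: "g \<in> mors X" and ws: "set ws \<subseteq> tangent_space (Obj X) (tgt X g)"
  shows "\<xi> (src X g) (map (transp g) ws) = \<xi> (tgt X g) ws"
proof -
  let ?vs = "map (dinv (Mor X) (Obj X) (tgt X) g) ws"
  have vs: "set ?vs \<subseteq> tangent_space (Mor X) g"
    using dinv_in[OF mor obj tgt_diffeo g] ws by auto
  have "map (differential (Mor X) (Obj X) (tgt X) g) ?vs = ws"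
    using ws differential_dinv[OF mor obj tgt_diffeo g] by (auto intro!: map_idI)
  then have "pull (Mor X) (Obj X) (tgt X) \<xi> g ?vs = \<xi> (tgt X g) ws"
    using vs g by (simp add: pull_def)
  moreover have "pull (Mor X) (Obj X) (tgt X) \<xi> = pull (Mor X) (Obj X) (src X) \<xi>"
    using \<xi> by (simp add: gforms_def)
  ultimately show ?thesis using pull_src_dinv[OF g ws, of \<xi>] by simp
qed

lemma gforms_outside:
  assumes "\<xi> \<in> gforms k X" "x \<notin> obs X \<or> \<not> set ws \<subseteq> tangent_space (Obj X) x"
  shows "\<xi> x ws = 0"
proof (cases "x \<in> obs X")
  case True
  then have "alt_form k (tangent_space (Obj X) x) (\<xi> x)" using assms(1) by (simp add: gforms_def forms_def)
  then show ?thesis using True assms(2) unfolding alt_form_def by blast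
next
  case False
  then show ?thesis using assms(1) by (simp add: gforms_def forms_def)
qed

text \<open>Invariance makes every transported value of \<open>\<xi>\<close> equal to its value at
  \<open>x\<close>, so this value factors out and leaves the sum of \<open>\<rho>\<close> over the
  morphisms to \<open>x\<close>, which is 1.\<close>

lemma partition_of_unity_mult:
  assumes \<rho>: "partition_of_unity X \<rho>" and \<xi>: "\<xi> \<in> gforms k X"
  shows "orbit_finite (fun_mult \<rho> \<xi>)" "jform (fun_mult \<rho> \<xi>) = \<xi>"
proof -
  let ?C = "form_supp (Obj X) (fun_form (Obj X) \<rho>)"
  have C: "clean_obs X ?C" using \<rho> by (simp add: partition_of_unity_def clean_forms_obs_def)
  have \<rho>C: "z \<in> ?C" if "z \<in> obs X" "\<rho> z \<noteq> 0" for z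
    by (rule mem_form_supp[OF that(1)]) (use that in \<open>auto simp: fun_form_def fun_eq_iff\<close>)
  show "orbit_finite (fun_mult \<rho> \<xi>)"
    by (rule orbit_finite_clean[OF C \<rho>C]) (auto simp: fun_mult_def fun_eq_iff)
  show "jform (fun_mult \<rho> \<xi>) = \<xi>"
  proof (intro ext)
    fix x ws
    show "jform (fun_mult \<rho> \<xi>) x ws = \<xi> x ws"
    proof (cases "x \<in> obs X \<and> set ws \<subseteq> tangent_space (Obj X) x")
      case True
      then have x: "x \<in> obs X" and ws: "set ws \<subseteq> tangent_space (Obj X) x" by auto
      let ?G = "{g \<in> mors X. tgt X g = x \<and> src X g \<in> ?C}"
      have fin: "finite ?G" using finite_clean_obs[OF C x] .
      have \<rho>s: "src X g \<in> ?C" if "g \<in> mors X" "\<rho> (src X g) \<noteq> 0" for g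
        using \<rho>C[OF src_in] that by blast
      \<comment> \<open>A function is a form of degree 0, whose only argument list is
        \<open>[]\<close>; there the partition condition becomes a sum of numbers.\<close>
      have "jform (fun_form (Obj X) \<rho>) x [] = (\<Sum>g\<in>?G. fun_form (Obj X) \<rho> (src X g) (map (transp g) []))"
        by (rule jform_eq[OF x _ fin]) (use \<rho>s in \<open>auto simp: fun_form_def fun_eq_iff split: if_splits\<close>)
      moreover have "jform (fun_form (Obj X) \<rho>) x [] = 1"
        using \<rho> x by (simp add: partition_of_unity_def jform_def fun_form_def)
      ultimately have one: "(\<Sum>g\<in>?G. \<rho> (src X g)) = 1"
        by (simp add: fun_form_def gpd_simps)
      have "jform (fun_mult \<rho> \<xi>) x ws = (\<Sum>g\<in>?G. fun_mult \<rho> \<xi> (src X g) (map (transp g) ws))"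
        by (rule jform_eq[OF x ws fin]) (use \<rho>s in \<open>auto simp: fun_mult_def fun_eq_iff\<close>)
      also have "\<dots> = (\<Sum>g\<in>?G. \<rho> (src X g) * \<xi> x ws)"
        by (rule sum.cong) (use gforms_transp[OF \<xi>] ws in \<open>auto simp: fun_mult_def\<close>)
      also have "\<dots> = \<xi> x ws" using one by (simp flip: sum_distrib_right)
      finally show ?thesis .
    next
      case False
      then have "x \<notin> obs X \<or> \<not> set ws \<subseteq> tangent_space (Obj X) x" by blast
      then show ?thesis using jform_outside gforms_outside[OF \<xi>] by metis
    qed
  qed
qed

text \<open>
  Both sides are sums over the pairs of composable arrows \<open>g\<close>, \<open>f\<close>; the pairs with
  \<open>src g = tgt f\<close> correspond to those with \<open>src g = src f\<close> through \<open>(g, f) \<mapsto> (g f, f)\<close>.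
\<close>

lemma jform_push_src_tgt:
  assumes \<beta>: "\<beta> \<in> clean_forms_mors k X"
  shows "orbit_finite (push (Mor X) (Obj X) (src X) \<beta>)" "orbit_finite (push (Mor X) (Obj X) (tgt X) \<beta>)"
    "jform (push (Mor X) (Obj X) (src X) \<beta>) = jform (push (Mor X) (Obj X) (tgt X) \<beta>)"
proof -
  let ?s = "push (Mor X) (Obj X) (src X) \<beta>" and ?t = "push (Mor X) (Obj X) (tgt X) \<beta>"
  let ?D = "form_supp (Mor X) \<beta>"
  have cl: "clean_obs X (src X ` ?D)" "clean_obs X (tgt X ` ?D)"
    using \<beta> by (simp_all add: clean_forms_mors_def clean_mors_def)
  have D: "f \<in> ?D" if "f \<in> mors X" "\<beta> f \<noteq> (\<lambda>_. 0)" for f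
    using mem_form_supp[OF that(1), of \<beta>] that(2) by simp
  have s: "a \<in> src X ` ?D" if "?s a \<noteq> (\<lambda>_. 0)" for a
    by (rule push_nonzeroE[OF that]) (use D in blast)
  have t: "a \<in> tgt X ` ?D" if "?t a \<noteq> (\<lambda>_. 0)" for a
    by (rule push_nonzeroE[OF that]) (use D in blast)
  show "orbit_finite ?s" "orbit_finite ?t"
    using orbit_finite_clean[OF cl(1)] orbit_finite_clean[OF cl(2)] s t by blast+
  have fin_t: "finite {f \<in> mors X. tgt X f = a \<and> \<beta> f \<noteq> (\<lambda>_. 0)}" if a: "a \<in> obs X" for a
    by (rule finite_subset[OF _ finite_clean_obs[OF cl(1) a]]) (use D in auto)
  \<comment> \<open>Inversion turns morphisms out of \<open>a\<close> into morphisms to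
    \<open>a\<close> whose sources lie in the clean set of targets of \<open>?D\<close>, so the
    finiteness statement for \<open>tgt\<close> covers this fibre as well.\<close>
  have fin_s: "finite {f \<in> mors X. src X f = a \<and> \<beta> f \<noteq> (\<lambda>_. 0)}" if a: "a \<in> obs X" for a
  proof (rule inj_on_finite[OF _ _ finite_clean_obs[OF cl(2) a]])
    show "inj_on (invm X) {f \<in> mors X. src X f = a \<and> \<beta> f \<noteq> (\<lambda>_. 0)}"
    proof (rule inj_on_inverseI)
      fix f assume "f \<in> {f \<in> mors X. src X f = a \<and> \<beta> f \<noteq> (\<lambda>_. 0)}"
      then have f: "f \<in> mors X" by simp
      have "invm X (invm X f) = comp X (invm X (invm X f)) (comp X (invm X f) f)"
        using comp_idm[of "invm X (invm X f)"] f by (simp add: gpd_simps)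
      also have "\<dots> = f" using invm_comp_cancel[of "invm X f" f] f by (simp add: gpd_simps)
      finally show "invm X (invm X f) = f" .
    qed
    show "invm X ` {f \<in> mors X. src X f = a \<and> \<beta> f \<noteq> (\<lambda>_. 0)} \<subseteq> {g \<in> mors X. tgt X g = a \<and> src X g \<in> tgt X ` ?D}"
      using D by (auto simp: gpd_simps)
  qed
  show "jform ?s = jform ?t"
  proof (intro ext)
    fix x ws
    show "jform ?s x ws = jform ?t x ws"
    proof (cases "x \<in> obs X \<and> set ws \<subseteq> tangent_space (Obj X) x")
      case True
      then have x: "x \<in> obs X" and ws: "set ws \<subseteq> tangent_space (Obj X) x" by auto
      let ?G = "{g \<in> mors X. tgt X g = x \<and> src X g \<in> src X ` ?D}"
      let ?H = "{g \<in> mors X. tgt X g = x \<and> src X g \<in> tgt X ` ?D}"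
      let ?Fs = "\<lambda>g. {f \<in> mors X. src X f = src X g \<and> \<beta> f \<noteq> (\<lambda>_. 0)}"
      let ?Ft = "\<lambda>g. {f \<in> mors X. tgt X f = src X g \<and> \<beta> f \<noteq> (\<lambda>_. 0)}"
      let ?us = "\<lambda>g f. \<beta> f (map (dinv (Mor X) (Obj X) (src X) f) (map (transp g) ws))"
      let ?ut = "\<lambda>g f. \<beta> f (map (dinv (Mor X) (Obj X) (tgt X) f) (map (transp g) ws))"
      have fG: "finite ?G" and fH: "finite ?H"
        using finite_clean_obs[OF cl(1) x] finite_clean_obs[OF cl(2) x] .
      have "jform ?s x ws = (\<Sum>g\<in>?G. ?s (src X g) (map (transp g) ws))"
        by (rule jform_eq[OF x ws fG]) (use s in auto)
      also have "\<dots> = (\<Sum>g\<in>?G. \<Sum>f\<in>?Fs g. ?us g f)"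
        by (rule sum.cong[OF refl push_eq]) (use map_transp_in src_in in auto)
      also have "\<dots> = (\<Sum>(g, f)\<in>(SIGMA g:?G. ?Fs g). ?us g f)"
        by (rule sum.Sigma[OF fG]) (use fin_s src_in in auto)
      also have "\<dots> = (\<Sum>(g, f)\<in>(SIGMA g:?H. ?Ft g). ?ut g f)"
      proof (rule sum.reindex_bij_witness[where i = "\<lambda>(g, f). (comp X g f, f)" and j = "\<lambda>(g, f). (comp X g (invm X f), f)"])
        fix p assume "p \<in> (SIGMA g:?G. ?Fs g)"
        then obtain g f where p: "p = (g, f)" "g \<in> mors X" "tgt X g = x" "f \<in> mors X" "src X f = src X g" "\<beta> f \<noteq> (\<lambda>_. 0)"
          by auto
        let ?g = "comp X g (invm X f)"
        have g: "?g \<in> mors X" "src X ?g = tgt X f" "tgt X ?g = x" using p by (simp_all add: gpd_simps)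
        have "comp X ?g f = comp X g (comp X (invm X f) f)"
          using comp_assoc[of g "invm X f" f] p by (simp add: gpd_simps)
        also have "\<dots> = g" using comp_idm[of g] p by (simp add: gpd_simps)
        finally have gf: "comp X ?g f = g" .
        show "(case (case p of (g, f) \<Rightarrow> (comp X g (invm X f), f)) of (g, f) \<Rightarrow> (comp X g f, f)) = p"
          using gf p(1) by simp
        show "(case p of (g, f) \<Rightarrow> (comp X g (invm X f), f)) \<in> (SIGMA g:?H. ?Ft g)"
          using g p D by auto
        \<comment> \<open>Here \<open>g\<close> is the composite of \<open>?g\<close> after
          \<open>f\<close>, so \<open>transp g\<close> is \<open>transp f\<close> applied after
          \<open>transp ?g\<close>. As \<open>transp f\<close> ends with the differential of
          \<open>src\<close> at \<open>f\<close>, the inverse differential of \<open>src\<close>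
          cancels and that of \<open>tgt\<close> remains.\<close>
        have "dinv (Mor X) (Obj X) (src X) f (transp g w) = dinv (Mor X) (Obj X) (tgt X) f (transp ?g w)"
          if w: "w \<in> tangent_space (Obj X) x" for w
        proof -
          have "transp g w = transp f (transp ?g w)"
            using transp_comp[OF g(1) p(4) g(2)] gf g(3) w by simp
          moreover have "dinv (Mor X) (Obj X) (tgt X) f (transp ?g w) \<in> tangent_space (Mor X) f"
            using dinv_in[OF mor obj tgt_diffeo p(4)] transp_in[OF g(1)] g(2) by metis
          ultimately show ?thesis
            by (simp add: transp_def[of f] dinv_differential[OF mor obj src_diffeo p(4)])
        qed
        then have "?ut ?g f = ?us g f"
          using ws by (intro arg_cong[of _ _ "\<beta> f"]) (auto simp: subset_iff)
        then show "(case (case p of (g, f) \<Rightarrow> (comp X g (invm X f), f)) of (g, f) \<Rightarrow> ?ut g f) = (case p of (g, f) \<Rightarrow> ?us g f)"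
          using p(1) by simp
      next
        fix p assume "p \<in> (SIGMA g:?H. ?Ft g)"
        then obtain g f where p: "p = (g, f)" "g \<in> mors X" "tgt X g = x" "f \<in> mors X" "tgt X f = src X g" "\<beta> f \<noteq> (\<lambda>_. 0)"
          by auto
        have "comp X (comp X g f) (invm X f) = g" using comp_comp_invm_cancel p by simp
        then show "(case (case p of (g, f) \<Rightarrow> (comp X g f, f)) of (g, f) \<Rightarrow> (comp X g (invm X f), f)) = p"
          using p(1) by simp
        show "(case p of (g, f) \<Rightarrow> (comp X g f, f)) \<in> (SIGMA g:?G. ?Fs g)"
          using p D by (auto simp: gpd_simps)
      qed
      also have "\<dots> = (\<Sum>g\<in>?H. \<Sum>f\<in>?Ft g. ?ut g f)"
        by (rule sum.Sigma[OF fH, symmetric]) (use fin_t src_in in auto)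
      also have "\<dots> = (\<Sum>g\<in>?H. ?t (src X g) (map (transp g) ws))"
        by (rule sum.cong[OF refl push_eq[symmetric]]) (use map_transp_in src_in in auto)
      also have "\<dots> = jform ?t x ws"
        by (rule jform_eq[OF x ws fH, symmetric]) (use t in auto)
      finally show ?thesis .
    qed (use jform_outside in metis)
  qed
qed

text \<open>Constancy of \<open>J\<close> on a coset. Finiteness is carried along so that the new
  representative can again be summed or pushed forward.\<close>

lemma jform_push_diff:
  assumes \<beta>: "\<beta> \<in> clean_forms_mors k X" and \<alpha>: "orbit_finite \<alpha>"
  defines "\<alpha>' \<equiv> form_add \<alpha> (form_diff (push (Mor X) (Obj X) (src X) \<beta>) (push (Mor X) (Obj X) (tgt X) \<beta>))"
  shows "orbit_finite \<alpha>'" "jform \<alpha>' = jform \<alpha>"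
proof -
  note b = jform_push_src_tgt[OF \<beta>]
  note d = orbit_finite_diff[OF b(1,2)] jform_diff[OF b(1,2)]
  show "orbit_finite \<alpha>'" unfolding \<alpha>'_def by (rule orbit_finite_add[OF \<alpha> d(1)])
  show "jform \<alpha>' = jform \<alpha>"
    unfolding \<alpha>'_def jform_add[OF \<alpha> d(1)] d(2) b(3) by (simp add: form_add_def form_diff_def)
qed

text \<open>The zero correction shows that each coset contains its representative; this makes the
  set to which \<open>the_elem\<close> is applied nonempty.\<close>

lemma zero_clean_forms_mors: "(\<lambda>_ _. 0) \<in> clean_forms_mors k X"
proof -
  have "(\<lambda>_ _. 0) \<in> forms k (Mor X)"
    by (auto simp: forms_def alt_form_def smooth_on_iff_smooth_at smooth_at_const)
  moreover have "form_supp (Mor X) (\<lambda>_ _. 0) = {}" by (simp add: form_supp_def)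
  moreover have "clean_mors X {}"
    by (simp add: clean_mors_def clean_obs_def proper_map_def closed_map_def)
  ultimately show ?thesis by (simp add: clean_forms_mors_def)
qed

end

section \<open>Pull-back of forms\<close>

lemma alt_form_lincomb:
  assumes "alt_form k T \<alpha>" "length vs = k" "set vs \<subseteq> T" "i < k" "v \<in> T" "w \<in> T"
  shows "\<alpha> (vs[i := (\<lambda>c. a *\<^sub>R v c + b *\<^sub>R w c)]) = a * \<alpha> (vs[i := v]) + b * \<alpha> (vs[i := w])"
  using assms unfolding alt_form_def by simp

text \<open>Stated for an arbitrary map \<open>L\<close> that respects linear combinations on
  \<open>T\<close>, so that it serves for \<open>differential\<close> as well as for
  \<open>lift\<close>. The guard provides the extension by 0 that \<open>alt_form\<close>
  demands.\<close>

lemma alt_form_pull: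
  assumes \<phi>: "alt_form k T' \<phi>" and L: "\<And>v. v \<in> T \<Longrightarrow> L v \<in> T'"
    and lin: "\<And>v w a b. v \<in> T \<Longrightarrow> w \<in> T \<Longrightarrow> L (\<lambda>c. a *\<^sub>R v c + b *\<^sub>R w c) = (\<lambda>c. a *\<^sub>R L v c + b *\<^sub>R L w c)"
    and T: "\<And>v w a b. v \<in> T \<Longrightarrow> w \<in> T \<Longrightarrow> (\<lambda>c. a *\<^sub>R v c + b *\<^sub>R w c) \<in> T"
  shows "alt_form k T (\<lambda>vs. if set vs \<subseteq> T then \<phi> (map L vs) else 0)"
  unfolding alt_form_def
proof (intro conjI allI impI)
  fix vs assume "\<not> (length vs = k \<and> set vs \<subseteq> T)"
  then show "(if set vs \<subseteq> T then \<phi> (map L vs) else 0) = 0"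
    using \<phi> by (auto simp: alt_form_def)
next
  fix vs i v w a b
  assume A: "length vs = k \<and> set vs \<subseteq> T \<and> i < k \<and> v \<in> T \<and> w \<in> T"
  have up: "set (vs[i := u]) \<subseteq> T" if "u \<in> T" for u
    using A that set_update_subset_insert[of vs i u] by auto
  have "set (map L vs) \<subseteq> T'" using A L by auto
  then have "\<phi> ((map L vs)[i := (\<lambda>c. a *\<^sub>R L v c + b *\<^sub>R L w c)])
      = a * \<phi> ((map L vs)[i := L v]) + b * \<phi> ((map L vs)[i := L w])"
    using A L by (intro alt_form_lincomb[OF \<phi>]) auto
  then show "(if set (vs[i := (\<lambda>c. a *\<^sub>R v c + b *\<^sub>R w c)]) \<subseteq> T then \<phi> (map L (vs[i := (\<lambda>c. a *\<^sub>R v c + b *\<^sub>R w c)])) else 0)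
      = a * (if set (vs[i := v]) \<subseteq> T then \<phi> (map L (vs[i := v])) else 0)
      + b * (if set (vs[i := w]) \<subseteq> T then \<phi> (map L (vs[i := w])) else 0)"
    using up[OF T[of v w a b]] up[of v] up[of w] A lin by (simp add: map_update)
next
  fix vs i j
  assume A: "length vs = k \<and> set vs \<subseteq> T \<and> i < j \<and> j < k \<and> vs ! i = vs ! j"
  then have B: "length (map L vs) = k \<and> set (map L vs) \<subseteq> T' \<and> i < j \<and> j < k \<and> map L vs ! i = map L vs ! j"
    using L by auto
  have "\<forall>vs i j. length vs = k \<and> set vs \<subseteq> T' \<and> i < j \<and> j < k \<and> vs ! i = vs ! j \<longrightarrow> \<phi> vs = 0"
    using \<phi> by (simp add: alt_form_def)
  from this[rule_format, OF B] show "(if set vs \<subseteq> T then \<phi> (map L vs) else 0) = 0"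
    by simp
qed

text \<open>A varying argument is expanded in the basis, which trades it for constant vectors with
  smooth coefficients. Peeling from the right moves it into the constant tail \<open>vs\<close>,
  until only the case \<open>const\<close> remains.\<close>

lemma smooth_at_multilinear:
  fixes \<Phi> :: "'p::real_normed_vector \<Rightarrow> 'f::real_inner list \<Rightarrow> real" and B :: "'f set"
  assumes B: "orthonormal_basis B"
    and lin: "\<And>q us vs a b u w. q \<in> S \<Longrightarrow> Suc (length us + length vs) = k \<Longrightarrow>
        \<Phi> q (us @ (a *\<^sub>R u + b *\<^sub>R w) # vs) = a * \<Phi> q (us @ u # vs) + b * \<Phi> q (us @ w # vs)"
    and const: "\<And>es. length es = k \<Longrightarrow> smooth_at S (\<lambda>q. \<Phi> q es) p"
  shows "\<lbrakk>\<And>f. f \<in> set fs \<Longrightarrow> smooth_at S f p; length fs + length vs = k\<rbrakk> \<Longrightarrow>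
    smooth_at S (\<lambda>q. \<Phi> q (map (\<lambda>f. f q) fs @ vs)) p"
proof (induction fs arbitrary: vs rule: rev_induct)
  case Nil
  then show ?case using const by simp
next
  case (snoc f fs)
  have "smooth_at S (\<lambda>q. \<Sum>b\<in>B. (f q \<bullet> b) *\<^sub>R \<Phi> q (map (\<lambda>f. f q) fs @ b # vs)) p"
    by (intro smooth_at_sum smooth_at_scaleR smooth_at_inner snoc.IH) (use snoc.prems in auto)
  then show ?case
  proof (rule smooth_at_cong[of _ _ _ UNIV])
    fix q assume q: "q \<in> S"
    let ?L = "\<lambda>u. \<Phi> q (map (\<lambda>f. f q) fs @ u # vs)"
    have l: "?L (a *\<^sub>R u + b *\<^sub>R w) = a * ?L u + b * ?L w" for a b u w
      by (rule lin[OF q]) (use snoc.prems(2) in simp)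
    have "linear ?L"
    proof (rule linearI)
      show "?L (u + w) = ?L u + ?L w" for u w using l[of 1 u 1 w] by simp
      show "?L (r *\<^sub>R u) = r *\<^sub>R ?L u" for r u using l[of r u 0 u] by simp
    qed
    then show "q \<in> S \<and> (\<Sum>b\<in>B. (f q \<bullet> b) *\<^sub>R ?L b) = \<Phi> q (map (\<lambda>f. f q) (fs @ [f]) @ vs)"
      using q linear_expansion[OF B, of ?L "f q"] by simp
  qed auto
qed

text \<open>
  In coordinates the pulled back form is the composite with the smooth map \<open>h\<close>, evaluated at the
  images of constant vectors under the smoothly varying derivative.
\<close>

lemma smooth_at_pull_germ:
  assumes M: "manifold_with_corners M" and N: "manifold_with_corners N" and h: "smooth_into M N U h"
    and x: "x \<in> U" and c: "c \<in> charts_at M x" and \<omega>: "\<omega> \<in> forms k N"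
    and pull: "\<And>u vs. u \<in> U \<Longrightarrow> set vs \<subseteq> tangent_space M u \<Longrightarrow> \<omega>' u vs = \<omega> (h u) (map (tdiff M N U h u) vs)"
    and es: "length es = k"
  shows "smooth_at (snd c ` fst c) (\<lambda>p. \<omega>' (chart_inv c p) (map (coord_vec M c (chart_inv c p)) es)) (snd c x)"
proof -
  note cc = charts_atD[OF M c]
  obtain d where d: "d \<in> charts_at N (h x)"
    using charts_at_nonempty[OF N smooth_intoD(4)[OF h x]] .
  note dc = charts_atD[OF N d]
  let ?W = "overlap c d U h" and ?f = "loc_rep c d h"
  let ?S = "snd c ` ?W"
  have S: "openin (top_of_set (corner (mbasis M))) ?S"
    by (rule openin_chart_image_overlap[OF h cc(2) dc(2)])
  have xS: "snd c x \<in> ?S" using cc dc x by (auto simp: overlap_def)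
  have f: "smooth_on ?S ?f" using h cc(1) dc(1) by (simp add: smooth_into_def)
  \<comment> \<open>Separates the base point from the coordinate vectors: for fixed vectors this is
    a coefficient of \<open>\<omega>\<close> composed with \<open>h\<close>, while the derivative of
    \<open>h\<close> enters through the arguments.\<close>
  define \<Phi> where "\<Phi> = (\<lambda>q es. \<omega> (chart_inv d (?f q)) (map (coord_vec N d (chart_inv d (?f q))) es))"
  have W: "chart_inv c (snd c u) = u" "chart_inv d (?f (snd c u)) = h u" "u \<in> U" "h u \<in> fst d"
      "c \<in> charts_at M u" "d \<in> charts_at N (h u)" if "u \<in> ?W" for u
    using that cc(1) dc(1) by (auto simp: overlap_def loc_rep_def chart_inv_chart[OF cc(2)] chart_inv_chart[OF dc(2)] charts_at_def)
  have "smooth_at ?S (\<lambda>q. \<Phi> q (map (\<lambda>f. f q) (map (\<lambda>e q. frechet_derivative ?f (at q within ?S) e) es) @ [])) (snd c x)"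
  proof (rule smooth_at_multilinear[OF manifold_basis[OF N], where k = k])
    fix es' :: "'d list" assume es': "length es' = k"
    let ?w = "\<lambda>p. \<omega> (chart_inv d p) (map (coord_vec N d (chart_inv d p)) es')"
    have "smooth_at ?S (\<lambda>q. ?w (?f q)) (snd c x)"
    proof (rule smooth_at_compose[OF manifold_basis[OF N] xS])
      show "smooth_at ?S ?f (snd c x)" using f xS unfolding smooth_on_iff_smooth_at by blast
      have im: "?f q \<in> snd d ` fst d" if "q \<in> ?S" for q
        using that by (auto simp: loc_rep_def overlap_def chart_inv_chart[OF cc(2)])
      have "smooth_on (snd d ` fst d) ?w" using \<omega> dc(1) es' by (simp add: forms_def)
      then show "smooth_at (snd d ` fst d) ?w (?f (snd c x))"
        using im[OF xS] unfolding smooth_on_iff_smooth_at by blast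
      show "?f q \<in> snd d ` fst d" if "q \<in> ?S" for q using im that .
    qed
    then show "smooth_at ?S (\<lambda>q. \<Phi> q es') (snd c x)" by (simp add: \<Phi>_def)
  next
    fix f assume "f \<in> set (map (\<lambda>e q. frechet_derivative ?f (at q within ?S) e) es)"
    then show "smooth_at ?S f (snd c x)"
      using smooth_on_frechet_derivative(2)[OF manifold_basis[OF M] S f] xS
      by (auto simp: smooth_on_iff_smooth_at)
  next
    fix q and us vs :: "'d list" and a b u w
    assume "q \<in> ?S" and len: "Suc (length us + length vs) = k"
    then obtain v where v: "v \<in> ?W" "q = snd c v" by auto
    note dv = W(6)[OF v(1)]
    let ?C = "coord_vec N d (h v)"
    have C: "?C e \<in> tangent_space N (h v)" for e by (rule coord_vec_in[OF N dv])
    have "alt_form k (tangent_space N (h v)) (\<omega> (h v))"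
      using \<omega> charts_atD(4)[OF N dv] by (simp add: forms_def)
    \<comment> \<open>Multilinearity is phrased through list updates; the varying entry of
      \<open>us @ u # vs\<close> stands at position \<open>length us\<close>.\<close>
    from alt_form_lincomb[OF this, of "map ?C (us @ u # vs)" "length us" "?C u" "?C w" a b]
    have "\<omega> (h v) ((map ?C (us @ u # vs))[length us := (\<lambda>c. a *\<^sub>R ?C u c + b *\<^sub>R ?C w c)])
      = a * \<omega> (h v) ((map ?C (us @ u # vs))[length us := ?C u]) + b * \<omega> (h v) ((map ?C (us @ u # vs))[length us := ?C w])"
      using C len by auto
    then show "\<Phi> q (us @ (a *\<^sub>R u + b *\<^sub>R w) # vs) = a * \<Phi> q (us @ u # vs) + b * \<Phi> q (us @ w # vs)"
      unfolding \<Phi>_def v(2) W(2)[OF v(1)]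
      by (simp add: coord_vec_lincomb[OF N dv] list_update_append)
  qed (use es in simp)
  then have "smooth_at ?S (\<lambda>p. \<omega>' (chart_inv c p) (map (coord_vec M c (chart_inv c p)) es)) (snd c x)"
  proof (rule smooth_at_cong[of _ _ _ UNIV])
    fix q assume q: "q \<in> ?S"
    then obtain u where u: "u \<in> ?W" "q = snd c u" by auto
    note Wu = W[OF u(1)]
    have "set (map (coord_vec M c u) es) \<subseteq> tangent_space M u"
      using coord_vec_in[OF M Wu(5)] by auto
    then have "\<omega>' u (map (coord_vec M c u) es) = \<omega> (h u) (map (tdiff M N U h u) (map (coord_vec M c u) es))"
      using pull[OF Wu(3)] by blast
    also have "\<dots> = \<omega> (h u) (map (coord_vec N d (h u)) (map (germ_deriv U c d h u) es))"
      using tdiff_coord_vec[OF M N h Wu(3,5,6)] by (simp add: o_def)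
    also have "\<dots> = \<Phi> q (map (germ_deriv U c d h u) es)"
      by (simp add: \<Phi>_def u(2) Wu(2))
    finally show "q \<in> ?S \<and> \<Phi> q (map (\<lambda>f. f q) (map (\<lambda>e q. frechet_derivative ?f (at q within ?S) e) es) @ [])
        = \<omega>' (chart_inv c q) (map (coord_vec M c (chart_inv c q)) es)"
      using q u(2) Wu(1) by (simp add: o_def germ_deriv_def[abs_def])
  qed auto
  moreover have "?S \<subseteq> snd c ` fst c" by (auto simp: overlap_def)
  moreover have "snd c ` fst c \<subseteq> corner (mbasis M)"
    using cc(2) openin_subset[of "top_of_set (corner (mbasis M))" "snd c ` fst c"] by (auto simp: is_chart_def)
  ultimately show ?thesis using smooth_at_openin_localize[OF S _ _ _ xS] by blast
qed

lemma formsI: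
  assumes M: "manifold_with_corners M"
    and "\<And>x. x \<in> pts M \<Longrightarrow> alt_form k (tangent_space M x) (\<omega> x)"
    and "\<And>x vs. x \<notin> pts M \<Longrightarrow> \<omega> x vs = 0"
    and sm: "\<And>x c es. x \<in> pts M \<Longrightarrow> c \<in> charts_at M x \<Longrightarrow> length es = k \<Longrightarrow>
      smooth_at (snd c ` fst c) (\<lambda>p. \<omega> (chart_inv c p) (map (coord_vec M c (chart_inv c p)) es)) (snd c x)"
  shows "\<omega> \<in> forms k M"
proof -
  have "smooth_on (snd c ` fst c) (\<lambda>p. \<omega> (chart_inv c p) (map (coord_vec M c (chart_inv c p)) es))"
    if "c \<in> matlas M" "length es = k" for c es
    unfolding smooth_on_iff_smooth_at
  proof
    fix p assume "p \<in> snd c ` fst c"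
    then obtain x where x: "p = snd c x" "x \<in> fst c" by blast
    then have "c \<in> charts_at M x" using that(1) by (simp add: charts_at_def)
    from sm[OF charts_atD(4)[OF M this] this that(2)]
    show "smooth_at (snd c ` fst c) (\<lambda>p. \<omega> (chart_inv c p) (map (coord_vec M c (chart_inv c p)) es)) p"
      using x(1) by simp
  qed
  then show ?thesis using assms(2,3) by (auto simp: forms_def)
qed

lemma pull_forms:
  assumes M: "manifold_with_corners M" and N: "manifold_with_corners N" and h: "smooth_into M N (pts M) h"
    and \<omega>: "\<omega> \<in> forms k N"
  shows "pull M N h \<omega> \<in> forms k M"
proof (rule formsI[OF M])
  fix x assume x: "x \<in> pts M"
  have "alt_form k (tangent_space N (h x)) (\<omega> (h x))"
    using \<omega> smooth_intoD(4)[OF h x] by (simp add: forms_def)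
  then have "alt_form k (tangent_space M x)
      (\<lambda>vs. if set vs \<subseteq> tangent_space M x then \<omega> (h x) (map (differential M N h x) vs) else 0)"
    by (rule alt_form_pull)
       (rule differential_in[OF M N h x] differential_lincomb[OF M N h x] tangent_space_lincomb[OF M]; assumption?)+
  then show "alt_form k (tangent_space M x) (pull M N h \<omega> x)"
    using x by (simp add: pull_def[abs_def])
next
  fix x c and es :: "'b list" assume x: "x \<in> pts M" and c: "c \<in> charts_at M x" and es: "length es = k"
  show "smooth_at (snd c ` fst c) (\<lambda>p. pull M N h \<omega> (chart_inv c p) (map (coord_vec M c (chart_inv c p)) es)) (snd c x)"
    by (rule smooth_at_pull_germ[OF M N h x c \<omega> _ es]) (simp add: pull_def differential_eq_tdiff[OF M])
qed (simp add: pull_def)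

section \<open>Refinements\<close>

locale gpd_refinement = X: etale_groupoid X + Y: etale_groupoid Y
  for X :: "('a, 'm, 'e::real_inner) gpd" and Y :: "('b, 'n, 'f::real_inner) gpd" +
  fixes F0 :: "'a \<Rightarrow> 'b" and F1 :: "'m \<Rightarrow> 'n"
  assumes refinement: "refinement X Y F0 F1"
begin

section \<open>The refinement as an equivalence of categories\<close>

lemma F_functor: "gpd_functor X Y F0 F1"
  using refinement by (simp add: refinement_def smooth_functor_def)

lemma
  shows F0_in: "x \<in> obs X \<Longrightarrow> F0 x \<in> obs Y"
    and F1_in: "g \<in> mors X \<Longrightarrow> F1 g \<in> mors Y" and src_F1: "g \<in> mors X \<Longrightarrow> src Y (F1 g) = F0 (src X g)"
    and tgt_F1: "g \<in> mors X \<Longrightarrow> tgt Y (F1 g) = F0 (tgt X g)"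
  using F_functor by (simp_all add: gpd_functor_def)

lemmas F_simps = F0_in F1_in src_F1 tgt_F1

lemma F0_diffeo: "local_diffeo (Obj X) (Obj Y) F0"
  using refinement by (simp add: refinement_def)

lemmas F0_smooth = local_diffeo_smooth_into[OF X.obj Y.obj F0_diffeo]

lemma F1_smooth: "smooth_into (Mor X) (Mor Y) (mors X) F1"
  using refinement unfolding refinement_def smooth_functor_def smooth_map_iff_smooth_into[OF X.mor] by blast

lemma essentially_surjective:
  assumes "y \<in> obs Y"
  obtains z h where "z \<in> obs X" "h \<in> mors Y" "src Y h = F0 z" "tgt Y h = y"
proof -
  obtain G0 G1 \<epsilon> where "gpd_functor Y X G0 G1" "natural_iso Y Y (F0 \<circ> G0) (F1 \<circ> G1) id id \<epsilon>"
    using refinement unfolding refinement_def equivalence_of_categories_def by blast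
  then show thesis
    using assms that[of "G0 y" "\<epsilon> y"] by (simp add: gpd_functor_def natural_iso_def)
qed

text \<open>Naturality of \<open>\<eta>\<close> makes \<open>F1\<close> faithful and naturality of
  \<open>\<epsilon>\<close> makes \<open>G1\<close> faithful. For fullness, conjugating
  \<open>G1 k\<close> by \<open>\<eta>\<close> yields a morphism whose image under \<open>F1\<close>
  has the same \<open>G1\<close>-image as \<open>k\<close>.\<close>

lemma fully_faithful:
  assumes a: "a \<in> obs X" and b: "b \<in> obs X"
  shows "\<lbrakk>k \<in> mors Y; src Y k = F0 a; tgt Y k = F0 b\<rbrakk> \<Longrightarrow>
      \<exists>g\<in>mors X. src X g = a \<and> tgt X g = b \<and> F1 g = k"
    and "\<lbrakk>g \<in> mors X; g' \<in> mors X; src X g = a; src X g' = a; tgt X g = b; tgt X g' = b; F1 g = F1 g'\<rbrakk>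
      \<Longrightarrow> g = g'"
proof -
  obtain G0 G1 \<eta> \<epsilon> where G: "gpd_functor Y X G0 G1"
    and \<eta>': "natural_iso X X id id (G0 \<circ> F0) (G1 \<circ> F1) \<eta>"
    and \<epsilon>': "natural_iso Y Y (F0 \<circ> G0) (F1 \<circ> G1) id id \<epsilon>"
    using refinement unfolding refinement_def equivalence_of_categories_def by blast
  have \<eta>: "\<eta> x \<in> mors X" "src X (\<eta> x) = x" "tgt X (\<eta> x) = G0 (F0 x)" if "x \<in> obs X" for x
    using \<eta>' that by (auto simp: natural_iso_def)
  have \<eta>n: "comp X (G1 (F1 g)) (\<eta> (src X g)) = comp X (\<eta> (tgt X g)) g" if "g \<in> mors X" for g
    using \<eta>' that by (auto simp: natural_iso_def)
  have \<epsilon>: "\<epsilon> y \<in> mors Y" "src Y (\<epsilon> y) = F0 (G0 y)" "tgt Y (\<epsilon> y) = y" if "y \<in> obs Y" for y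
    using \<epsilon>' that by (auto simp: natural_iso_def)
  have \<epsilon>n: "comp Y k (\<epsilon> (src Y k)) = comp Y (\<epsilon> (tgt Y k)) (F1 (G1 k))" if "k \<in> mors Y" for k
    using \<epsilon>' that by (auto simp: natural_iso_def)
  have G1: "G1 k \<in> mors X" "src X (G1 k) = G0 (src Y k)" "tgt X (G1 k) = G0 (tgt Y k)" if "k \<in> mors Y" for k
    using G that by (auto simp: gpd_functor_def)
  show "g = g'" if g: "g \<in> mors X" "g' \<in> mors X" "src X g = a" "src X g' = a" "tgt X g = b" "tgt X g' = b" "F1 g = F1 g'"
  proof -
    have "comp X (\<eta> b) g = comp X (\<eta> b) g'" using \<eta>n[OF g(1)] \<eta>n[OF g(2)] unfolding g(3-7) by simp
    then show ?thesis
      by (intro X.comp_left_cancel[of "\<eta> b" g g']) (use \<eta>[OF b] g in auto)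
  qed
  have Gf: "k = k'" if k: "k \<in> mors Y" "k' \<in> mors Y" "src Y k = src Y k'" "tgt Y k = tgt Y k'" "G1 k = G1 k'" for k k'
  proof -
    note s = Y.src_in[OF k(1)]
    have "comp Y k (\<epsilon> (src Y k)) = comp Y k' (\<epsilon> (src Y k))"
      using \<epsilon>n[OF k(1)] \<epsilon>n[OF k(2)] unfolding k(3-5) by simp
    then show ?thesis
      by (intro Y.comp_right_cancel[of "\<epsilon> (src Y k)" k k']) (use \<epsilon>[OF s] k in auto)
  qed
  show "\<exists>g\<in>mors X. src X g = a \<and> tgt X g = b \<and> F1 g = k"
    if k: "k \<in> mors Y" "src Y k = F0 a" "tgt Y k = F0 b"
  proof -
    let ?c = "comp X (G1 k) (\<eta> a)"
    let ?g = "comp X (invm X (\<eta> b)) ?c"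
    have c: "?c \<in> mors X" "src X ?c = a" "tgt X ?c = G0 (F0 b)"
      using G1[OF k(1)] \<eta>[OF a] k by (simp_all add: X.gpd_simps)
    then have g: "?g \<in> mors X" "src X ?g = a" "tgt X ?g = b"
      using \<eta>[OF b] by (simp_all add: X.gpd_simps)
    have "comp X (\<eta> b) ?g = ?c" using X.comp_invm_cancel[of "\<eta> b" ?c] \<eta>[OF b] c by simp
    then have eq: "comp X (G1 (F1 ?g)) (\<eta> a) = ?c" using \<eta>n[OF g(1)] g by simp
    have "G1 (F1 ?g) = G1 k"
      by (rule X.comp_right_cancel[OF _ _ _ _ _ eq])
         (use \<eta>[OF a] G1[OF k(1)] G1[OF F1_in[OF g(1)]] k(2) src_F1[OF g(1)] g(2) in auto)
    then have "F1 ?g = k"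
      by (intro Gf) (use k g F1_in[OF g(1)] src_F1[OF g(1)] tgt_F1[OF g(1)] in auto)
    then show ?thesis using g by blast
  qed
qed

section \<open>Transport between X and Y\<close>

lemma transp_F1_differential:
  assumes g: "g \<in> mors X" and w: "w \<in> tangent_space (Obj X) (tgt X g)"
  shows "Y.transp (F1 g) (differential (Obj X) (Obj Y) F0 (tgt X g) w)
    = differential (Obj X) (Obj Y) F0 (src X g) (X.transp g w)"
proof -
  let ?v = "dinv (Mor X) (Obj X) (tgt X) g w"
  have v: "?v \<in> tangent_space (Mor X) g" using dinv_in[OF X.mor X.obj X.tgt_diffeo g w] .
  \<comment> \<open>The chain rule for a commuting square, used for both \<open>src\<close> and
    \<open>tgt\<close>; together the two squares show that the differential of \<open>F0\<close>
    intertwines the transports.\<close>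
  have sq: "differential (Obj X) (Obj Y) F0 (s g) (differential (Mor X) (Obj X) s g ?v)
      = differential (Mor Y) (Obj Y) s' (F1 g) (differential (Mor X) (Mor Y) F1 g ?v)"
    if s: "smooth_into (Mor X) (Obj X) (mors X) s" and s': "smooth_into (Mor Y) (Obj Y) (mors Y) s'"
      and eq: "\<And>g. g \<in> mors X \<Longrightarrow> F0 (s g) = s' (F1 g)" for s s'
  proof -
    have V: "{x \<in> mors X. s x \<in> obs X} = mors X" using smooth_intoD(4)[OF s] by blast
    have sm: "smooth_into (Mor X) (Obj Y) (mors X) (\<lambda>y. F0 (s y))"
      using smooth_into_compose[OF X.mor X.obj Y.obj s F0_smooth] unfolding V by (simp add: o_def)
    show ?thesis
      using differential_compose[OF X.mor X.obj Y.obj s F0_smooth g v]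
        differential_compose[OF X.mor Y.mor Y.obj F1_smooth s' g v]
        differential_cong[OF X.mor Y.obj sm g eq] by simp
  qed
  have "w = differential (Mor X) (Obj X) (tgt X) g ?v"
    using differential_dinv[OF X.mor X.obj X.tgt_diffeo g w] by simp
  then have "differential (Obj X) (Obj Y) F0 (tgt X g) w
      = differential (Mor Y) (Obj Y) (tgt Y) (F1 g) (differential (Mor X) (Mor Y) F1 g ?v)"
    using sq[OF X.tgt_smooth Y.tgt_smooth] tgt_F1 by simp
  then have "Y.transp (F1 g) (differential (Obj X) (Obj Y) F0 (tgt X g) w)
      = differential (Mor Y) (Obj Y) (src Y) (F1 g) (differential (Mor X) (Mor Y) F1 g ?v)"
    using Y.transp_differential_tgt[OF F1_in[OF g] differential_in[OF X.mor Y.mor F1_smooth g]] by simp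
  also have "\<dots> = differential (Obj X) (Obj Y) F0 (src X g) (differential (Mor X) (Obj X) (src X) g ?v)"
    using sq[OF X.src_smooth Y.src_smooth] src_F1 by simp
  finally show ?thesis by (simp add: X.transp_def)
qed

text \<open>The pairs \<open>(z, h)\<close> with \<open>src h = F0 z\<close> form the bibundle of
  \<open>F\<close>, on which \<open>X\<close> acts through precomposition with \<open>F1\<close>.
  \<open>lift z h\<close> is transport along such a pair, from the tangent space at
  \<open>tgt h\<close> to that at \<open>z\<close>.\<close>

definition lift :: "'a \<Rightarrow> 'n \<Rightarrow> ('b, 'f) tvec \<Rightarrow> ('a, 'e) tvec" where
  "lift z h w = dinv (Obj X) (Obj Y) F0 z (Y.transp h w)"

lemma
  assumes "z \<in> obs X" "h \<in> mors Y" "src Y h = F0 z"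
  shows lift_in: "lift z h w \<in> tangent_space (Obj X) z"
    and differential_lift: "differential (Obj X) (Obj Y) F0 z (lift z h w) = Y.transp h w"
proof -
  have t: "Y.transp h w \<in> tangent_space (Obj Y) (F0 z)" using Y.transp_in[OF assms(2)] assms(3) by metis
  show "lift z h w \<in> tangent_space (Obj X) z" "differential (Obj X) (Obj Y) F0 z (lift z h w) = Y.transp h w"
    using dinv_in[OF X.obj Y.obj F0_diffeo assms(1) t] differential_dinv[OF X.obj Y.obj F0_diffeo assms(1) t]
    by (simp_all add: lift_def)
qed

text \<open>Compatibility of this transport with the action: functoriality in \<open>Y\<close>
  splits off \<open>F1 g\<close>, whose transport corresponds under the differential of
  \<open>F0\<close> to transport along \<open>g\<close>.\<close>

lemma lift_comp:
  assumes g: "g \<in> mors X" and h: "h \<in> mors Y" "src Y h = F0 (tgt X g)"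
    and w: "w \<in> tangent_space (Obj Y) (tgt Y h)"
  shows "lift (src X g) (comp Y h (F1 g)) w = X.transp g (lift (tgt X g) h w)"
proof -
  note z = X.tgt_in[OF g]
  have "Y.transp (comp Y h (F1 g)) w = Y.transp (F1 g) (Y.transp h w)"
    by (rule Y.transp_comp) (use g h w in \<open>simp_all add: F_simps\<close>)
  also have "\<dots> = Y.transp (F1 g) (differential (Obj X) (Obj Y) F0 (tgt X g) (lift (tgt X g) h w))"
    using differential_lift[OF z h] by simp
  also have "\<dots> = differential (Obj X) (Obj Y) F0 (src X g) (X.transp g (lift (tgt X g) h w))"
    using transp_F1_differential[OF g lift_in[OF z h]] .
  finally show ?thesis
    using dinv_differential[OF X.obj Y.obj F0_diffeo X.src_in[OF g] X.transp_in[OF g]] by (simp add: lift_def)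
qed

lemma lift_idm:
  assumes "x \<in> obs X" "v \<in> tangent_space (Obj X) x"
  shows "lift x (idm Y (F0 x)) (differential (Obj X) (Obj Y) F0 x v) = v"
  using assms by (simp add: lift_def Y.transp_idm F0_in differential_in[OF X.obj Y.obj F0_smooth]
      dinv_differential[OF X.obj Y.obj F0_diffeo])

lemma lift_lincomb:
  assumes z: "z \<in> obs X" and h: "h \<in> mors Y" "src Y h = F0 z"
    and w: "v \<in> tangent_space (Obj Y) (tgt Y h)" "w \<in> tangent_space (Obj Y) (tgt Y h)"
  shows "lift z h (\<lambda>c. a *\<^sub>R v c + b *\<^sub>R w c) = (\<lambda>c. a *\<^sub>R lift z h v c + b *\<^sub>R lift z h w c)"
proof -
  have "Y.transp h u \<in> tangent_space (Obj Y) (F0 z)" for u using Y.transp_in[OF h(1)] h(2) by metis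
  then show ?thesis
    by (simp add: lift_def Y.transp_lincomb[OF h(1) w] dinv_lincomb[OF X.obj Y.obj F0_diffeo z])
qed

text \<open>The differential of \<open>F0\<close> cancels its inverse inside \<open>lift\<close>;
  what remains is transport along \<open>h\<close>, which preserves the invariant form
  \<open>\<eta>\<close>.\<close>

lemma pullback_lift:
  assumes \<eta>: "\<eta> \<in> gforms k Y" and z: "z \<in> obs X" and h: "h \<in> mors Y" "src Y h = F0 z"
    and ws: "set ws \<subseteq> tangent_space (Obj Y) (tgt Y h)"
  shows "pullback X Y F0 \<eta> z (map (lift z h) ws) = \<eta> (tgt Y h) ws"
proof -
  have "set (map (lift z h) ws) \<subseteq> tangent_space (Obj X) z" using lift_in[OF z h] by auto
  then have "pullback X Y F0 \<eta> z (map (lift z h) ws) = \<eta> (src Y h) (map (Y.transp h) ws)"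
    using z differential_lift[OF z h] h(2) by (simp add: pullback_def pull_def o_def)
  then show ?thesis using Y.gforms_transp[OF \<eta> h(1) ws] by simp
qed

lemma pullback_gforms:
  assumes \<eta>: "\<eta> \<in> gforms k Y"
  shows "pullback X Y F0 \<eta> \<in> gforms k X"
proof -
  have "pullback X Y F0 \<eta> \<in> forms k (Obj X)"
    unfolding pullback_def by (rule pull_forms[OF X.obj Y.obj F0_smooth]) (use \<eta> in \<open>simp add: gforms_def\<close>)
  moreover have "pull (Mor X) (Obj X) (src X) (pullback X Y F0 \<eta>) = pull (Mor X) (Obj X) (tgt X) (pullback X Y F0 \<eta>)"
  proof (intro ext)
    fix g vs
    show "pull (Mor X) (Obj X) (src X) (pullback X Y F0 \<eta>) g vs = pull (Mor X) (Obj X) (tgt X) (pullback X Y F0 \<eta>) g vs"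
    proof (cases "g \<in> mors X \<and> set vs \<subseteq> tangent_space (Mor X) g")
      case True
      then have g: "g \<in> mors X" and vs: "set vs \<subseteq> tangent_space (Mor X) g" by auto
      let ?ws = "map (differential (Mor X) (Obj X) (tgt X) g) vs"
      have ws: "set ?ws \<subseteq> tangent_space (Obj X) (tgt X g)"
        using differential_in[OF X.mor X.obj X.tgt_smooth g] by auto
      have us: "map (differential (Mor X) (Obj X) (src X) g) vs = map (X.transp g) ?ws"
        using X.transp_differential_tgt[OF g] vs by auto
      let ?D = "differential (Obj X) (Obj Y) F0"
      have Dws: "set (map (?D (tgt X g)) ?ws) \<subseteq> tangent_space (Obj Y) (tgt Y (F1 g))"
        using differential_in[OF X.obj Y.obj F0_smooth X.tgt_in[OF g]] tgt_F1[OF g] by auto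
      have "pull (Mor X) (Obj X) (src X) (pullback X Y F0 \<eta>) g vs = \<eta> (F0 (src X g)) (map (?D (src X g)) (map (X.transp g) ?ws))"
        using g vs X.map_transp_in[OF g, of ?ws] X.src_in[OF g] unfolding us[symmetric]
        by (simp add: pull_def pullback_def)
      also have "map (?D (src X g)) (map (X.transp g) ?ws) = map (Y.transp (F1 g)) (map (?D (tgt X g)) ?ws)"
        using transp_F1_differential[OF g] ws by auto
      also have "\<eta> (F0 (src X g)) \<dots> = \<eta> (F0 (tgt X g)) (map (?D (tgt X g)) ?ws)"
        using Y.gforms_transp[OF \<eta> F1_in[OF g] Dws] src_F1[OF g] tgt_F1[OF g] by metis
      also have "\<dots> = pull (Mor X) (Obj X) (tgt X) (pullback X Y F0 \<eta>) g vs"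
        using g vs ws X.tgt_in[OF g] by (simp add: pull_def pullback_def)
      finally show ?thesis .
    qed (auto simp: pull_def)
  qed
  ultimately show ?thesis by (simp add: gforms_def)
qed

text \<open>Transitivity of the action of \<open>X\<close> on the pairs over one target: fullness
  provides a preimage of \<open>h\<close> inverted and composed with \<open>h'\<close>.\<close>

lemma comparison_morphism:
  assumes "z \<in> obs X" "h \<in> mors Y" "src Y h = F0 z"
    and "z' \<in> obs X" "h' \<in> mors Y" "src Y h' = F0 z'" "tgt Y h' = tgt Y h"
  obtains g where "g \<in> mors X" "src X g = z'" "tgt X g = z" "h' = comp Y h (F1 g)"
proof -
  let ?k = "comp Y (invm Y h) h'"
  have "?k \<in> mors Y" "src Y ?k = F0 z'" "tgt Y ?k = F0 z" using assms by (simp_all add: Y.gpd_simps)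
  then obtain g where g: "g \<in> mors X" "src X g = z'" "tgt X g = z" "F1 g = ?k"
    using fully_faithful(1)[OF assms(4,1)] by blast
  moreover have "h' = comp Y h (F1 g)" using Y.comp_invm_cancel[of h h'] g(4) assms by simp
  ultimately show thesis using that by blast
qed

text \<open>
  The morphisms \<open>g\<close> to \<open>z\<close> correspond to the pairs of a morphism \<open>h' = h F\<^sub>1(g)\<close> to \<open>y\<close> and a point
  \<open>src g\<close> of the fibre of \<open>F\<^sub>0\<close> over its source, because \<open>F\<close> is fully faithful.
\<close>

lemma jform_push:
  assumes \<alpha>: "X.orbit_finite \<alpha>" and z: "z \<in> obs X" and h: "h \<in> mors Y" "src Y h = F0 z"
  shows "finite {h' \<in> mors Y. tgt Y h' = tgt Y h \<and> push (Obj X) (Obj Y) F0 \<alpha> (src Y h') \<noteq> (\<lambda>_. 0)}"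
    and "set ws \<subseteq> tangent_space (Obj Y) (tgt Y h) \<Longrightarrow>
      Y.jform (push (Obj X) (Obj Y) F0 \<alpha>) (tgt Y h) ws = X.jform \<alpha> z (map (lift z h) ws)"
proof -
  let ?G = "{g \<in> mors X. tgt X g = z \<and> \<alpha> (src X g) \<noteq> (\<lambda>_. 0)}"
  let ?p = "push (Obj X) (Obj Y) F0 \<alpha>"
  let ?j = "\<lambda>g. comp Y h (F1 g)"
  have fG: "finite ?G" using \<alpha> z by (simp add: X.orbit_finite_def)
  have j: "?j g \<in> mors Y" "src Y (?j g) = F0 (src X g)" "tgt Y (?j g) = tgt Y h" if "g \<in> ?G" for g
    using that h by (simp_all add: F_simps Y.gpd_simps)
  \<comment> \<open>An inclusion is all that can be expected: contributions within one fibre of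
    \<open>F0\<close> may cancel. The surplus morphisms add only zeros to the sum.\<close>
  have sub: "{h' \<in> mors Y. tgt Y h' = tgt Y h \<and> ?p (src Y h') \<noteq> (\<lambda>_. 0)} \<subseteq> ?j ` ?G"
  proof
    fix h' assume h': "h' \<in> {h' \<in> mors Y. tgt Y h' = tgt Y h \<and> ?p (src Y h') \<noteq> (\<lambda>_. 0)}"
    then have "?p (src Y h') \<noteq> (\<lambda>_. 0)" by simp
    then obtain z' where z': "z' \<in> obs X" "F0 z' = src Y h'" "\<alpha> z' \<noteq> (\<lambda>_. 0)" by (rule push_nonzeroE)
    obtain g where "g \<in> mors X" "src X g = z'" "tgt X g = z" "h' = ?j g"
      using comparison_morphism[OF z h z'(1), of h'] h' z'(2) by auto
    then show "h' \<in> ?j ` ?G" using z'(3) by blast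
  qed
  then show "finite {h' \<in> mors Y. tgt Y h' = tgt Y h \<and> ?p (src Y h') \<noteq> (\<lambda>_. 0)}"
    using fG finite_subset by blast
  assume ws: "set ws \<subseteq> tangent_space (Obj Y) (tgt Y h)"
  let ?u = "\<lambda>g. \<alpha> (src X g) (map (X.transp g) (map (lift z h) ws))"
  have "Y.jform ?p (tgt Y h) ws = (\<Sum>h'\<in>?j ` ?G. ?p (src Y h') (map (Y.transp h') ws))"
    by (rule Y.jform_eq[OF Y.tgt_in[OF h(1)] ws _ sub]) (use fG j in auto)
  \<comment> \<open>Several \<open>g\<close> may share one image \<open>?j g\<close>, namely one for
    each nonvanishing point in the fibre of \<open>F0\<close> over \<open>src h'\<close>; hence the
    sum is grouped by images.\<close>
  also have "\<dots> = (\<Sum>h'\<in>?j ` ?G. \<Sum>g\<in>{g \<in> ?G. ?j g = h'}. ?u g)"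
  proof (rule sum.cong[OF refl])
    fix h' assume "h' \<in> ?j ` ?G"
    then have h': "h' \<in> mors Y" "tgt Y h' = tgt Y h" using j by auto
    let ?Z = "{z' \<in> obs X. F0 z' = src Y h' \<and> \<alpha> z' \<noteq> (\<lambda>_. 0)}"
    let ?H = "{g \<in> ?G. ?j g = h'}"
    \<comment> \<open>Cancelling \<open>h\<close> equates the images under \<open>F1\<close>, and
      faithfulness then shows that each point of the fibre is counted once.\<close>
    have inj: "inj_on (src X) ?H"
    proof (rule inj_onI)
      fix g g' assume g: "g \<in> ?H" "g' \<in> ?H" "src X g = src X g'"
      have "F1 g = F1 g'"
        by (intro Y.comp_left_cancel[of h "F1 g" "F1 g'"]) (use g h in \<open>auto simp: F_simps\<close>)
      then show "g = g'"
        by (intro fully_faithful(2)[of "src X g" z g g']) (use g z X.src_in in auto)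
    qed
    have Z: "src X ` ?H = ?Z"
    proof (intro equalityI subsetI)
      fix z' assume "z' \<in> src X ` ?H"
      then show "z' \<in> ?Z" using j(2) X.src_in by fastforce
    next
      fix z' assume z': "z' \<in> ?Z"
      then obtain g where "g \<in> mors X" "src X g = z'" "tgt X g = z" "h' = ?j g"
        using comparison_morphism[OF z h, of z' h'] h' by auto
      then show "z' \<in> src X ` ?H" using z' by auto
    qed
    have "?p (src Y h') (map (Y.transp h') ws) = (\<Sum>z'\<in>?Z. \<alpha> z' (map (lift z' h') ws))"
      using push_eq[OF Y.src_in[OF h'(1)] Y.map_transp_in[OF h'(1)]] by (simp add: lift_def[abs_def] o_def)
    also have "\<dots> = (\<Sum>g\<in>?H. \<alpha> (src X g) (map (lift (src X g) h') ws))"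
      unfolding Z[symmetric] using sum.reindex[OF inj] by simp
    also have "\<dots> = (\<Sum>g\<in>?H. ?u g)"
    proof (rule sum.cong[OF refl])
      fix g assume g: "g \<in> ?H"
      then have "map (lift (src X g) h') ws = map (X.transp g) (map (lift z h) ws)"
        using lift_comp[of g h] h ws by auto
      then show "\<alpha> (src X g) (map (lift (src X g) h') ws) = ?u g" by (rule arg_cong)
    qed
    finally show "?p (src Y h') (map (Y.transp h') ws) = (\<Sum>g\<in>?H. ?u g)" .
  qed
  also have "\<dots> = (\<Sum>g\<in>?G. ?u g)" by (rule sum.image_gen[OF fG, symmetric])
  also have "\<dots> = X.jform \<alpha> z (map (lift z h) ws)"
    by (rule X.jform_eq[OF z _ fG, symmetric]) (use lift_in[OF z h] in auto)
  finally show "Y.jform ?p (tgt Y h) ws = X.jform \<alpha> z (map (lift z h) ws)" .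
qed

text \<open>By essential surjectivity every point of \<open>Y\<close> is the target in some pair
  \<open>(z, h)\<close>, so an invariant form is determined by its pull-back read through the
  lifts.\<close>

lemma gforms_eqI:
  assumes "\<eta> \<in> gforms k Y" "\<And>y ws. y \<notin> obs Y \<or> \<not> set ws \<subseteq> tangent_space (Obj Y) y \<Longrightarrow> \<eta>' y ws = 0"
    and "\<And>z h ws. \<lbrakk>z \<in> obs X; h \<in> mors Y; src Y h = F0 z; set ws \<subseteq> tangent_space (Obj Y) (tgt Y h)\<rbrakk> \<Longrightarrow>
      \<eta>' (tgt Y h) ws = pullback X Y F0 \<eta> z (map (lift z h) ws)"
  shows "\<eta>' = \<eta>"
proof (intro ext)
  fix y ws
  show "\<eta>' y ws = \<eta> y ws"
  proof (cases "y \<in> obs Y \<and> set ws \<subseteq> tangent_space (Obj Y) y")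
    case True
    obtain z h where z: "z \<in> obs X" "h \<in> mors Y" "src Y h = F0 z" "tgt Y h = y"
      by (rule essentially_surjective) (use True in blast)
    show ?thesis
      using assms(3)[OF z(1-3)] pullback_lift[OF assms(1) z(1-3)] True z(4) by simp
  next
    case False
    then show ?thesis using assms(2) Y.gforms_outside[OF assms(1)] by metis
  qed
qed

lemma pushforward_pullback:
  assumes \<rho>: "partition_of_unity X \<rho>" and \<eta>: "\<eta> \<in> gforms k Y"
  shows "pushforward k X Y F0 \<rho> (pullback X Y F0 \<eta>) = \<eta>"
proof -
  let ?\<xi> = "pullback X Y F0 \<eta>"
  let ?C = "pushforward_cl k X Y F0 (K_map k X \<rho> ?\<xi>)"
  note pou = X.partition_of_unity_mult[OF \<rho> pullback_gforms[OF \<eta>]]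
  have J: "Y.jform \<theta> = \<eta>" if \<theta>C: "\<theta> \<in> ?C" for \<theta>
  proof -
    obtain \<alpha> where \<alpha>: "\<alpha> \<in> clean_coset k X (fun_mult \<rho> ?\<xi>)"
      and \<theta>: "\<theta> \<in> clean_coset k Y (push (Obj X) (Obj Y) F0 \<alpha>)"
      using \<theta>C unfolding pushforward_cl_def K_map_def by blast
    \<comment> \<open>An arbitrary representative need not be \<open>fun_mult \<rho> ?\<xi>\<close>
      itself, but it has the same \<open>J\<close>-value, and \<open>jform_push\<close> depends on
      the representative only through this value.\<close>
    have fin: "X.orbit_finite \<alpha>" and J\<alpha>: "X.jform \<alpha> = ?\<xi>"
      using \<alpha> X.jform_push_diff[OF _ pou(1)] pou(2) by (auto simp: clean_coset_def)
    have "Y.orbit_finite (push (Obj X) (Obj Y) F0 \<alpha>)"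
      unfolding Y.orbit_finite_def
    proof
      fix y assume "y \<in> obs Y"
      then obtain z h where z: "z \<in> obs X" "h \<in> mors Y" "src Y h = F0 z" "tgt Y h = y"
        by (rule essentially_surjective)
      then show "finite {h \<in> mors Y. tgt Y h = y \<and> push (Obj X) (Obj Y) F0 \<alpha> (src Y h) \<noteq> (\<lambda>_. 0)}"
        using jform_push(1)[OF fin z(1-3)] by simp
    qed
    then have "Y.jform \<theta> = Y.jform (push (Obj X) (Obj Y) F0 \<alpha>)"
      using \<theta> Y.jform_push_diff(2) by (auto simp: clean_coset_def)
    also have "\<dots> = \<eta>"
      by (rule gforms_eqI[OF \<eta>]) (use Y.jform_outside jform_push(2)[OF fin] J\<alpha> in auto)
    finally show ?thesis .
  qed
  have "?C \<noteq> {}"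
    using X.zero_clean_forms_mors Y.zero_clean_forms_mors
    by (auto simp: pushforward_cl_def K_map_def clean_coset_def)
  then have "Y.jform ` ?C = {\<eta>}" using J by auto
  then have "the_elem (Y.jform ` ?C) = \<eta>" by simp
  then show ?thesis
    by (simp add: pushforward_def J_map_def Y.jform_def[abs_def])
qed

section \<open>Descent of invariant forms along F\<close>

definition descent :: "('a, 'e) form \<Rightarrow> ('b, 'f) form" where
  "descent \<xi> = (\<lambda>y ws.
     if y \<in> obs Y \<and> set ws \<subseteq> tangent_space (Obj Y) y
     then (let (z, h) = (SOME (z, h). z \<in> obs X \<and> h \<in> mors Y \<and> src Y h = F0 z \<and> tgt Y h = y)
           in \<xi> z (map (lift z h) ws))
     else 0)"

text \<open>Frees \<open>descent\<close> from its pointwise choice of \<open>(z, h)\<close>: the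
  chosen pair differs from the given one by a morphism of \<open>X\<close>, under whose transport
  \<open>\<xi>\<close> is invariant.\<close>

lemma descent_eq:
  assumes \<xi>: "\<xi> \<in> gforms k X" and z: "z \<in> obs X" and h: "h \<in> mors Y" "src Y h = F0 z"
    and ws: "set ws \<subseteq> tangent_space (Obj Y) (tgt Y h)"
  shows "descent \<xi> (tgt Y h) ws = \<xi> z (map (lift z h) ws)"
proof -
  let ?P = "\<lambda>(z', h'). z' \<in> obs X \<and> h' \<in> mors Y \<and> src Y h' = F0 z' \<and> tgt Y h' = tgt Y h"
  obtain z' h' where e: "(SOME p. ?P p) = (z', h')" by fastforce
  have "?P (SOME p. ?P p)" by (rule someI[of ?P "(z, h)"]) (use z h in simp)
  then have p: "z' \<in> obs X" "h' \<in> mors Y" "src Y h' = F0 z'" "tgt Y h' = tgt Y h" unfolding e by auto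
  obtain g where g: "g \<in> mors X" "src X g = z'" "tgt X g = z" "h' = comp Y h (F1 g)"
    using comparison_morphism[OF z h p] .
  have "descent \<xi> (tgt Y h) ws = \<xi> z' (map (lift z' h') ws)"
    using ws Y.tgt_in[OF h(1)] e by (simp add: descent_def)
  also have "map (lift z' h') ws = map (X.transp g) (map (lift z h) ws)"
    using lift_comp[OF g(1) h(1)] g h(2) ws by auto
  also have "\<xi> z' \<dots> = \<xi> z (map (lift z h) ws)"
    using X.gforms_transp[OF \<xi> g(1), of "map (lift z h) ws"] lift_in[OF z h] g by auto
  finally show ?thesis .
qed

text \<open>Near \<open>y\<close> the descended form is the pull-back along the germ \<open>F\<^sub>0\<inverse> \<circ> src \<circ> tgt\<inverse>\<close>.\<close>

lemma descent_germ:
  assumes z: "z \<in> obs X" and h: "h \<in> mors Y" "src Y h = F0 z"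
  obtains W \<psi> where "smooth_into (Obj Y) (Obj X) W \<psi>" "tgt Y h \<in> W"
    "\<And>\<xi> k y ws. \<lbrakk>\<xi> \<in> gforms k X; y \<in> W; set ws \<subseteq> tangent_space (Obj Y) y\<rbrakk> \<Longrightarrow>
      descent \<xi> y ws = \<xi> (\<psi> y) (map (tdiff (Obj Y) (Obj X) W \<psi> y) ws)"
proof -
  obtain U V \<tau> where \<tau>: "local_inverse (Mor Y) (Obj Y) (tgt Y) U V \<tau>" "h \<in> U"
    by (rule local_diffeo_local_inverse[OF Y.mor Y.obj Y.tgt_diffeo h(1)])
  obtain U' V' \<gamma> where \<gamma>: "local_inverse (Obj X) (Obj Y) F0 U' V' \<gamma>" "z \<in> U'"
    by (rule local_diffeo_local_inverse[OF X.obj Y.obj F0_diffeo z])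
  have \<tau>i: "\<tau> y \<in> U" "\<tau> y \<in> mors Y" "tgt Y (\<tau> y) = y" if "y \<in> V" for y
    using \<tau>(1) that smooth_intoD(2) by (fastforce simp: local_inverse_def)+
  have \<gamma>i: "\<gamma> y \<in> U'" "\<gamma> y \<in> obs X" "F0 (\<gamma> y) = y" if "y \<in> V'" for y
    using \<gamma>(1) that smooth_intoD(2) by (fastforce simp: local_inverse_def)+
  have s\<gamma>: "smooth_into (Obj Y) (Obj X) V' \<gamma>" using \<gamma>(1) by (simp add: local_inverse_def)
  let ?\<phi> = "src Y \<circ> \<tau>"
  have s\<phi>: "smooth_into (Obj Y) (Obj Y) V ?\<phi>"
    by (rule Y.transp_germ_smooth[OF \<tau>(1)])
  let ?W = "{y \<in> V. ?\<phi> y \<in> V'}"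
  show thesis
  proof (rule that)
    show "smooth_into (Obj Y) (Obj X) ?W (\<gamma> \<circ> ?\<phi>)"
      by (rule smooth_into_compose[OF Y.obj Y.obj X.obj s\<phi> s\<gamma>])
    show "tgt Y h \<in> ?W" using \<tau> \<gamma> h by (auto simp: local_inverse_def)
    fix \<xi> k y ws
    assume \<xi>: "\<xi> \<in> gforms k X" and y: "y \<in> ?W" and ws: "set ws \<subseteq> tangent_space (Obj Y) y"
    \<comment> \<open>The choices hidden in \<open>descent\<close> are unrelated at different
      points, so they are replaced near the given point by the pairs \<open>(?z, ?h)\<close>, which
      vary smoothly with \<open>y\<close>.\<close>
    let ?h = "\<tau> y" and ?z = "\<gamma> (?\<phi> y)"
    have yV: "y \<in> V" "?\<phi> y \<in> V'" using y by auto
    note hh = \<tau>i[OF yV(1)] and zz = \<gamma>i[OF yV(2)]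
    have src: "src Y ?h = F0 ?z" using zz by simp
    have "lift ?z ?h w = tdiff (Obj Y) (Obj X) ?W (\<gamma> \<circ> ?\<phi>) y w" if w: "w \<in> tangent_space (Obj Y) y" for w
    proof -
      have w': "w \<in> tangent_space (Obj Y) (tgt Y ?h)" using w hh by simp
      have t: "Y.transp ?h w \<in> tangent_space (Obj Y) (F0 ?z)" using Y.transp_in[OF hh(2)] src by metis
      have "lift ?z ?h w = tdiff (Obj Y) (Obj X) V' \<gamma> (?\<phi> y) (Y.transp ?h w)"
        using dinv_eq_tdiff[OF X.obj Y.obj F0_smooth \<gamma>(1) zz(1) t] zz(3) by (simp add: lift_def)
      also have "Y.transp ?h w = tdiff (Obj Y) (Obj Y) V ?\<phi> y w"
        using Y.transp_eq_tdiff[OF \<tau>(1) hh(1) w'] hh(3) by simp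
      finally show ?thesis
        using tdiff_compose[OF Y.obj Y.obj X.obj s\<phi> s\<gamma> yV w] by metis
    qed
    then have "map (lift ?z ?h) ws = map (tdiff (Obj Y) (Obj X) ?W (\<gamma> \<circ> ?\<phi>) y) ws" using ws by auto
    then show "descent \<xi> y ws = \<xi> ((\<gamma> \<circ> ?\<phi>) y) (map (tdiff (Obj Y) (Obj X) ?W (\<gamma> \<circ> ?\<phi>) y) ws)"
      using descent_eq[OF \<xi> zz(2) hh(2) src, of ws] ws unfolding hh(3) by (simp only: o_apply)
  qed
qed

lemma descent_gforms:
  assumes \<xi>: "\<xi> \<in> gforms k X"
  shows "descent \<xi> \<in> gforms k Y"
proof -
  have \<xi>f: "\<xi> \<in> forms k (Obj X)" using \<xi> by (simp add: gforms_def)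
  have "descent \<xi> \<in> forms k (Obj Y)"
  proof (rule formsI[OF Y.obj])
    fix y assume y: "y \<in> obs Y"
    obtain z h where z: "z \<in> obs X" and h: "h \<in> mors Y" "src Y h = F0 z" "tgt Y h = y"
      by (rule essentially_surjective[OF y])
    have "alt_form k (tangent_space (Obj X) z) (\<xi> z)" using \<xi>f z by (simp add: forms_def)
    then have "alt_form k (tangent_space (Obj Y) y) (\<lambda>vs. if set vs \<subseteq> tangent_space (Obj Y) y then \<xi> z (map (lift z h) vs) else 0)"
      by (rule alt_form_pull)
         (rule lift_in[OF z h(1,2)] lift_lincomb[OF z h(1,2), unfolded h(3)] tangent_space_lincomb[OF Y.obj]; assumption?)+
    moreover have "descent \<xi> y = (\<lambda>vs. if set vs \<subseteq> tangent_space (Obj Y) y then \<xi> z (map (lift z h) vs) else 0)"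
      using descent_eq[OF \<xi> z h(1,2)] h(3) by (auto simp: descent_def)
    ultimately show "alt_form k (tangent_space (Obj Y) y) (descent \<xi> y)" by simp
  next
    fix y c and es :: "'f list" assume y: "y \<in> obs Y" and c: "c \<in> charts_at (Obj Y) y" and es: "length es = k"
    obtain z h where z: "z \<in> obs X" and h: "h \<in> mors Y" "src Y h = F0 z" "tgt Y h = y"
      by (rule essentially_surjective[OF y])
    obtain W \<psi> where W: "smooth_into (Obj Y) (Obj X) W \<psi>" "tgt Y h \<in> W"
      "\<And>y ws. \<lbrakk>y \<in> W; set ws \<subseteq> tangent_space (Obj Y) y\<rbrakk> \<Longrightarrow>
        descent \<xi> y ws = \<xi> (\<psi> y) (map (tdiff (Obj Y) (Obj X) W \<psi> y) ws)"
      using descent_germ[OF z h(1,2)] \<xi> by metis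
    show "smooth_at (snd c ` fst c) (\<lambda>p. descent \<xi> (chart_inv c p) (map (coord_vec (Obj Y) c (chart_inv c p)) es)) (snd c y)"
      by (rule smooth_at_pull_germ[OF Y.obj X.obj W(1) _ c \<xi>f W(3) es]) (use W(2) h(3) in auto)
  qed (simp add: descent_def)
  moreover have "pull (Mor Y) (Obj Y) (src Y) (descent \<xi>) = pull (Mor Y) (Obj Y) (tgt Y) (descent \<xi>)"
  proof (intro ext)
    fix g vs
    show "pull (Mor Y) (Obj Y) (src Y) (descent \<xi>) g vs = pull (Mor Y) (Obj Y) (tgt Y) (descent \<xi>) g vs"
    proof (cases "g \<in> mors Y \<and> set vs \<subseteq> tangent_space (Mor Y) g")
      case True
      then have g: "g \<in> mors Y" and vs: "set vs \<subseteq> tangent_space (Mor Y) g" by auto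
      obtain z h where z: "z \<in> obs X" and h: "h \<in> mors Y" "src Y h = F0 z" "tgt Y h = src Y g"
        by (rule essentially_surjective[OF Y.src_in[OF g]])
      let ?us = "map (differential (Mor Y) (Obj Y) (src Y) g) vs"
      let ?ws = "map (differential (Mor Y) (Obj Y) (tgt Y) g) vs"
      \<comment> \<open>Pairs over both ends of \<open>g\<close> are taken with the same
        \<open>z\<close>: \<open>h\<close> over the source and \<open>?k\<close> over the target.
        Functoriality turns both sides into one and the same value of \<open>\<xi>\<close> at
        \<open>z\<close>.\<close>
      let ?k = "comp Y g h"
      have k: "?k \<in> mors Y" "src Y ?k = F0 z" "tgt Y ?k = tgt Y g" using g h by (simp_all add: Y.gpd_simps)
      have us: "set ?us \<subseteq> tangent_space (Obj Y) (tgt Y h)"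
        using differential_in[OF Y.mor Y.obj Y.src_smooth g] h(3) by auto
      have ws: "set ?ws \<subseteq> tangent_space (Obj Y) (tgt Y g)"
        using differential_in[OF Y.mor Y.obj Y.tgt_smooth g] by auto
      have "lift z ?k w = lift z h (Y.transp g w)" if "w \<in> tangent_space (Obj Y) (tgt Y g)" for w
        using Y.transp_comp[OF g h(1) h(3)[symmetric] that] by (simp add: lift_def)
      then have "map (lift z ?k) ?ws = map (lift z h) (map (Y.transp g) ?ws)" using ws by auto
      also have "map (Y.transp g) ?ws = ?us" using Y.transp_differential_tgt[OF g] vs by auto
      finally have "descent \<xi> (src Y g) ?us = descent \<xi> (tgt Y g) ?ws"
        using descent_eq[OF \<xi> z h(1,2) us] descent_eq[OF \<xi> z k(1,2), of ?ws] ws unfolding h(3) k(3) by metis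
      then show ?thesis using g vs by (simp add: pull_def)
    qed (auto simp: pull_def)
  qed
  ultimately show ?thesis by (simp add: gforms_def)
qed

text \<open>At \<open>F0 x\<close> the pair consisting of \<open>x\<close> and an identity is
  available, and lifting along it undoes the differential of \<open>F0\<close>.\<close>

lemma pullback_descent:
  assumes \<xi>: "\<xi> \<in> gforms k X"
  shows "pullback X Y F0 (descent \<xi>) = \<xi>"
proof (intro ext)
  fix x vs
  show "pullback X Y F0 (descent \<xi>) x vs = \<xi> x vs"
  proof (cases "x \<in> obs X \<and> set vs \<subseteq> tangent_space (Obj X) x")
    case True
    then have x: "x \<in> obs X" and vs: "set vs \<subseteq> tangent_space (Obj X) x" by auto
    let ?ws = "map (differential (Obj X) (Obj Y) F0 x) vs"
    note i = Y.idm_in[OF F0_in[OF x]] Y.src_idm[OF F0_in[OF x]] Y.tgt_idm[OF F0_in[OF x]]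
    have "set ?ws \<subseteq> tangent_space (Obj Y) (F0 x)"
      using differential_in[OF X.obj Y.obj F0_smooth x] by auto
    then have "descent \<xi> (F0 x) ?ws = \<xi> x (map (lift x (idm Y (F0 x))) ?ws)"
      using descent_eq[OF \<xi> x i(1,2), of ?ws] i(3) by simp
    also have "map (lift x (idm Y (F0 x))) ?ws = vs"
      using lift_idm[OF x] vs by (auto intro!: map_idI)
    finally show ?thesis using x vs by (simp add: pullback_def pull_def)
  next
    case False
    then show ?thesis using X.gforms_outside[OF \<xi>, of x vs] by (auto simp: pullback_def pull_def)
  qed
qed

lemma linear_iso_pullback: "linear_iso (gforms k Y) (gforms k X) (pullback X Y F0)"
  unfolding linear_iso_def
proof (intro conjI ballI allI)
  show "bij_betw (pullback X Y F0) (gforms k Y) (gforms k X)"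
    unfolding bij_betw_def
  proof
    show "inj_on (pullback X Y F0) (gforms k Y)"
    proof (rule inj_onI)
      fix \<eta> \<eta>' assume e: "\<eta> \<in> gforms k Y" "\<eta>' \<in> gforms k Y" "pullback X Y F0 \<eta> = pullback X Y F0 \<eta>'"
      show "\<eta> = \<eta>'"
        by (rule gforms_eqI[OF e(2)]) (use Y.gforms_outside[OF e(1)] pullback_lift[OF e(1)] e(3) in auto)
    qed
    show "pullback X Y F0 ` gforms k Y = gforms k X"
      using pullback_gforms descent_gforms pullback_descent by (auto simp: image_iff) metis
  qed
qed (intro ext; simp add: pullback_def pull_def form_add_def form_scale_def)+

end

theorem lemma4p17:
  fixes X :: "('a, 'm, 'e::real_inner) gpd" and Y :: "('b, 'n, 'f::real_inner) gpd"
    and F0 :: "'a \<Rightarrow> 'b" and F1 :: "'m \<Rightarrow> 'n"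
  assumes "etale_proper_groupoid X" and "etale_proper_groupoid Y"
    and "refinement X Y F0 F1"
  shows "\<forall>k. linear_iso (gforms k Y) (gforms k X) (pullback X Y F0) \<and>
           (\<forall>\<rho>. partition_of_unity X \<rho> \<longrightarrow>
              (\<forall>\<xi>\<in>gforms k X. pushforward k X Y F0 \<rho> \<xi> \<in> gforms k Y) \<and>
              (\<forall>\<eta>\<in>gforms k Y. pushforward k X Y F0 \<rho> (pullback X Y F0 \<eta>) = \<eta>) \<and>
              (\<forall>\<xi>\<in>gforms k X. pullback X Y F0 (pushforward k X Y F0 \<rho> \<xi>) = \<xi>))"
proof -
  interpret gpd_refinement X Y F0 F1
    using assms by unfold_locales
  \<comment> \<open>Writing \<open>\<xi>\<close> as the pull-back of its descent reduces the
    push-forward of an arbitrary invariant form to the case already computed.\<close>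
  have "pushforward k X Y F0 \<rho> \<xi> = descent \<xi>" if "partition_of_unity X \<rho>" "\<xi> \<in> gforms k X" for k \<rho> \<xi>
    using pushforward_pullback[OF that(1) descent_gforms[OF that(2)]] pullback_descent[OF that(2)] by simp
  then show ?thesis
    using linear_iso_pullback pushforward_pullback descent_gforms pullback_descent by auto
qed

end
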